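(* Let $\alpha>0$ and let $A$ be a bounded linear operator on $F^2_\alpha$. Then the following assertions hold. (a) The operator $A$ is of the form $A=T_f$ with $f\in L^\infty(\mathbb C,dA)$ if and only if $H_0^A\in L^2(\mathbb C,dA)$ and the function defined a.e. by $$f_A^{(0)}(u):=\frac{\pi}{\alpha}\,e^{\alpha|u|^2}\bigl(\mathcal F_\alpha^{-1}H_0^A\bigr)(u)$$ belongs to $L^\infty(\mathbb C,dA)$. In that case $A=T_{f_A^{(0)}}$, and the bounded Toeplitz symbol is unique almost everywhere (i.e. if $A=T_f=T_g$ with $f,g\in L^\infty(\mathbb C,dA)$, then $f=g$ a.e.). (b) The operator $A$ is of the form $A=T_f$ for some $f\in L^\infty(\mathbb C,dA)$ if and only if $H_1^A\in L^2(\mathbb C,dA)$, the a.e. defined function on $\mathbb C$ given by $$f_A^{(1)}(u):=\frac{1}{\bar u}\,\frac{\pi}{\alpha^2}\,e^{\alpha|u|^2}\bigl(\mathcal F_\alpha^{-1}H_1^A\bigr)(u),\qquad u\neq 0,$$ belongs to $L^\infty(\mathbb C,dA)$, and it satisfies the origin functional identity $$Ah(0)=T_{f_A^{(1)}}h(0)\qquad\text{for all } h\in F^2_\alpha .$$ In that case $A=T_{f_A^{(1)}}$, and the bounded Toeplitz symbol is unique almost everywhere.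
   Context: Fix $\alpha>0$. Let $dA$ denote Lebesgue area measure on $\mathbb C$, $d\lambda_\alpha(z)=\frac{\alpha}{\pi}e^{-\alpha|z|^2}dA(z)$, and let $F^2_\alpha$ be the Fock space of all entire functions in $L^2(\mathbb C,d\lambda_\alpha)$, with inner product $\langle h,k\rangle_\alpha=\int_{\mathbb C}h\,\overline{k}\,d\lambda_\alpha$. Its reproducing kernel is $K_w(z)=e^{\alpha z\bar w}$. For $f\in L^\infty(\mathbb C,dA)$ the Toeplitz operator $T_f$ on $F^2_\alpha$ is the bounded operator $$T_fh(z)=\frac{\alpha}{\pi}\int_{\mathbb C}f(u)h(u)e^{\alpha z\bar u-\alpha|u|^2}\,dA(u),$$ that is, $T_fh=P(fh)$ with $P$ the orthogonal projection of $L^2(\mathbb C,d\lambda_\alpha)$ onto $F^2_\alpha$; it depends only on the a.e. class of $f$. For a bounded operator $A$ on $F^2_\alpha$, the canonical kernel is $\mathcal K_A(w,z)=\langle AK_w,K_z\rangle_\alpha=(AK_w)(z)$, which is anti-entire in $w$ and entire in $z$. Set $$H_0^A(w)=\mathcal K_A(w,-w),\qquad H_1^A(w)=\partial_z\mathcal K_A(w,z)\big|_{z=-w}.$$ The Fourier transform $\mathcal F_\alpha$ is defined for $G\in L^1(\mathbb C,dA)$ by $$(\mathcal F_\alpha G)(w)=\int_{\mathbb C}G(u)e^{\alpha(u\bar w-\bar u w)}\,dA(u),$$ and extends from $L^1\cap L^2$ to a bijective bounded operator on $L^2(\mathbb C,dA)$ with $\|\mathcal F_\alpha G\|_{L^2}=\frac{\pi}{\alpha}\|G\|_{L^2}$.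 Its inverse on $L^2(\mathbb C,dA)$ is the $L^2$-continuous extension of $(\mathcal F_\alpha^{-1}H)(u)=\frac{\alpha^2}{\pi^2}\int_{\mathbb C}H(w)e^{-\alpha u\bar w+\alpha\bar u w}\,dA(w)$ (valid e.g. for Schwartz functions $H$). *)

theory Defs
  imports "HOL-Analysis.Analysis"
begin

section \<open>Lebesgue spaces of complex-valued functions\<close>

text \<open>The elements are functions rather than classes of functions modulo null sets; equality of
  classes is written out as almost-everywhere equality.\<close>

definition L1 :: "'a measure \<Rightarrow> ('a \<Rightarrow> complex) set" where
  "L1 M = {f. integrable M f}"

definition L2 :: "'a measure \<Rightarrow> ('a \<Rightarrow> complex) set" where
  "L2 M = {f. f \<in> borel_measurable M \<and> integrable M (\<lambda>x. (norm (f x))\<^sup>2)}"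

definition Linf :: "'a measure \<Rightarrow> ('a \<Rightarrow> complex) set" where
  "Linf M = {f. f \<in> borel_measurable M \<and> (\<exists>C::real. AE x in M. norm (f x) \<le> C)}"

text \<open>The nonnegative integral is used because the Bochner integral of a non-integrable function
  is 0.\<close>

definition L2_tendsto :: "'a measure \<Rightarrow> (nat \<Rightarrow> 'a \<Rightarrow> complex) \<Rightarrow> ('a \<Rightarrow> complex) \<Rightarrow> bool" where
  "L2_tendsto M F G \<longleftrightarrow>
     (\<lambda>n. \<integral>\<^sup>+ x. ennreal ((norm (F n x - G x))\<^sup>2) \<partial>M) \<longlonglongrightarrow> 0"

section \<open>The Fock space\<close>

definition fock_measure :: "real \<Rightarrow> complex measure" where
  "fock_measure \<alpha> =
     density lebesgue (\<lambda>z. ennreal (\<alpha> / pi * exp (- \<alpha> * (norm z)\<^sup>2)))"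

definition fock_space :: "real \<Rightarrow> (complex \<Rightarrow> complex) set" where
  "fock_space \<alpha> = {h. h holomorphic_on UNIV \<and> h \<in> L2 (fock_measure \<alpha>)}"

definition fock_inner :: "real \<Rightarrow> (complex \<Rightarrow> complex) \<Rightarrow> (complex \<Rightarrow> complex) \<Rightarrow> complex" where
  "fock_inner \<alpha> h k = (LINT z|fock_measure \<alpha>. h z * cnj (k z))"

definition fock_norm :: "real \<Rightarrow> (complex \<Rightarrow> complex) \<Rightarrow> real" where
  "fock_norm \<alpha> h = sqrt (Re (fock_inner \<alpha> h h))"

definition fock_kernel :: "real \<Rightarrow> complex \<Rightarrow> complex \<Rightarrow> complex" where
  "fock_kernel \<alpha> w z = exp (of_real \<alpha> * z * cnj w)"

text \<open>An operator is a map on all functions of which only the restriction to the Fock space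
  matters.\<close>

definition fock_bounded_operator ::
    "real \<Rightarrow> ((complex \<Rightarrow> complex) \<Rightarrow> (complex \<Rightarrow> complex)) \<Rightarrow> bool" where
  "fock_bounded_operator \<alpha> A \<longleftrightarrow>
     (\<forall>h\<in>fock_space \<alpha>. A h \<in> fock_space \<alpha>) \<and>
     (\<forall>h\<in>fock_space \<alpha>. \<forall>k\<in>fock_space \<alpha>. A (\<lambda>z. h z + k z) = (\<lambda>z. A h z + A k z)) \<and>
     (\<forall>c. \<forall>h\<in>fock_space \<alpha>. A (\<lambda>z. c * h z) = (\<lambda>z. c * A h z)) \<and>
     (\<exists>C::real. \<forall>h\<in>fock_space \<alpha>. fock_norm \<alpha> (A h) \<le> C * fock_norm \<alpha> h)"

definition toeplitz ::
    "real \<Rightarrow> (complex \<Rightarrow> complex) \<Rightarrow> (complex \<Rightarrow> complex) \<Rightarrow> complex \<Rightarrow> complex" where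
  "toeplitz \<alpha> f h z =
     of_real (\<alpha> / pi) *
       (LINT u|lebesgue. f u * h u * exp (of_real \<alpha> * z * cnj u - of_real (\<alpha> * (norm u)\<^sup>2)))"

definition is_toeplitz ::
    "real \<Rightarrow> ((complex \<Rightarrow> complex) \<Rightarrow> (complex \<Rightarrow> complex)) \<Rightarrow> (complex \<Rightarrow> complex) \<Rightarrow> bool" where
  "is_toeplitz \<alpha> A f \<longleftrightarrow> (\<forall>h\<in>fock_space \<alpha>. A h = toeplitz \<alpha> f h)"

definition canonical_kernel ::
    "real \<Rightarrow> ((complex \<Rightarrow> complex) \<Rightarrow> (complex \<Rightarrow> complex)) \<Rightarrow> complex \<Rightarrow> complex \<Rightarrow> complex" where
  "canonical_kernel \<alpha> A w z = fock_inner \<alpha> (A (fock_kernel \<alpha> w)) (fock_kernel \<alpha> z)"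

definition H0 :: "real \<Rightarrow> ((complex \<Rightarrow> complex) \<Rightarrow> (complex \<Rightarrow> complex)) \<Rightarrow> complex \<Rightarrow> complex" where
  "H0 \<alpha> A w = canonical_kernel \<alpha> A w (- w)"

definition H1 :: "real \<Rightarrow> ((complex \<Rightarrow> complex) \<Rightarrow> (complex \<Rightarrow> complex)) \<Rightarrow> complex \<Rightarrow> complex" where
  "H1 \<alpha> A w = deriv (\<lambda>z. canonical_kernel \<alpha> A w z) (- w)"

section \<open>The Fourier transform\<close>

definition fourier_L1 :: "real \<Rightarrow> (complex \<Rightarrow> complex) \<Rightarrow> complex \<Rightarrow> complex" where
  "fourier_L1 \<alpha> G w = (LINT u|lebesgue. G u * exp (of_real \<alpha> * (u * cnj w - cnj u * w)))"

text \<open>The extension of \<^const>\<open>fourier_L1\<close> from the intersection of L1 and L2 to L2, by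
  continuity, and its inverse on L2. Both are determined by their arguments almost everywhere
  only, so a representative is chosen.\<close>

definition fourier_L2 :: "real \<Rightarrow> (complex \<Rightarrow> complex) \<Rightarrow> complex \<Rightarrow> complex" where
  "fourier_L2 \<alpha> G =
     (SOME F. F \<in> L2 lebesgue \<and>
        (\<exists>Gn. (\<forall>n. Gn n \<in> L1 lebesgue \<inter> L2 lebesgue) \<and>
              L2_tendsto lebesgue Gn G \<and>
              L2_tendsto lebesgue (\<lambda>n. fourier_L1 \<alpha> (Gn n)) F))"

definition fourier_L2_inv :: "real \<Rightarrow> (complex \<Rightarrow> complex) \<Rightarrow> complex \<Rightarrow> complex" where
  "fourier_L2_inv \<alpha> H =
     (SOME G. G \<in> L2 lebesgue \<and> (AE w in lebesgue. fourier_L2 \<alpha> G w = H w))"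

section \<open>The candidate symbols\<close>

definition symbol0 ::
    "real \<Rightarrow> ((complex \<Rightarrow> complex) \<Rightarrow> (complex \<Rightarrow> complex)) \<Rightarrow> complex \<Rightarrow> complex" where
  "symbol0 \<alpha> A u =
     of_real (pi / \<alpha> * exp (\<alpha> * (norm u)\<^sup>2)) * fourier_L2_inv \<alpha> (H0 \<alpha> A) u"

text \<open>At 0 this takes the value 0 (division by zero), which is irrelevant almost everywhere.\<close>

definition symbol1 ::
    "real \<Rightarrow> ((complex \<Rightarrow> complex) \<Rightarrow> (complex \<Rightarrow> complex)) \<Rightarrow> complex \<Rightarrow> complex" where
  "symbol1 \<alpha> A u =
     1 / cnj u * of_real (pi / \<alpha>\<^sup>2 * exp (\<alpha> * (norm u)\<^sup>2)) * fourier_L2_inv \<alpha> (H1 \<alpha> A) u"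

end

theory Submission
  imports Defs "HOL-Probability.Distributions" "HOL-Complex_Analysis.Complex_Analysis"
begin

text \<open>Restricted to the antidiagonal \<open>z = - w\<close>, the product of the two kernels in the Toeplitz integral is
  a character: the integrand of \<open>T\<^sub>f K\<^sub>w (- w)\<close> is \<open>(\<alpha> / \<pi>) e\<^bsup>-\<alpha>|u|\<^sup>2\<^esup> f(u)\<close> times
  \<open>e\<^bsup>\<alpha> (u cnj w - cnj u w)\<^esup>\<close>. So \<open>H0\<close> is the symplectic Fourier transform of the Gaussian multiple of
  the symbol (\<open>toeplitz_kernel_antidiagonal\<close>), and a derivative in \<open>z\<close>, taken before the
  restriction, brings down a factor \<open>\<alpha> cnj u\<close> (\<open>toeplitz_kernel_deriv_antidiagonal\<close>). The Gaussian makes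
  both transformed functions integrable and square-integrable, however rough the bounded symbol is.
  If \<open>A = T\<^sub>f\<close>, then Plancherel's theorem places \<open>H0\<close> and \<open>H1\<close> in \<open>L\<^sup>2\<close> and Fourier inversion returns \<open>f\<close>
  as \<open>symbol0\<close> and as \<open>symbol1\<close>, almost everywhere; this also gives uniqueness of the symbol.

  For the converse, let \<open>f\<close> be the candidate symbol. Inversion gives that the kernels of \<open>A\<close> and \<open>T\<^sub>f\<close>
  (for \<open>H1\<close>: their derivatives in \<open>z\<close>) agree almost everywhere on the antidiagonal. Their difference is an
  entire function of \<open>(cnj w, z)\<close>, and the points \<open>(cnj w, - w)\<close> form a totally real plane in
  \<open>\<complex>\<^sup>2\<close> of full dimension, on which no entire function except 0 vanishes identically
  (\<open>antidiagonal_series_zero\<close>). To pass from kernels to the whole Fock space, the argument is run for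
  bounded functionals \<open>M\<^sub>z\<close> that depend holomorphically on \<open>z\<close> (\<open>fock_family_zero\<close>): vanishing on all
  kernels means vanishing on all monomials, since the kernels generate them, and Taylor polynomials converge in the norm of the Fock space
  (\<open>fock_taylor_tendsto\<close>). For the first criterion, \<open>M\<^sub>z h = (A h - T\<^sub>f h)(z)\<close>. For the second, \<open>M\<^sub>z h\<close> is the
  derivative of \<open>A h - T\<^sub>f h\<close> at \<open>z\<close>, so that \<open>A h - T\<^sub>f h\<close> is constant, and the identity at the origin
  makes the constant 0.

  The \<open>L\<^sup>2\<close> theory of the symplectic Fourier transform rests on the fact that it is its own inverse up to the
  factor \<open>(\<pi> / \<alpha>)\<^sup>2\<close>. Damping a transform by a Gaussian and transforming again is, up to the same
  factor, convolution with a heat kernel (\<open>fourier_gauss_fourier\<close>), and such convolutions converge to the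
  identity in \<open>L\<^sup>2\<close> (\<open>heat_conv_L2_tendsto\<close>). This yields both Plancherel's theorem
  (\<open>fourier_plancherel\<close>) and density of the range (\<open>fourier_L2_limit_onto\<close>). All that the main argument needs
  is \<open>fourier_L2_inv_eq_iff\<close>, which characterizes the inverse by the integral formula.

  The analytic input is the mean value property against radial weights (\<open>radial_mean_value\<close>), a consequence
  of rotation invariance. It gives the reproducing property of the kernel and the orthogonality of the
  Taylor remainder to lower monomials; the reproducing property in turn computes the Fourier
  transform of a Gaussian.\<close>

section \<open>Mean-square convergence\<close>

lemma borel_measurable_cnj [measurable]: "cnj \<in> borel_measurable borel"
  by (intro borel_measurable_continuous_onI continuous_intros)

text \<open>The values are extended nonnegative numbers, so that limits and exchanges of integrals need no
  finiteness in advance.\<close>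
definition L2sq :: "'a measure \<Rightarrow> ('a \<Rightarrow> complex) \<Rightarrow> ennreal" where
  "L2sq M f = (\<integral>\<^sup>+ x. ennreal ((norm (f x))\<^sup>2) \<partial>M)"

lemma L2_iff_L2sq: "f \<in> L2 M \<longleftrightarrow> f \<in> borel_measurable M \<and> L2sq M f < \<infinity>"
  by (auto simp: L2_def L2sq_def integrable_iff_bounded)

lemma L2_measurable: "f \<in> L2 M \<Longrightarrow> f \<in> borel_measurable M"
  by (simp add: L2_def)

lemma L2_tendsto_L2sq: "L2_tendsto M F G \<longleftrightarrow> (\<lambda>n. L2sq M (\<lambda>x. F n x - G x)) \<longlonglongrightarrow> 0"
  by (simp add: L2_tendsto_def L2sq_def)

lemma norm_add_sq_le: "(norm (a + b :: complex))\<^sup>2 \<le> 2 * (norm a)\<^sup>2 + 2 * (norm b)\<^sup>2"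
proof -
  have "(norm (a + b))\<^sup>2 \<le> (norm a + norm b)\<^sup>2"
    by (intro power_mono norm_triangle_ineq) auto
  also have "\<dots> \<le> 2 * (norm a)\<^sup>2 + 2 * (norm b)\<^sup>2"
    using zero_le_power2[of "norm a - norm b"] by (simp add: power2_eq_square algebra_simps)
  finally show ?thesis .
qed

lemma L2sq_add_le:
  assumes [measurable]: "f \<in> borel_measurable M" "g \<in> borel_measurable M"
  shows "L2sq M (\<lambda>x. f x + g x) \<le> 2 * L2sq M f + 2 * L2sq M g"
proof -
  have "L2sq M (\<lambda>x. f x + g x)
      \<le> (\<integral>\<^sup>+x. 2 * ennreal ((norm (f x))\<^sup>2) + 2 * ennreal ((norm (g x))\<^sup>2) \<partial>M)"
    unfolding L2sq_def
  proof (rule nn_integral_mono)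
    fix x
    have "ennreal ((norm (f x + g x))\<^sup>2) \<le> ennreal (2 * (norm (f x))\<^sup>2 + 2 * (norm (g x))\<^sup>2)"
      by (intro ennreal_leI norm_add_sq_le)
    then show "ennreal ((norm (f x + g x))\<^sup>2) \<le> 2 * ennreal ((norm (f x))\<^sup>2) + 2 * ennreal ((norm (g x))\<^sup>2)"
      by (simp add: ennreal_plus ennreal_mult)
  qed
  also have "\<dots> = 2 * L2sq M f + 2 * L2sq M g"
    unfolding L2sq_def by (simp add: nn_integral_add nn_integral_cmult)
  finally show ?thesis .
qed

lemma L2sq_diff_le:
  assumes [measurable]: "f \<in> borel_measurable M" "g \<in> borel_measurable M" "h \<in> borel_measurable M"
  shows "L2sq M (\<lambda>x. f x - h x) \<le> 2 * L2sq M (\<lambda>x. f x - g x) + 2 * L2sq M (\<lambda>x. g x - h x)"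
  using L2sq_add_le[of "\<lambda>x. f x - g x" M "\<lambda>x. g x - h x"] by simp

lemma L2sq_cmult:
  assumes [measurable]: "f \<in> borel_measurable M"
  shows "L2sq M (\<lambda>x. c * f x) = ennreal ((norm c)\<^sup>2) * L2sq M f"
  unfolding L2sq_def
  by (subst nn_integral_cmult[symmetric]) (auto simp: norm_mult power_mult_distrib ennreal_mult)

lemma L2sq_minus_commute: "L2sq M (\<lambda>x. f x - g x) = L2sq M (\<lambda>x. g x - f x)"
  unfolding L2sq_def by (simp add: norm_minus_commute)

lemma L2sq_cong_AE: "AE x in M. f x = g x \<Longrightarrow> L2sq M f = L2sq M g"
  unfolding L2sq_def by (intro nn_integral_cong_AE) auto

lemma L2_add: "f \<in> L2 M \<Longrightarrow> g \<in> L2 M \<Longrightarrow> (\<lambda>x. f x + g x) \<in> L2 M"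
  unfolding L2_iff_L2sq using L2sq_add_le[of f M g]
  by (auto simp: ennreal_mult_less_top intro: le_less_trans)

lemma L2_cmult: "f \<in> L2 M \<Longrightarrow> (\<lambda>x. c * f x) \<in> L2 M"
  unfolding L2_iff_L2sq by (auto simp: L2sq_cmult ennreal_mult_less_top)

lemma L2_diff: "f \<in> L2 M \<Longrightarrow> g \<in> L2 M \<Longrightarrow> (\<lambda>x. f x - g x) \<in> L2 M"
  using L2_add[of f M "\<lambda>x. (-1) * g x"] L2_cmult[of g M "-1"] by simp

lemma L2sq_eq_integral:
  assumes "f \<in> L2 M"
  shows "L2sq M f = ennreal (\<integral>x. (norm (f x))\<^sup>2 \<partial>M)"
  using assms unfolding L2_def L2sq_def by (intro nn_integral_eq_integral) auto

lemma L2sq_eq_0_AE: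
  assumes [measurable]: "f \<in> borel_measurable M" "g \<in> borel_measurable M"
    and "L2sq M (\<lambda>x. f x - g x) = 0"
  shows "AE x in M. f x = g x"
  using assms(3) unfolding L2sq_def
  by (subst (asm) nn_integral_0_iff_AE) auto

lemma L2_tendsto_unique:
  assumes [measurable]: "\<And>n. F n \<in> borel_measurable M" "G \<in> borel_measurable M" "H \<in> borel_measurable M"
    and "L2_tendsto M F G" "L2_tendsto M F H"
  shows "AE x in M. G x = H x"
proof (rule L2sq_eq_0_AE)
  have "L2sq M (\<lambda>x. G x - H x) \<le> 2 * L2sq M (\<lambda>x. F n x - G x) + 2 * L2sq M (\<lambda>x. F n x - H x)" for n
    using L2sq_diff_le[of G M "F n" H] by (simp add: L2sq_minus_commute[of M G "F n"])
  moreover have "(\<lambda>n. 2 * L2sq M (\<lambda>x. F n x - G x) + 2 * L2sq M (\<lambda>x. F n x - H x)) \<longlonglongrightarrow> 2 * 0 + 2 * 0"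
    using assms(4,5) unfolding L2_tendsto_L2sq
    by (intro tendsto_add ennreal_tendsto_cmult) auto
  ultimately have "L2sq M (\<lambda>x. G x - H x) \<le> 0"
    by (intro LIMSEQ_le_const) auto
  then show "L2sq M (\<lambda>x. G x - H x) = 0" by simp
qed auto

lemma L2_tendsto_in_L2:
  assumes F: "\<And>n. F n \<in> L2 M" and [measurable]: "G \<in> borel_measurable M" and lim: "L2_tendsto M F G"
  shows "G \<in> L2 M"
proof -
  have [measurable]: "F n \<in> borel_measurable M" for n using F by (rule L2_measurable)
  have "eventually (\<lambda>n. L2sq M (\<lambda>x. F n x - G x) < 1) sequentially"
    using lim unfolding L2_tendsto_L2sq by (rule order_tendstoD) simp
  then obtain n where "L2sq M (\<lambda>x. F n x - G x) < 1" by (auto simp: eventually_sequentially)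
  then have "(\<lambda>x. F n x - G x) \<in> L2 M" by (auto simp: L2_iff_L2sq less_top intro: less_trans)
  from L2_diff[OF F[of n] this] show ?thesis by simp
qed

lemma L2_tendstoI:
  assumes "\<And>e. e > 0 \<Longrightarrow> eventually (\<lambda>n. L2sq M (\<lambda>x. F n x - G x) < ennreal e) sequentially"
  shows "L2_tendsto M F G"
  unfolding L2_tendsto_L2sq
proof (rule order_tendstoI)
  fix a :: ennreal assume "0 < a"
  then obtain e where e: "0 < e" "ennreal e < a"
  proof (cases a)
    case (real r)
    with \<open>0 < a\<close> have "0 < r / 2" "ennreal (r / 2) < a" by (auto simp: ennreal_less_iff)
    then show ?thesis by (rule that)
  next
    case top
    then show ?thesis using that[of 1] by simp
  qed
  show "eventually (\<lambda>n. L2sq M (\<lambda>x. F n x - G x) < a) sequentially"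
    using assms[OF e(1)] by eventually_elim (use e(2) in auto)
qed auto

lemma L2_tendstoD:
  assumes "L2_tendsto M F G" "e > 0"
  shows "eventually (\<lambda>n. L2sq M (\<lambda>x. F n x - G x) < ennreal e) sequentially"
  using assms unfolding L2_tendsto_L2sq by (intro order_tendstoD) auto

lemma L2_tendsto_const: "L2_tendsto M (\<lambda>n. F) F"
  by (simp add: L2_tendsto_def)

lemma L2_tendsto_less:
  assumes "L2_tendsto M F G" "e > 0"
  obtains n where "L2sq M (\<lambda>x. G x - F n x) < ennreal e"
proof -
  have "eventually (\<lambda>n. L2sq M (\<lambda>x. F n x - G x) < ennreal e) sequentially"
    using assms unfolding L2_tendsto_L2sq by (intro order_tendstoD) auto
  then show ?thesis using that by (auto simp: eventually_sequentially L2sq_minus_commute[of M G])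
qed

lemma L2sq_diff_less:
  assumes [measurable]: "f \<in> borel_measurable M" "g \<in> borel_measurable M" "h \<in> borel_measurable M"
    and "L2sq M (\<lambda>x. f x - g x) < ennreal a" "L2sq M (\<lambda>x. g x - h x) < ennreal b"
  shows "L2sq M (\<lambda>x. f x - h x) < ennreal (2 * a + 2 * b)"
proof -
  obtain p where p: "L2sq M (\<lambda>x. f x - g x) = ennreal p" "0 \<le> p" "p < a"
    using assms(4) by (cases "L2sq M (\<lambda>x. f x - g x)") (auto simp: ennreal_less_iff)
  obtain q where q: "L2sq M (\<lambda>x. g x - h x) = ennreal q" "0 \<le> q" "q < b"
    using assms(5) by (cases "L2sq M (\<lambda>x. g x - h x)") (auto simp: ennreal_less_iff)
  have "2 * ennreal p + 2 * ennreal q = ennreal (2 * p + 2 * q)"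
    using p q by (simp add: ennreal_plus ennreal_mult)
  then have "L2sq M (\<lambda>x. f x - h x) \<le> ennreal (2 * p + 2 * q)"
    using L2sq_diff_le[of f M g h] p q by simp
  also have "\<dots> < ennreal (2 * a + 2 * b)" using p q by (intro ennreal_lessI) linarith+
  finally show ?thesis .
qed

lemma L2_tendsto_Cauchy:
  assumes [measurable]: "\<And>n. F n \<in> borel_measurable M" "G \<in> borel_measurable M"
    and lim: "L2_tendsto M F G" and e: "e > 0"
  shows "\<exists>N. \<forall>m\<ge>N. \<forall>n\<ge>N. L2sq M (\<lambda>x. F m x - F n x) < ennreal e"
proof -
  obtain N where N: "\<And>n. n \<ge> N \<Longrightarrow> L2sq M (\<lambda>x. F n x - G x) < ennreal (e / 4)"
    using L2_tendstoD[OF lim, of "e / 4"] e by (auto simp: eventually_sequentially)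
  have "L2sq M (\<lambda>x. F m x - F n x) < ennreal e" if "m \<ge> N" "n \<ge> N" for m n
  proof -
    have "L2sq M (\<lambda>x. G x - F n x) < ennreal (e / 4)"
      using N[OF that(2)] by (simp add: L2sq_minus_commute[of M G])
    from L2sq_diff_less[OF _ _ _ N[OF that(1)] this] show ?thesis by simp
  qed
  then show ?thesis by blast
qed

text \<open>A subsequence with increments of square norm at most \<open>4\<^sup>-\<^sup>k\<close> has square-summable increments
  even with the growing weights \<open>2\<^sup>k\<close>, so it converges almost everywhere; Fatou's lemma turns the
  pointwise limit into a mean-square limit of the whole sequence.\<close>
lemma L2_complete:
  assumes F: "\<And>n. F n \<in> L2 M"
    and cauchy: "\<And>e. e > 0 \<Longrightarrow> \<exists>N. \<forall>m\<ge>N. \<forall>n\<ge>N. L2sq M (\<lambda>x. F m x - F n x) < ennreal e"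
  obtains G where "G \<in> L2 M" "L2_tendsto M F G"
proof -
  have [measurable]: "F n \<in> borel_measurable M" for n using F by (rule L2_measurable)
  have "\<exists>N. \<forall>m\<ge>N. \<forall>n\<ge>N. L2sq M (\<lambda>x. F m x - F n x) < ennreal ((1/4)^k)" for k :: nat
    by (rule cauchy) simp
  then obtain N where N: "\<And>k m n. m \<ge> N k \<Longrightarrow> n \<ge> N k \<Longrightarrow> L2sq M (\<lambda>x. F m x - F n x) < ennreal ((1/4)^k)"
    by metis
  \<comment> \<open>adding \<open>k\<close> makes the subsequence tend to infinity; the maximum makes it monotone\<close>
  define s where "s k = k + Max (N ` {..k})" for k
  have sN: "s k \<ge> N k" for k
    unfolding s_def by (intro trans_le_add2 Max_ge) auto
  have sm: "s k \<le> s l" if "k \<le> l" for k l unfolding s_def using that by (intro add_mono Max_mono) auto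
  define d where "d k x = F (s (Suc k)) x - F (s k) x" for k x
  have [measurable]: "d k \<in> borel_measurable M" for k unfolding d_def by simp
  have d: "L2sq M (d k) \<le> ennreal ((1/4)^k)" for k
    unfolding d_def using N[of k "s (Suc k)" "s k"] sN[of k] sm[of k "Suc k"] by (simp add: order_less_imp_le)
  have "(\<integral>\<^sup>+x. (\<Sum>k. 2^k * ennreal ((norm (d k x))\<^sup>2)) \<partial>M) = (\<Sum>k. \<integral>\<^sup>+x. 2^k * ennreal ((norm (d k x))\<^sup>2) \<partial>M)"
    by (rule nn_integral_suminf) simp
  also have "\<dots> = (\<Sum>k. 2^k * L2sq M (d k))" unfolding L2sq_def by (simp add: nn_integral_cmult)
  also have "\<dots> \<le> (\<Sum>k. ennreal ((1/2)^k))"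
  proof (intro suminf_le allI)
    fix k :: nat
    have "2^k * L2sq M (d k) \<le> 2^k * ennreal ((1/4)^k)" by (intro mult_left_mono d) simp
    also have "\<dots> = ennreal (2^k * (1/4)^k)"
      by (simp add: ennreal_mult flip: ennreal_power)
    also have "2^k * (1/4)^k = ((1/2)^k :: real)" by (simp flip: power_mult_distrib)
    finally show "2^k * L2sq M (d k) \<le> ennreal ((1/2)^k)" .
  qed auto
  also have "\<dots> < \<infinity>"
    by (subst suminf_ennreal2) (auto intro: summable_geometric)
  finally have fin: "(\<integral>\<^sup>+x. (\<Sum>k. 2^k * ennreal ((norm (d k x))\<^sup>2)) \<partial>M) < \<infinity>" .
  have "AE x in M. (\<Sum>k. 2^k * ennreal ((norm (d k x))\<^sup>2)) \<noteq> \<infinity>"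
    using fin by (intro nn_integral_PInf_AE) auto
  then have conv: "AE x in M. convergent (\<lambda>k. F (s k) x)"
  proof eventually_elim
    case (elim x)
    let ?S = "\<Sum>k. 2^k * ennreal ((norm (d k x))\<^sup>2)"
    obtain C where C: "?S = ennreal C" "C \<ge> 0" using elim by (cases ?S) auto
    have bd: "norm (d k x) \<le> sqrt C * (sqrt (1/2))^k" for k
    proof -
      have "2^k * ennreal ((norm (d k x))\<^sup>2) \<le> ?S"
        using sum_le_suminf[of "\<lambda>k. 2^k * ennreal ((norm (d k x))\<^sup>2)" "{k}"] by simp
      then have "ennreal (2^k * (norm (d k x))\<^sup>2) \<le> ennreal C"
        using C by (simp add: ennreal_mult flip: ennreal_power)
      then have "2^k * (norm (d k x))\<^sup>2 \<le> C" using C by (simp add: ennreal_le_iff)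
      then have "(norm (d k x))\<^sup>2 \<le> C * (1/2)^k" by (simp add: field_simps power_divide)
      then have "norm (d k x) \<le> sqrt (C * (1/2)^k)" by (simp add: real_le_rsqrt)
      then show ?thesis by (simp only: real_sqrt_mult real_sqrt_power)
    qed
    have "summable (\<lambda>k. sqrt C * (sqrt (1/2))^k)"
      by (intro summable_mult summable_geometric) (simp add: real_sqrt_divide)
    then have "summable (\<lambda>k. d k x)" by (rule summable_comparison_test'[where N=0]) (rule bd)
    then have "convergent (\<lambda>n. \<Sum>k<n. d k x)" unfolding summable_iff_convergent .
    also have "(\<lambda>n. \<Sum>k<n. d k x) = (\<lambda>n. F (s n) x - F (s 0) x)"
      unfolding d_def by (rule ext) (rule sum_lessThan_telescope)
    finally show ?case unfolding convergent_diff_const_right_iff .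
  qed
  define G where "G x = lim (\<lambda>k. F (s k) x)" for x
  have [measurable]: "G \<in> borel_measurable M" unfolding G_def by measurable
  have bound: "L2sq M (\<lambda>x. F n x - G x) \<le> ennreal e"
    if n: "\<And>m. m \<ge> K \<Longrightarrow> L2sq M (\<lambda>x. F n x - F m x) \<le> ennreal e" for n e K
  proof -
    have "L2sq M (\<lambda>x. F n x - G x) = (\<integral>\<^sup>+x. liminf (\<lambda>k. ennreal ((norm (F n x - F (s k) x))\<^sup>2)) \<partial>M)"
      unfolding L2sq_def
    proof (rule nn_integral_cong_AE, use conv in eventually_elim)
      fix x assume "convergent (\<lambda>k. F (s k) x)"
      then have "(\<lambda>k. F (s k) x) \<longlonglongrightarrow> G x" unfolding G_def by (simp add: convergent_LIMSEQ_iff)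
      then have "(\<lambda>k. ennreal ((norm (F n x - F (s k) x))\<^sup>2)) \<longlonglongrightarrow> ennreal ((norm (F n x - G x))\<^sup>2)"
        by (intro tendsto_ennrealI tendsto_intros)
      then show "ennreal ((norm (F n x - G x))\<^sup>2) = liminf (\<lambda>k. ennreal ((norm (F n x - F (s k) x))\<^sup>2))"
        by (intro lim_imp_Liminf[symmetric]) auto
    qed
    also have "\<dots> \<le> liminf (\<lambda>k. L2sq M (\<lambda>x. F n x - F (s k) x))"
      unfolding L2sq_def by (rule nn_integral_liminf) simp
    also have "\<dots> \<le> liminf (\<lambda>k::nat. ennreal e)"
    proof (rule Liminf_mono)
      have "s k \<ge> K" if "k \<ge> K" for k using that unfolding s_def by simp
      then show "eventually (\<lambda>k. L2sq M (\<lambda>x. F n x - F (s k) x) \<le> ennreal e) sequentially"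
        unfolding eventually_sequentially using n by blast
    qed
    finally show ?thesis by (simp add: Liminf_const)
  qed
  have lim: "L2_tendsto M F G"
  proof (rule L2_tendstoI)
    fix e :: real assume e: "e > 0"
    then obtain K where K: "\<And>m n. m \<ge> K \<Longrightarrow> n \<ge> K \<Longrightarrow> L2sq M (\<lambda>x. F m x - F n x) < ennreal (e / 2)"
      using cauchy[of "e / 2"] by auto
    have "L2sq M (\<lambda>x. F n x - G x) \<le> ennreal (e / 2)" if "n \<ge> K" for n
      using K that by (intro bound[of K] less_imp_le) auto
    moreover have "ennreal (e / 2) < ennreal e" using e by (intro ennreal_lessI) auto
    ultimately show "eventually (\<lambda>n. L2sq M (\<lambda>x. F n x - G x) < ennreal e) sequentially"
      unfolding eventually_sequentially by (meson le_less_trans)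
  qed
  with L2_tendsto_in_L2[OF F _ lim] show ?thesis using that by simp
qed

text \<open>Together with the next lemma, this expresses almost-everywhere equality of two limits through the
  approximating sequences alone, where Plancherel's theorem applies.\<close>
lemma L2_tendsto_iff_diff:
  assumes [measurable]: "\<And>n. X n \<in> borel_measurable M" "\<And>n. Y n \<in> borel_measurable M" "H \<in> borel_measurable M"
    and Y: "L2_tendsto M Y H"
  shows "L2_tendsto M X H \<longleftrightarrow> (\<lambda>n. L2sq M (\<lambda>x. X n x - Y n x)) \<longlonglongrightarrow> 0"
proof -
  have Y0: "(\<lambda>n. 2 * L2sq M (\<lambda>x. Y n x - H x)) \<longlonglongrightarrow> 2 * 0"
    using Y unfolding L2_tendsto_L2sq by (intro ennreal_tendsto_cmult) auto
  have Y0': "(\<lambda>n. 2 * L2sq M (\<lambda>x. H x - Y n x)) \<longlonglongrightarrow> 2 * 0"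
    using Y0 by (simp add: L2sq_minus_commute[of M H])
  show ?thesis
  proof
    assume "L2_tendsto M X H"
    then have "(\<lambda>n. 2 * L2sq M (\<lambda>x. X n x - H x) + 2 * L2sq M (\<lambda>x. H x - Y n x)) \<longlonglongrightarrow> 2 * 0 + 2 * 0"
      unfolding L2_tendsto_L2sq by (intro tendsto_add ennreal_tendsto_cmult Y0') auto
    then have "(\<lambda>n. 2 * L2sq M (\<lambda>x. X n x - H x) + 2 * L2sq M (\<lambda>x. H x - Y n x)) \<longlonglongrightarrow> 0" by simp
    then show "(\<lambda>n. L2sq M (\<lambda>x. X n x - Y n x)) \<longlonglongrightarrow> 0"
      by (rule tendsto_sandwich[OF _ _ tendsto_const, rotated 2]) (auto intro!: always_eventually L2sq_diff_le)
  next
    assume "(\<lambda>n. L2sq M (\<lambda>x. X n x - Y n x)) \<longlonglongrightarrow> 0"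
    then have "(\<lambda>n. 2 * L2sq M (\<lambda>x. X n x - Y n x) + 2 * L2sq M (\<lambda>x. Y n x - H x)) \<longlonglongrightarrow> 2 * 0 + 2 * 0"
      by (intro tendsto_add ennreal_tendsto_cmult Y0) auto
    then have "(\<lambda>n. 2 * L2sq M (\<lambda>x. X n x - Y n x) + 2 * L2sq M (\<lambda>x. Y n x - H x)) \<longlonglongrightarrow> 0" by simp
    then show "L2_tendsto M X H"
      unfolding L2_tendsto_L2sq
      by (rule tendsto_sandwich[OF _ _ tendsto_const, rotated 2]) (auto intro!: always_eventually L2sq_diff_le)
  qed
qed

lemma L2_tendsto_AE_iff:
  assumes [measurable]: "\<And>n. X n \<in> borel_measurable M" "H \<in> borel_measurable M" "H' \<in> borel_measurable M"
    and X: "L2_tendsto M X H"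
  shows "(AE x in M. H x = H' x) \<longleftrightarrow> L2_tendsto M X H'"
proof
  assume ae: "AE x in M. H x = H' x"
  have "L2sq M (\<lambda>x. X n x - H' x) = L2sq M (\<lambda>x. X n x - H x)" for n
    using ae by (intro L2sq_cong_AE) auto
  then show "L2_tendsto M X H'" using X unfolding L2_tendsto_L2sq by simp
next
  assume "L2_tendsto M X H'"
  then show "AE x in M. H x = H' x" by (rule L2_tendsto_unique[OF _ _ _ X, rotated 3]) auto
qed

lemma L2sq_dominated:
  assumes [measurable]: "\<And>n. F n \<in> borel_measurable M" "G \<in> borel_measurable M" and w: "w \<in> borel_measurable M"
    and lim: "AE x in M. (\<lambda>n. F n x) \<longlonglongrightarrow> G x"
    and bound: "\<And>n. AE x in M. norm (F n x - G x) \<le> w x" and fin: "(\<integral>\<^sup>+x. ennreal ((w x)\<^sup>2) \<partial>M) < \<infinity>"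
  shows "L2_tendsto M F G"
proof -
  have "(\<lambda>n. \<integral>\<^sup>+x. ennreal ((norm (F n x - G x))\<^sup>2) \<partial>M) \<longlonglongrightarrow> (\<integral>\<^sup>+x. 0 \<partial>M)"
  proof (rule nn_integral_dominated_convergence[where w="\<lambda>x. ennreal ((w x)\<^sup>2)"])
    show "AE x in M. (\<lambda>n. ennreal ((norm (F n x - G x))\<^sup>2)) \<longlonglongrightarrow> 0"
      using lim
    proof eventually_elim
      case (elim x)
      then have "(\<lambda>n. ennreal ((norm (F n x - G x))\<^sup>2)) \<longlonglongrightarrow> ennreal ((norm (G x - G x))\<^sup>2)"
        by (intro tendsto_ennrealI tendsto_intros)
      then show ?case by simp
    qed
    show "AE x in M. ennreal ((norm (F n x - G x))\<^sup>2) \<le> ennreal ((w x)\<^sup>2)" for n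
      using bound[of n] by eventually_elim (auto intro!: ennreal_leI power_mono)
  qed (use w fin in measurable)
  then show ?thesis unfolding L2_tendsto_def by simp
qed

lemma L2_mult_cnj_integrable:
  assumes "f \<in> L2 M" "g \<in> L2 M"
  shows "integrable M (\<lambda>x. f x * cnj (g x))"
proof (rule Bochner_Integration.integrable_bound)
  have [measurable]: "f \<in> borel_measurable M" "g \<in> borel_measurable M"
    using assms by (auto intro: L2_measurable)
  show "(\<lambda>x. f x * cnj (g x)) \<in> borel_measurable M" by measurable
  show "integrable M (\<lambda>x. (norm (f x))\<^sup>2 + (norm (g x))\<^sup>2)"
    using assms by (auto simp: L2_def)
  show "AE x in M. norm (f x * cnj (g x)) \<le> norm ((norm (f x))\<^sup>2 + (norm (g x))\<^sup>2)"
  proof (rule AE_I2)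
    fix x
    have "2 * (norm (f x) * norm (g x)) \<le> (norm (f x))\<^sup>2 + (norm (g x))\<^sup>2"
      using zero_le_power2[of "norm (f x) - norm (g x)"] by (simp add: power2_eq_square algebra_simps)
    moreover have "0 \<le> norm (f x) * norm (g x)" by simp
    ultimately have "norm (f x) * norm (g x) \<le> (norm (f x))\<^sup>2 + (norm (g x))\<^sup>2"
      by linarith
    then show "norm (f x * cnj (g x)) \<le> norm ((norm (f x))\<^sup>2 + (norm (g x))\<^sup>2)"
      by (simp add: norm_mult)
  qed
qed

lemma L2_Cauchy_Schwarz:
  assumes "f \<in> L2 M" "g \<in> L2 M"
  shows "(norm (\<integral>x. f x * cnj (g x) \<partial>M))\<^sup>2 \<le> (\<integral>x. (norm (f x))\<^sup>2 \<partial>M) * (\<integral>x. (norm (g x))\<^sup>2 \<partial>M)"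
proof -
  have [measurable]: "f \<in> borel_measurable M" "g \<in> borel_measurable M"
    using assms by (auto intro: L2_measurable)
  have "ennreal (norm (\<integral>x. f x * cnj (g x) \<partial>M)) \<le> (\<integral>\<^sup>+x. ennreal (norm (f x)) * ennreal (norm (g x)) \<partial>M)"
    using integral_norm_bound_ennreal[OF L2_mult_cnj_integrable[OF assms]]
    by (simp add: norm_mult ennreal_mult)
  then have "(ennreal (norm (\<integral>x. f x * cnj (g x) \<partial>M)))\<^sup>2 \<le> (\<integral>\<^sup>+x. ennreal (norm (f x)) * ennreal (norm (g x)) \<partial>M)\<^sup>2"
    by (rule power_mono) simp
  also have "\<dots> \<le> L2sq M f * L2sq M g"
    using Cauchy_Schwarz_nn_integral[of "\<lambda>x. ennreal (norm (f x))" M "\<lambda>x. ennreal (norm (g x))"]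
    by (simp add: L2sq_def ennreal_power)
  also have "\<dots> = ennreal ((\<integral>x. (norm (f x))\<^sup>2 \<partial>M) * (\<integral>x. (norm (g x))\<^sup>2 \<partial>M))"
    by (simp add: L2sq_eq_integral[OF assms(1)] L2sq_eq_integral[OF assms(2)] ennreal_mult)
  finally show ?thesis by (simp add: ennreal_power ennreal_le_iff)
qed

lemma L2_Cauchy_Schwarz_le:
  assumes "f \<in> L2 M" "g \<in> L2 M" "L2sq M f \<le> ennreal (p\<^sup>2)" "L2sq M g \<le> ennreal (q\<^sup>2)" "p \<ge> 0" "q \<ge> 0"
  shows "norm (\<integral>x. f x * cnj (g x) \<partial>M) \<le> p * q"
proof (rule power2_le_imp_le)
  have "(norm (\<integral>x. f x * cnj (g x) \<partial>M))\<^sup>2 \<le> (\<integral>x. (norm (f x))\<^sup>2 \<partial>M) * (\<integral>x. (norm (g x))\<^sup>2 \<partial>M)"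
    by (rule L2_Cauchy_Schwarz[OF assms(1,2)])
  also have "\<dots> \<le> p\<^sup>2 * q\<^sup>2"
    using assms(3,4) by (intro mult_mono) (auto simp: L2sq_eq_integral assms(1,2))
  finally show "(norm (\<integral>x. f x * cnj (g x) \<partial>M))\<^sup>2 \<le> (p * q)\<^sup>2" by (simp add: power_mult_distrib)
qed (use assms in simp)

text \<open>If the norm of \<open>F\<close> is at most that of \<open>G\<close>, then closeness of the inner product
  \<open>\<langle>F, G\<rangle>\<close> to \<open>\<langle>G, G\<rangle>\<close> already forces \<open>F\<close> to be close to \<open>G\<close>: expand the square.\<close>
lemma L2sq_diff_le_of_L2sq_le:
  assumes F: "F \<in> L2 M" and G: "G \<in> L2 M" and le: "L2sq M F \<le> L2sq M G"
  shows "L2sq M (\<lambda>x. F x - G x) \<le> ennreal (2 * (\<integral>x. (norm (G x))\<^sup>2 \<partial>M) - 2 * Re (\<integral>x. F x * cnj (G x) \<partial>M))"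
proof -
  have i: "integrable M (\<lambda>x. (norm (F x))\<^sup>2)" "integrable M (\<lambda>x. (norm (G x))\<^sup>2)"
    "integrable M (\<lambda>x. F x * cnj (G x))" using F G L2_mult_cnj_integrable by (auto simp: L2_def)
  define r where "r x = Re (F x * cnj (G x))" for x
  have r: "integrable M r" "(\<integral>x. r x \<partial>M) = Re (\<integral>x. F x * cnj (G x) \<partial>M)"
    unfolding r_def using i(3) by (rule integrable_Re, rule Bochner_Integration.integral_Re)
  have "(norm (F x - G x))\<^sup>2 = (norm (F x))\<^sup>2 + (norm (G x))\<^sup>2 - 2 * r x" for x
    unfolding cmod_power2 r_def by (simp add: power2_eq_square algebra_simps)
  then have "(\<integral>x. (norm (F x - G x))\<^sup>2 \<partial>M)
      = (\<integral>x. (norm (F x))\<^sup>2 \<partial>M) + (\<integral>x. (norm (G x))\<^sup>2 \<partial>M) - 2 * Re (\<integral>x. F x * cnj (G x) \<partial>M)"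
    using i r by simp
  moreover have "(\<integral>x. (norm (F x))\<^sup>2 \<partial>M) \<le> (\<integral>x. (norm (G x))\<^sup>2 \<partial>M)"
    using le by (simp add: L2sq_eq_integral F G)
  ultimately show ?thesis
    unfolding L2sq_eq_integral[OF L2_diff[OF F G]] by (intro ennreal_leI) linarith
qed

lemma LinfE:
  assumes "f \<in> Linf M"
  obtains B where "B \<ge> 0" "AE x in M. norm (f x) \<le> B" "f \<in> borel_measurable M"
proof -
  obtain C where C: "AE x in M. norm (f x) \<le> C" using assms by (auto simp: Linf_def)
  have "AE x in M. norm (f x) \<le> max C 0" using C by eventually_elim simp
  then show ?thesis using that[of "max C 0"] assms by (simp add: Linf_def)
qed

lemma Linf_cong_AE:
  assumes "f \<in> Linf M" "g \<in> borel_measurable M" "AE x in M. g x = f x"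
  shows "g \<in> Linf M"
proof -
  obtain B where "AE x in M. norm (f x) \<le> B" using assms(1) by (auto simp: Linf_def)
  with assms(3) have "AE x in M. norm (g x) \<le> B" by eventually_elim simp
  then show ?thesis using assms(2) by (auto simp: Linf_def)
qed

lemma L2sq_Linf_mult_le:
  assumes B: "B \<ge> 0" "AE x in M. norm (f x) \<le> B" and [measurable]: "g \<in> borel_measurable M"
  shows "L2sq M (\<lambda>x. f x * g x) \<le> ennreal (B\<^sup>2) * L2sq M g"
proof -
  have "L2sq M (\<lambda>x. f x * g x) \<le> (\<integral>\<^sup>+x. ennreal (B\<^sup>2) * ennreal ((norm (g x))\<^sup>2) \<partial>M)"
    unfolding L2sq_def
  proof (rule nn_integral_mono_AE, use B(2) in eventually_elim)
    case (elim x)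
    then have "(norm (f x * g x))\<^sup>2 \<le> (B * norm (g x))\<^sup>2"
      by (intro power_mono) (auto simp: norm_mult mult_right_mono)
    then show ?case by (simp add: power_mult_distrib ennreal_leI flip: ennreal_mult')
  qed
  then show ?thesis by (simp add: L2sq_def nn_integral_cmult)
qed

lemma Linf_mult_L2:
  assumes f: "f \<in> Linf M" and g: "g \<in> L2 M"
  shows "(\<lambda>x. f x * g x) \<in> L2 M"
proof -
  obtain B where B: "B \<ge> 0" "AE x in M. norm (f x) \<le> B" "f \<in> borel_measurable M" using f by (rule LinfE)
  have [measurable]: "g \<in> borel_measurable M" using g by (rule L2_measurable)
  show ?thesis
    using L2sq_Linf_mult_le[OF B(1,2), of g] g B(3)
    by (auto simp: L2_iff_L2sq ennreal_mult_less_top intro: le_less_trans)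
qed

section \<open>Rotations and the mean value property\<close>

lemma nn_integral_lborel_affine:
  fixes f :: "'a::euclidean_space \<Rightarrow> ennreal"
  assumes [measurable]: "f \<in> borel_measurable borel" and "c \<noteq> 0"
  shows "(\<integral>\<^sup>+x. f x \<partial>lborel) = ennreal (\<bar>c\<bar> ^ DIM('a)) * (\<integral>\<^sup>+x. f (t + c *\<^sub>R x) \<partial>lborel)"
  by (subst lborel_affine[OF assms(2), of t])
     (simp add: nn_integral_density nn_integral_distr nn_integral_cmult)

lemma nn_integral_lborel_shift:
  fixes f :: "'a::euclidean_space \<Rightarrow> ennreal"
  assumes [measurable]: "f \<in> borel_measurable borel"
  shows "(\<integral>\<^sup>+x. f (x - a) \<partial>lborel) = (\<integral>\<^sup>+x. f x \<partial>lborel)"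
    and "(\<integral>\<^sup>+x. f (a - x) \<partial>lborel) = (\<integral>\<^sup>+x. f x \<partial>lborel)"
  using nn_integral_lborel_affine[OF assms, of 1 "-a"] nn_integral_lborel_affine[OF assms, of "-1" a]
  by simp_all

text \<open>Both measures are invariant under translations and agree on the unit ball \<open>B\<close>, so
  they agree. Concretely, for a Borel set \<open>A\<close>, integrate \<open>1\<^sub>A(c x) 1\<^sub>B(y - c x)\<close> over \<open>x\<close> and \<open>y\<close>; the
  substitution \<open>x \<mapsto> c\<inverse> y - x\<close> exchanges the two factors, and the product of the rotated volume of
  \<open>A\<close> and the volume of \<open>B\<close> equals the product of the volume of \<open>A\<close> and the rotated volume of \<open>B\<close>.\<close>
lemma lborel_distr_rotation:
  fixes c :: complex
  assumes c: "norm c = 1"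
  shows "distr lborel borel ((*) c) = (lborel :: complex measure)"
proof (rule measure_eqI)
  fix A assume "A \<in> sets (distr lborel borel ((*) c))"
  then have [measurable]: "A \<in> sets borel" by simp
  define B where "B = ball (0::complex) 1"
  have [measurable]: "B \<in> sets borel" unfolding B_def by simp
  have cc: "c * cnj c = 1" using c by (simp add: complex_norm_square[symmetric])
  \<comment> \<open>the ball is invariant under the rotation\<close>
  have B: "indicator B (c * x) = (indicator B x :: ennreal)" for x
    using c by (simp add: B_def indicator_def norm_mult)
  have "(\<integral>\<^sup>+x. indicator A (c * x) \<partial>lborel) * emeasure lborel B
      = (\<integral>\<^sup>+x. indicator A (c * x) * (\<integral>\<^sup>+y. indicator B (y - c * x) \<partial>lborel) \<partial>lborel)"
    by (subst nn_integral_lborel_shift(1)) (auto simp: nn_integral_multc)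
  also have "\<dots> = (\<integral>\<^sup>+x. (\<integral>\<^sup>+y. indicator A (c * x) * indicator B (y - c * x) \<partial>lborel) \<partial>lborel)"
    by (simp add: nn_integral_cmult)
  also have "\<dots> = (\<integral>\<^sup>+y. (\<integral>\<^sup>+x. indicator A (c * x) * indicator B (y - c * x) \<partial>lborel) \<partial>lborel)"
    by (rule lborel_pair.Fubini') measurable
  also have "\<dots> = (\<integral>\<^sup>+y. (\<integral>\<^sup>+x. indicator A (y - c * x) * indicator B x \<partial>lborel) \<partial>lborel)"
  proof (rule nn_integral_cong)
    fix y
    have "(\<integral>\<^sup>+x. indicator A (c * x) * indicator B (y - c * x) \<partial>lborel)
       = (\<integral>\<^sup>+x. indicator A (c * (cnj c * y - x)) * indicator B (y - c * (cnj c * y - x)) \<partial>lborel)"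
      by (rule nn_integral_lborel_shift(2)[symmetric]) measurable
    also have "\<dots> = (\<integral>\<^sup>+x. indicator A (y - c * x) * indicator B x \<partial>lborel)"
      using cc by (simp add: right_diff_distrib mult.assoc[symmetric] B)
    finally show "(\<integral>\<^sup>+x. indicator A (c * x) * indicator B (y - c * x) \<partial>lborel)
       = (\<integral>\<^sup>+x. indicator A (y - c * x) * indicator B x \<partial>lborel)" .
  qed
  also have "\<dots> = (\<integral>\<^sup>+x. (\<integral>\<^sup>+y. indicator A (y - c * x) * indicator B x \<partial>lborel) \<partial>lborel)"
    by (rule lborel_pair.Fubini'[symmetric]) measurable
  also have "\<dots> = (\<integral>\<^sup>+x. emeasure lborel A * indicator B x \<partial>lborel)"
    by (intro nn_integral_cong, subst nn_integral_multc, measurable, subst nn_integral_lborel_shift(1)) auto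
  also have "\<dots> = emeasure lborel A * emeasure lborel B" by (simp add: nn_integral_cmult)
  finally have *: "(\<integral>\<^sup>+x. indicator A (c * x) \<partial>lborel) * emeasure lborel B = emeasure lborel A * emeasure lborel B" .
  have "emeasure lborel B = ennreal pi" unfolding B_def using emeasure_ball[of 1 "0::complex"] by (simp add: unit_ball_vol_2)
  then have "(\<integral>\<^sup>+x. indicator A (c * x) \<partial>lborel) = emeasure lborel A"
    using * ennreal_mult_cancel_left[of "ennreal pi"] by (simp add: mult.commute)
  moreover have "emeasure (distr lborel borel ((*) c)) A = (\<integral>\<^sup>+x. indicator A x \<partial>distr lborel borel ((*) c))"
    by (subst nn_integral_indicator) auto
  moreover have "\<dots> = (\<integral>\<^sup>+x. indicator A (c * x) \<partial>lborel)"
    by (subst nn_integral_distr) auto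
  ultimately show "emeasure (distr lborel borel ((*) c)) A = emeasure lborel A" by simp
qed simp

lemma entire_circle_mean:
  assumes g: "g holomorphic_on UNIV"
  shows "((\<lambda>t. g (exp (2 * of_real pi * \<i> * of_real t) * z)) has_integral g 0) {0..1}"
proof -
  have "(\<lambda>u. g (u * z)) holomorphic_on UNIV"
    using holomorphic_on_compose_gen[of "\<lambda>u. u * z" UNIV g UNIV] g
    by (simp add: o_def holomorphic_intros)
  then have "((\<lambda>u. g (u * z) / (u - 0)) has_contour_integral (2 * of_real pi * \<i> * g (0 * z))) (circlepath 0 1)"
    by (intro Cauchy_integral_circlepath) (auto intro: holomorphic_on_imp_continuous_on holomorphic_on_subset)
  then have "((\<lambda>t. g (circlepath 0 1 t * z) / circlepath 0 1 t *
       vector_derivative (circlepath 0 1) (at t within {0..1})) has_integral (2 * of_real pi * \<i> * g 0)) {0..1}"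
    by (simp add: has_contour_integral_def)
  then have "((\<lambda>t. 2 * of_real pi * \<i> * g (exp (2 * of_real pi * \<i> * of_real t) * z)) has_integral (2 * of_real pi * \<i> * g 0)) {0..1}"
  proof (rule has_integral_eq[rotated])
    fix t :: real assume "t \<in> {0..1}"
    then have "vector_derivative (circlepath 0 1) (at t within {0..1}) = 2 * of_real pi * \<i> * exp (2 * of_real pi * \<i> * of_real t)"
      by (subst vector_derivative_circlepath01) auto
    then show "g (circlepath 0 1 t * z) / circlepath 0 1 t * vector_derivative (circlepath 0 1) (at t within {0..1})
        = 2 * of_real pi * \<i> * g (exp (2 * of_real pi * \<i> * of_real t) * z)"
      by (simp add: circlepath)
  qed
  from has_integral_mult_right[OF this, of "1 / (2 * of_real pi * \<i>)"] show ?thesis by simp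
qed

text \<open>A rotation of the plane leaves the integral of \<open>g \<rho>\<close> unchanged. Average over
  all rotations: by Fubini's theorem, \<open>g\<close> is replaced by its mean over circles, which is \<open>g 0\<close>.\<close>
lemma radial_mean_value:
  fixes g :: "complex \<Rightarrow> complex" and \<rho> :: "complex \<Rightarrow> real"
  assumes g: "g holomorphic_on UNIV" and [measurable]: "\<rho> \<in> borel_measurable borel"
    and radial: "\<And>c z. norm c = 1 \<Longrightarrow> \<rho> (c * z) = \<rho> z"
    and int: "integrable lborel (\<lambda>z. g z * of_real (\<rho> z))"
  shows "(\<integral>z. g z * of_real (\<rho> z) \<partial>lborel) = (\<integral>z. g 0 * of_real (\<rho> z) \<partial>lborel)"
proof -
  have contg: "continuous_on UNIV g" using g by (rule holomorphic_on_imp_continuous_on)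
  have [measurable]: "g \<in> borel_measurable borel"
    using contg by (rule borel_measurable_continuous_onI)
  define e where "e t = exp (2 * of_real pi * \<i> * of_real t)" for t :: real
  have [measurable]: "e \<in> borel_measurable borel"
    unfolding e_def by (intro borel_measurable_continuous_onI continuous_intros)
  have e: "norm (e t) = 1" for t by (simp add: e_def norm_exp_eq_Re)
  have rot: "integrable lborel (\<lambda>z. f (e t * z)) \<longleftrightarrow> integrable lborel f"
    "(\<integral>z. f (e t * z) \<partial>lborel) = (\<integral>z. f z \<partial>lborel)" if [measurable]: "f \<in> borel_measurable borel"
    for t and f :: "complex \<Rightarrow> 'b::{banach, second_countable_topology}"
    using integrable_distr_eq[of "(*) (e t)" lborel borel f] integral_distr[of "(*) (e t)" lborel borel f]
    by (simp_all add: lborel_distr_rotation[OF e])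
  define I :: "real \<Rightarrow> complex" where "I t = of_real (indicator {0..1} t)" for t
  have [measurable]: "I \<in> borel_measurable borel" unfolding I_def by measurable
  define F where "F t z = I t * (g (e t * z) * of_real (\<rho> z))" for t z
  have F: "F t z = I t * (g (e t * z) * of_real (\<rho> (e t * z)))" for t z
    by (simp add: F_def radial e)
  have [measurable]: "case_prod F \<in> borel_measurable (lborel \<Otimes>\<^sub>M lborel)"
    unfolding F_def by measurable
  have "integrable (lborel \<Otimes>\<^sub>M lborel) (case_prod F)"
  proof (rule lborel_pair.Fubini_integrable)
    have "(\<integral>z. norm (F t z) \<partial>lborel) = indicator {0..1} t * (\<integral>z. norm (g z * of_real (\<rho> z)) \<partial>lborel)" for t
      using rot(2)[of "\<lambda>z. norm (g z * of_real (\<rho> z))" t] by (simp add: F norm_mult I_def)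
    then show "integrable lborel (\<lambda>t. \<integral>z. norm (case_prod F (t, z)) \<partial>lborel)"
      by (simp add: integrable_mult_left)
    show "AE t in lborel. integrable lborel (\<lambda>z. case_prod F (t, z))"
      unfolding F prod.case using rot(1)[of "\<lambda>z. g z * of_real (\<rho> z)"] int by (intro AE_I2 integrable_mult_right) auto
  qed simp
  then have "(\<integral>z. (\<integral>t. F t z \<partial>lborel) \<partial>lborel) = (\<integral>t. (\<integral>z. F t z \<partial>lborel) \<partial>lborel)"
    by (rule lborel_pair.Fubini_integral)
  moreover have "(\<integral>t. F t z \<partial>lborel) = g 0 * of_real (\<rho> z)" for z
  proof -
    have "set_integrable lborel {0..1} (\<lambda>t. g (e t * z))"
      unfolding e_def
      by (intro borel_integrable_atLeastAtMost' continuous_intros continuous_on_compose2[OF contg]) auto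
    from set_borel_integral_eq_integral(2)[OF this] integral_unique[OF entire_circle_mean[OF g, of z]]
    have "(\<integral>t. I t * g (e t * z) \<partial>lborel) = g 0"
      by (simp add: set_lebesgue_integral_def e_def I_def scaleR_conv_of_real)
    moreover have "(\<integral>t. F t z \<partial>lborel) = (\<integral>t. I t * g (e t * z) \<partial>lborel) * of_real (\<rho> z)"
      unfolding F_def by (simp add: mult.assoc[symmetric])
    ultimately show ?thesis by simp
  qed
  moreover have "(\<integral>t. (\<integral>z. F t z \<partial>lborel) \<partial>lborel) = (\<integral>z. g z * of_real (\<rho> z) \<partial>lborel)"
  proof -
    have "(\<integral>z. F t z \<partial>lborel) = I t * (\<integral>z. g z * of_real (\<rho> z) \<partial>lborel)" for t
      unfolding F using rot(2)[of "\<lambda>z. g z * of_real (\<rho> z)" t] by simp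
    moreover have "(\<integral>t. I t \<partial>lborel) = 1" unfolding I_def by simp
    ultimately show ?thesis by simp
  qed
  ultimately show ?thesis by simp
qed

section \<open>Gaussian integrals\<close>

lemma nn_integral_gaussian_real:
  assumes b: "b > 0"
  shows "(\<integral>\<^sup>+(x::real). ennreal (exp (- b * x\<^sup>2)) \<partial>lborel) = ennreal (sqrt (pi / b))"
proof -
  define \<sigma> where "\<sigma> = 1 / sqrt (2 * b)"
  have s: "\<sigma> > 0" "\<sigma>\<^sup>2 = 1 / (2 * b)" using b by (auto simp: \<sigma>_def power_divide)
  have eq: "exp (- b * x\<^sup>2) = sqrt (pi / b) * normal_density 0 \<sigma> x" for x
    using b by (simp add: normal_density_def s field_simps real_sqrt_divide real_sqrt_mult)
  show ?thesis
    unfolding eq using s(1) b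
    by (subst nn_integral_eq_integral) (auto simp: integral_normal_density)
qed

lemma nn_integral_gaussian_complex:
  assumes b: "b > 0"
  shows "(\<integral>\<^sup>+(z::complex). ennreal (exp (- b * (norm z)\<^sup>2)) \<partial>lborel) = ennreal (pi / b)"
proof -
  have "(\<integral>\<^sup>+(z::complex). ennreal (exp (- b * (norm z)\<^sup>2)) \<partial>lborel)
      = (\<integral>\<^sup>+(z::complex). (\<Prod>i\<in>Basis. ennreal (exp (- b * (z \<bullet> i)\<^sup>2))) \<partial>lborel)"
  proof (rule nn_integral_cong)
    fix z :: complex
    have "exp (- b * (norm z)\<^sup>2) = exp (- b * (z \<bullet> 1)\<^sup>2) * exp (- b * (z \<bullet> \<i>)\<^sup>2)"
      by (simp add: cmod_power2 algebra_simps flip: exp_add)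
    then show "ennreal (exp (- b * (norm z)\<^sup>2)) = (\<Prod>i\<in>Basis. ennreal (exp (- b * (z \<bullet> i)\<^sup>2)))"
      by (simp add: Basis_complex_def ennreal_mult complex_eq_iff)
  qed
  also have "\<dots> = (\<Prod>i\<in>(Basis::complex set). (\<integral>\<^sup>+x. ennreal (exp (- b * x\<^sup>2)) \<partial>lborel))"
    by (rule nn_integral_lborel_prod) auto
  also have "\<dots> = ennreal (pi / b)"
    unfolding nn_integral_gaussian_real[OF b]
    using b by (simp add: Basis_complex_def complex_eq_iff flip: ennreal_mult)
  finally show ?thesis .
qed

lemma gaussian_complex:
  assumes b: "b > 0"
  shows "integrable lborel (\<lambda>z::complex. exp (- b * (norm z)\<^sup>2))"
    and "(\<integral>z. exp (- b * (norm z)\<^sup>2) \<partial>(lborel :: complex measure)) = pi / b"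
proof -
  show "integrable lborel (\<lambda>z::complex. exp (- b * (norm z)\<^sup>2))"
    using nn_integral_gaussian_complex[OF b] by (intro integrableI_bounded) auto
  show "(\<integral>z. exp (- b * (norm z)\<^sup>2) \<partial>(lborel :: complex measure)) = pi / b"
    using nn_integral_gaussian_complex[OF b] b by (intro integral_eq_nn_integral[THEN trans]) auto
qed

text \<open>Complete the square: a linear term in the exponent costs a constant factor and half of
  the quadratic term.\<close>
lemma gaussian_exp_integrable:
  assumes b: "b > 0"
  shows "integrable lborel (\<lambda>z::complex. exp (a * norm z - b * (norm z)\<^sup>2))"
proof (rule Bochner_Integration.integrable_bound)
  show "integrable lborel (\<lambda>z::complex. exp (a\<^sup>2 / (2 * b)) * exp (- (b / 2) * (norm z)\<^sup>2))"
    using gaussian_complex(1)[of "b / 2"] b by (intro integrable_mult_right) simp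
  show "AE z::complex in lborel. norm (exp (a * norm z - b * (norm z)\<^sup>2))
      \<le> norm (exp (a\<^sup>2 / (2 * b)) * exp (- (b / 2) * (norm z)\<^sup>2))"
  proof (rule AE_I2)
    fix z :: complex
    have "0 \<le> (a - b * norm z)\<^sup>2 / (2 * b)" using b by simp
    also have "\<dots> = a\<^sup>2 / (2 * b) - a * norm z + b / 2 * (norm z)\<^sup>2"
      using b by (simp add: power2_eq_square field_simps)
    finally show "norm (exp (a * norm z - b * (norm z)\<^sup>2))
      \<le> norm (exp (a\<^sup>2 / (2 * b)) * exp (- (b / 2) * (norm z)\<^sup>2))"
      by (simp flip: exp_add)
  qed
qed simp

lemma sigma_finite_completion:
  assumes "sigma_finite_measure M"
  shows "sigma_finite_measure (completion M)"
proof -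
  interpret sigma_finite_measure M by fact
  obtain A where "countable A" "A \<subseteq> sets M" "\<Union>A = space M" "\<forall>a\<in>A. emeasure M a \<noteq> \<infinity>"
    using sigma_finite_countable by blast
  then show ?thesis
    by (intro sigma_finite_measure.intro exI[of _ A]) auto
qed

interpretation lebesgue: sigma_finite_measure "lebesgue :: 'a::euclidean_space measure"
  by (rule sigma_finite_completion) (rule sigma_finite_lborel)

interpretation lebesgue_pair: pair_sigma_finite
  "lebesgue :: 'a::euclidean_space measure" "lebesgue :: 'b::euclidean_space measure" ..

lemma lebesgue_id_measurable: "(\<lambda>x. x) \<in> lebesgue \<rightarrow>\<^sub>M borel"
  by (intro measurable_completion) simp

lemma lebesgue_fst_measurable [measurable]: "fst \<in> lebesgue \<Otimes>\<^sub>M N \<rightarrow>\<^sub>M borel"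
  and lebesgue_snd_measurable [measurable]: "snd \<in> N \<Otimes>\<^sub>M lebesgue \<rightarrow>\<^sub>M borel"
  using measurable_compose[OF measurable_fst lebesgue_id_measurable]
    measurable_compose[OF measurable_snd lebesgue_id_measurable] by auto

lemma borel_measurable_lebesgueI: "f \<in> borel_measurable borel \<Longrightarrow> f \<in> borel_measurable lebesgue"
  by (intro measurable_completion) simp

lemma norm_lebesgue_measurable [measurable]: "norm \<in> borel_measurable lebesgue"
  by (rule borel_measurable_lebesgueI) simp

lemma AE_lebesgue_neq: "AE u in lebesgue. u \<noteq> (c :: complex)"
  using AE_lborel_singleton[of c] by (rule AE_completion)

lemma gaussian_integrable_lebesgue:
  assumes "b > 0"
  shows "integrable lebesgue (\<lambda>z::complex. complex_of_real (exp (- b * (norm z)\<^sup>2)))"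
  using gaussian_complex(1)[OF assms] by (subst integrable_completion) auto

lemma gaussian_bound_L1_L2:
  fixes F :: "complex \<Rightarrow> complex"
  assumes a: "\<alpha> > 0" and F: "F \<in> borel_measurable lebesgue"
    and bound: "AE u in lebesgue. norm (F u) \<le> C * exp (b * norm u - \<alpha> * (norm u)\<^sup>2)"
  shows "integrable lebesgue F" "F \<in> L2 lebesgue"
proof -
  have i: "integrable lebesgue (\<lambda>u::complex. c * exp (b * norm u - d * (norm u)\<^sup>2))" if "d > 0" for b c d :: real
    using gaussian_exp_integrable[OF that, of b] by (subst integrable_completion) auto
  show "integrable lebesgue F"
    by (rule Bochner_Integration.integrable_bound[OF i[OF a, of C b] F])
       (use bound in \<open>eventually_elim, simp\<close>)
  have "integrable lebesgue (\<lambda>u. (norm (F u))\<^sup>2)"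
  proof (rule Bochner_Integration.integrable_bound[OF i[of "2 * \<alpha>" "C\<^sup>2" "2 * b"]])
    show "AE u in lebesgue. norm ((norm (F u))\<^sup>2) \<le> norm (C\<^sup>2 * exp (2 * b * norm u - 2 * \<alpha> * (norm u)\<^sup>2))"
      using bound
    proof eventually_elim
      case (elim u)
      then have "(norm (F u))\<^sup>2 \<le> (C * exp (b * norm u - \<alpha> * (norm u)\<^sup>2))\<^sup>2" by (intro power_mono) auto
      also have "\<dots> = C\<^sup>2 * exp (2 * b * norm u - 2 * \<alpha> * (norm u)\<^sup>2)"
        by (simp add: power_mult_distrib algebra_simps flip: exp_double)
      finally show ?case by simp
    qed
  qed (use a F in auto)
  then show "F \<in> L2 lebesgue" using F by (simp add: L2_def)
qed

section \<open>The Fock space and its reproducing kernel\<close>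

text \<open>The square root of the density of the Gaussian measure. Multiplication by it is an isometry from
  the weighted space into \<open>L\<^sup>2\<close> of Lebesgue measure, where all estimates take place.\<close>
definition fock_weight :: "real \<Rightarrow> complex \<Rightarrow> complex" where
  "fock_weight \<alpha> u = of_real (sqrt (\<alpha> / pi) * exp (- (\<alpha> / 2) * (norm u)\<^sup>2))"

lemma fock_weight_measurable [measurable]: "fock_weight \<alpha> \<in> borel_measurable borel"
  unfolding fock_weight_def by measurable

lemma fock_weight_sq:
  assumes "\<alpha> > 0"
  shows "(norm (fock_weight \<alpha> u))\<^sup>2 = \<alpha> / pi * exp (- \<alpha> * (norm u)\<^sup>2)"
    and "fock_weight \<alpha> u * cnj (fock_weight \<alpha> u) = of_real (\<alpha> / pi * exp (- \<alpha> * (norm u)\<^sup>2))"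
proof -
  have *: "(sqrt (\<alpha> / pi) * exp (- (\<alpha> / 2) * (norm u)\<^sup>2))\<^sup>2 = \<alpha> / pi * exp (- \<alpha> * (norm u)\<^sup>2)"
    using assms by (simp add: power_mult_distrib flip: exp_double)
  show "(norm (fock_weight \<alpha> u))\<^sup>2 = \<alpha> / pi * exp (- \<alpha> * (norm u)\<^sup>2)"
    unfolding fock_weight_def norm_of_real power2_abs by (rule *)
  then show "fock_weight \<alpha> u * cnj (fock_weight \<alpha> u) = of_real (\<alpha> / pi * exp (- \<alpha> * (norm u)\<^sup>2))"
    by (simp add: complex_norm_square[symmetric])
qed

lemma L2sq_fock_measure:
  assumes "\<alpha> > 0" and [measurable]: "h \<in> borel_measurable lebesgue"
  shows "L2sq (fock_measure \<alpha>) h = L2sq lebesgue (\<lambda>u. h u * fock_weight \<alpha> u)"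
  unfolding L2sq_def fock_measure_def
  by (subst nn_integral_density)
     (auto simp: norm_mult power_mult_distrib fock_weight_sq[OF assms(1)] mult.commute
        assms(1) less_imp_le intro!: nn_integral_cong simp flip: ennreal_mult)

lemma L2_fock_measure:
  assumes "\<alpha> > 0"
  shows "h \<in> L2 (fock_measure \<alpha>) \<longleftrightarrow> h \<in> borel_measurable lebesgue \<and> (\<lambda>u. h u * fock_weight \<alpha> u) \<in> L2 lebesgue"
proof -
  have "h \<in> borel_measurable (fock_measure \<alpha>) \<longleftrightarrow> h \<in> borel_measurable lebesgue"
    unfolding fock_measure_def by simp
  then show ?thesis
    unfolding L2_iff_L2sq using L2sq_fock_measure[OF assms, of h]
      borel_measurable_times[OF _ borel_measurable_lebesgueI[OF fock_weight_measurable[of \<alpha>]], of h] by auto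
qed

lemma entire_measurable: "h holomorphic_on UNIV \<Longrightarrow> h \<in> borel_measurable borel"
  by (intro borel_measurable_continuous_onI holomorphic_on_imp_continuous_on)

lemma fock_space_iff:
  assumes "\<alpha> > 0"
  shows "h \<in> fock_space \<alpha> \<longleftrightarrow> h holomorphic_on UNIV \<and> (\<lambda>u. h u * fock_weight \<alpha> u) \<in> L2 lebesgue"
  unfolding fock_space_def using L2_fock_measure[OF assms, of h] borel_measurable_lebesgueI[OF entire_measurable[of h]]
  by auto

lemma fock_holomorphic: "h \<in> fock_space \<alpha> \<Longrightarrow> h holomorphic_on UNIV"
  by (simp add: fock_space_def)

lemma fock_measurable: "h \<in> fock_space \<alpha> \<Longrightarrow> h \<in> borel_measurable borel"
  by (intro entire_measurable fock_holomorphic)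

lemma fock_weighted_L2: "\<alpha> > 0 \<Longrightarrow> h \<in> fock_space \<alpha> \<Longrightarrow> (\<lambda>u. h u * fock_weight \<alpha> u) \<in> L2 lebesgue"
  by (simp add: fock_space_iff)

lemma fock_inner_eq:
  assumes "\<alpha> > 0" and [measurable]: "h \<in> borel_measurable lebesgue" "k \<in> borel_measurable lebesgue"
  shows "fock_inner \<alpha> h k = (\<integral>u. (h u * fock_weight \<alpha> u) * cnj (k u * fock_weight \<alpha> u) \<partial>lebesgue)"
proof -
  have "fock_inner \<alpha> h k = (\<integral>u. (\<alpha> / pi * exp (- \<alpha> * (norm u)\<^sup>2)) *\<^sub>R (h u * cnj (k u)) \<partial>lebesgue)"
    unfolding fock_inner_def fock_measure_def using assms(1)
    by (subst integral_density) auto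
  also have "\<dots> = (\<integral>u. (h u * fock_weight \<alpha> u) * cnj (k u * fock_weight \<alpha> u) \<partial>lebesgue)"
  proof (rule Bochner_Integration.integral_cong[OF refl])
    fix u
    have "(h u * fock_weight \<alpha> u) * cnj (k u * fock_weight \<alpha> u) = (fock_weight \<alpha> u * cnj (fock_weight \<alpha> u)) * (h u * cnj (k u))"
      by simp
    then show "(\<alpha> / pi * exp (- \<alpha> * (norm u)\<^sup>2)) *\<^sub>R (h u * cnj (k u)) = (h u * fock_weight \<alpha> u) * cnj (k u * fock_weight \<alpha> u)"
      unfolding fock_weight_sq(2)[OF assms(1)] by (simp add: scaleR_conv_of_real)
  qed
  finally show ?thesis .
qed

lemma fock_norm_nonneg: "fock_norm \<alpha> h \<ge> 0"
proof -
  have "fock_inner \<alpha> h h = of_real (\<integral>u. (norm (h u))\<^sup>2 \<partial>fock_measure \<alpha>)"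
    unfolding fock_inner_def complex_norm_square[symmetric] by (rule integral_complex_of_real)
  then show ?thesis unfolding fock_norm_def by simp
qed

lemma fock_norm_sq:
  assumes "\<alpha> > 0" and h: "h \<in> fock_space \<alpha>"
  shows "ennreal ((fock_norm \<alpha> h)\<^sup>2) = L2sq lebesgue (\<lambda>u. h u * fock_weight \<alpha> u)"
proof -
  have m: "h \<in> borel_measurable lebesgue"
    using h by (auto simp: fock_space_def intro: borel_measurable_lebesgueI entire_measurable)
  have "fock_inner \<alpha> h h = (\<integral>u. of_real ((norm (h u * fock_weight \<alpha> u))\<^sup>2) \<partial>lebesgue)"
    unfolding fock_inner_eq[OF assms(1) m m] by (simp only: complex_norm_square)
  also have "\<dots> = of_real (\<integral>u. (norm (h u * fock_weight \<alpha> u))\<^sup>2 \<partial>lebesgue)" by (rule integral_complex_of_real)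
  finally have "(fock_norm \<alpha> h)\<^sup>2 = (\<integral>u. (norm (h u * fock_weight \<alpha> u))\<^sup>2 \<partial>lebesgue)"
    unfolding fock_norm_def by simp
  moreover have "(\<lambda>u. h u * fock_weight \<alpha> u) \<in> L2 lebesgue" using h fock_space_iff[OF assms(1)] by blast
  ultimately show ?thesis by (simp add: L2sq_eq_integral)
qed

lemma exp_linear_in_fock:
  assumes a: "\<alpha> > 0" and h: "h holomorphic_on UNIV" and bound: "\<And>u. norm (h u) \<le> C * exp (b * norm u)"
  shows "h \<in> fock_space \<alpha>"
proof -
  have [measurable]: "h \<in> borel_measurable borel" using h by (rule entire_measurable)
  have "(\<lambda>u. h u * fock_weight \<alpha> u) \<in> L2 lebesgue"
    unfolding L2_def
  proof (intro CollectI conjI)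
    show "(\<lambda>u. h u * fock_weight \<alpha> u) \<in> borel_measurable lebesgue"
      by (rule borel_measurable_lebesgueI) measurable
    have "integrable lborel (\<lambda>u. (norm (h u * fock_weight \<alpha> u))\<^sup>2)"
    proof (rule Bochner_Integration.integrable_bound)
      show "integrable lborel (\<lambda>u::complex. C\<^sup>2 * (\<alpha> / pi) * exp (2 * b * norm u - \<alpha> * (norm u)\<^sup>2))"
        by (intro integrable_mult_right gaussian_exp_integrable a)
      show "AE u in lborel. norm ((norm (h u * fock_weight \<alpha> u))\<^sup>2) \<le> norm (C\<^sup>2 * (\<alpha> / pi) * exp (2 * b * norm u - \<alpha> * (norm u)\<^sup>2))"
      proof (rule AE_I2)
        fix u :: complex
        have "(norm (h u))\<^sup>2 \<le> (C * exp (b * norm u))\<^sup>2" by (intro power_mono bound) simp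
        then have "(norm (h u))\<^sup>2 * (norm (fock_weight \<alpha> u))\<^sup>2 \<le> (C * exp (b * norm u))\<^sup>2 * (\<alpha> / pi * exp (- \<alpha> * (norm u)\<^sup>2))"
          unfolding fock_weight_sq[OF a] using a by (intro mult_right_mono) auto
        also have "\<dots> = C\<^sup>2 * (\<alpha> / pi) * exp (2 * b * norm u - \<alpha> * (norm u)\<^sup>2)"
          by (simp add: power_mult_distrib exp_diff exp_minus field_simps flip: exp_double)
        finally show "norm ((norm (h u * fock_weight \<alpha> u))\<^sup>2) \<le> norm (C\<^sup>2 * (\<alpha> / pi) * exp (2 * b * norm u - \<alpha> * (norm u)\<^sup>2))"
          using a by (simp add: norm_mult power_mult_distrib abs_mult)
      qed
    qed measurable
    then show "integrable lebesgue (\<lambda>u. (norm (h u * fock_weight \<alpha> u))\<^sup>2)"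
      by (subst integrable_completion) auto
  qed
  then show ?thesis using h by (simp add: fock_space_iff[OF a])
qed

lemma fock_kernel_in_fock:
  assumes "\<alpha> > 0"
  shows "fock_kernel \<alpha> w \<in> fock_space \<alpha>"
proof (rule exp_linear_in_fock[OF assms])
  show "fock_kernel \<alpha> w holomorphic_on UNIV"
    unfolding fock_kernel_def by (intro holomorphic_intros)
  show "norm (fock_kernel \<alpha> w u) \<le> 1 * exp ((\<alpha> * norm w) * norm u)" for u
  proof -
    have "norm (fock_kernel \<alpha> w u) \<le> exp (norm (of_real \<alpha> * u * cnj w))"
      unfolding fock_kernel_def by (rule norm_exp)
    also have "norm (of_real \<alpha> * u * cnj w) = (\<alpha> * norm w) * norm u"
      using assms by (simp add: norm_mult)
    finally show ?thesis by simp
  qed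
qed

lemma fock_space_diff:
  assumes "\<alpha> > 0" "h \<in> fock_space \<alpha>" "k \<in> fock_space \<alpha>"
  shows "(\<lambda>u. h u - k u) \<in> fock_space \<alpha>"
  using assms L2_diff[of "\<lambda>u. h u * fock_weight \<alpha> u" lebesgue "\<lambda>u. k u * fock_weight \<alpha> u"]
  by (auto simp: fock_space_iff left_diff_distrib intro!: holomorphic_intros)

lemma fock_space_add:
  assumes "\<alpha> > 0" "h \<in> fock_space \<alpha>" "k \<in> fock_space \<alpha>"
  shows "(\<lambda>u. h u + k u) \<in> fock_space \<alpha>"
  using assms L2_add[of "\<lambda>u. h u * fock_weight \<alpha> u" lebesgue "\<lambda>u. k u * fock_weight \<alpha> u"]
  by (auto simp: fock_space_iff distrib_right intro!: holomorphic_intros)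

lemma fock_space_cmult:
  assumes "\<alpha> > 0" "h \<in> fock_space \<alpha>"
  shows "(\<lambda>u. c * h u) \<in> fock_space \<alpha>"
  using assms L2_cmult[of "\<lambda>u. h u * fock_weight \<alpha> u" lebesgue c]
  by (auto simp: fock_space_iff mult.assoc intro!: holomorphic_intros)

lemma fock_weight_kernel:
  assumes a: "\<alpha> > 0"
  shows "fock_weight \<alpha> u * cnj (fock_kernel \<alpha> z u * fock_weight \<alpha> u)
    = of_real (\<alpha> / pi) * exp (of_real \<alpha> * z * cnj u - of_real (\<alpha> * (norm u)\<^sup>2))"
proof -
  have "fock_weight \<alpha> u * cnj (fock_kernel \<alpha> z u * fock_weight \<alpha> u)
      = cnj (fock_kernel \<alpha> z u) * (fock_weight \<alpha> u * cnj (fock_weight \<alpha> u))" by simp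
  moreover have "cnj (fock_kernel \<alpha> z u) = exp (of_real \<alpha> * z * cnj u)"
    by (simp add: fock_kernel_def exp_cnj mult_ac)
  moreover have "exp (of_real \<alpha> * z * cnj u - of_real (\<alpha> * (norm u)\<^sup>2))
      = exp (of_real \<alpha> * z * cnj u) * of_real (exp (- \<alpha> * (norm u)\<^sup>2))"
    by (simp only: exp_of_real[symmetric] exp_add[symmetric]) simp
  ultimately show ?thesis
    unfolding fock_weight_sq(2)[OF a] by simp
qed

lemma fock_inner_kernel_eq:
  assumes a: "\<alpha> > 0" and [measurable]: "h \<in> borel_measurable lebesgue"
  shows "fock_inner \<alpha> h (fock_kernel \<alpha> z)
    = of_real (\<alpha> / pi) * (\<integral>u. h u * exp (of_real \<alpha> * z * cnj u - of_real (\<alpha> * (norm u)\<^sup>2)) \<partial>lebesgue)"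
proof -
  have m: "fock_kernel \<alpha> z \<in> borel_measurable lebesgue"
    using fock_kernel_in_fock[OF a] by (auto simp: fock_space_def intro: borel_measurable_lebesgueI entire_measurable)
  have "(h u * fock_weight \<alpha> u) * cnj (fock_kernel \<alpha> z u * fock_weight \<alpha> u)
      = of_real (\<alpha> / pi) * (h u * exp (of_real \<alpha> * z * cnj u - of_real (\<alpha> * (norm u)\<^sup>2)))" for u
    using fock_weight_kernel[OF a, of u z] by (simp add: mult.assoc mult.left_commute)
  then show ?thesis unfolding fock_inner_eq[OF a assms(2) m] by simp
qed

text \<open>Apply the mean value property to the Weyl translate \<open>g v = h (z + v) e\<^bsup>-\<alpha> v cnj z\<^esup>\<close>: under
  \<open>u = z + v\<close> the integrand of the reproducing integral becomes \<open>g v e\<^bsup>-\<alpha>|v|\<^sup>2\<^esup>\<close>, and \<open>g 0 = h z\<close>.\<close>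
lemma fock_reproducing:
  assumes a: "\<alpha> > 0" and h: "h \<in> fock_space \<alpha>"
  shows "fock_inner \<alpha> h (fock_kernel \<alpha> z) = h z"
proof -
  have hol: "h holomorphic_on UNIV" using h by (simp add: fock_space_def)
  have [measurable]: "h \<in> borel_measurable borel" using hol by (rule entire_measurable)
  define k where "k u = h u * exp (of_real \<alpha> * z * cnj u - of_real (\<alpha> * (norm u)\<^sup>2))" for u
  have km [measurable]: "k \<in> borel_measurable borel" unfolding k_def by measurable
  have m: "fock_kernel \<alpha> z \<in> borel_measurable lebesgue" "h \<in> borel_measurable lebesgue"
    using fock_kernel_in_fock[OF a] hol by (auto simp: fock_space_def intro: borel_measurable_lebesgueI entire_measurable)
  have eq: "(h u * fock_weight \<alpha> u) * cnj (fock_kernel \<alpha> z u * fock_weight \<alpha> u) = of_real (\<alpha> / pi) * k u" for u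
    using fock_weight_kernel[OF a, of u z] by (simp add: k_def mult.assoc mult.left_commute)
  have "integrable lebesgue (\<lambda>u. (h u * fock_weight \<alpha> u) * cnj (fock_kernel \<alpha> z u * fock_weight \<alpha> u))"
    using h fock_kernel_in_fock[OF a, of z] by (intro L2_mult_cnj_integrable) (auto simp: fock_space_iff[OF a])
  then have "integrable lebesgue (\<lambda>u. of_real (\<alpha> / pi) * k u)" unfolding eq .
  then have "integrable lebesgue k"
    using a integrable_mult_right[of "of_real (pi / \<alpha>)" lebesgue "\<lambda>u. of_real (\<alpha> / pi) * k u"]
    by simp
  then have int: "integrable lborel k" by (simp add: integrable_completion)
  have shift: "lborel = distr lborel borel ((+) z)" by (rule lborel_distr_plus[symmetric])
  define g where "g v = h (z + v) * exp (- of_real \<alpha> * v * cnj z)" for v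
  have ghol: "g holomorphic_on UNIV"
  proof -
    have "(\<lambda>v. z + v) holomorphic_on UNIV" by (intro holomorphic_intros)
    then have "(h \<circ> (\<lambda>v. z + v)) holomorphic_on UNIV"
      by (rule holomorphic_on_compose_gen[OF _ hol]) simp
    then show ?thesis unfolding g_def o_def by (intro holomorphic_intros)
  qed
  have kg: "k (z + v) = g v * of_real (exp (- \<alpha> * (norm v)\<^sup>2))" for v
  proof -
    have e: "of_real \<alpha> * z * cnj (z + v) - of_real (\<alpha> * (norm (z + v))\<^sup>2)
        = - of_real \<alpha> * v * cnj z + of_real (- \<alpha> * (norm v)\<^sup>2)"
      unfolding of_real_mult complex_norm_square by (simp add: complex_norm_square algebra_simps)
    show ?thesis unfolding k_def g_def e by (simp only: exp_add exp_of_real mult.assoc)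
  qed
  have "integrable lborel (\<lambda>v. k (z + v))"
    using int by (subst (asm) shift) (simp add: integrable_distr_eq)
  then have "(\<integral>v. g v * of_real (exp (- \<alpha> * (norm v)\<^sup>2)) \<partial>lborel) = (\<integral>v. g 0 * of_real (exp (- \<alpha> * (norm v)\<^sup>2)) \<partial>(lborel :: complex measure))"
    by (intro radial_mean_value ghol) (auto simp: norm_mult kg)
  also have "\<dots> = g 0 * of_real (pi / \<alpha>)"
    using gaussian_complex(2)[OF a] by simp
  also have "g 0 = h z" by (simp add: g_def)
  also have "(\<integral>v. g v * of_real (exp (- \<alpha> * (norm v)\<^sup>2)) \<partial>lborel) = (\<integral>u. k u \<partial>lborel)"
    by (subst (2) shift) (simp add: integral_distr kg)
  finally have "(\<integral>u. k u \<partial>lborel) = h z * of_real (pi / \<alpha>)" .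
  moreover have "(\<integral>u. k u \<partial>lebesgue) = (\<integral>u. k u \<partial>lborel)"
    by (rule integral_completion) simp
  ultimately show ?thesis
    unfolding fock_inner_kernel_eq[OF a m(2)] k_def[symmetric] using a by simp
qed

lemma fock_norm_kernel:
  assumes a: "\<alpha> > 0"
  shows "fock_norm \<alpha> (fock_kernel \<alpha> z) = exp (\<alpha> / 2 * (norm z)\<^sup>2)"
proof -
  have "fock_kernel \<alpha> z z = of_real (exp (\<alpha> * (norm z)\<^sup>2))"
    unfolding fock_kernel_def mult.assoc complex_norm_square[symmetric] exp_of_real[symmetric] by simp
  then have "fock_norm \<alpha> (fock_kernel \<alpha> z) = sqrt (exp (\<alpha> * (norm z)\<^sup>2))"
    unfolding fock_norm_def fock_reproducing[OF a fock_kernel_in_fock[OF a]] by (simp only: Re_complex_of_real)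
  also have "exp (\<alpha> * (norm z)\<^sup>2) = (exp (\<alpha> / 2 * (norm z)\<^sup>2))\<^sup>2" by (simp flip: exp_double)
  finally show ?thesis by simp
qed

section \<open>The symplectic Fourier transform of integrable functions\<close>

text \<open>The multiplication formula in general form: an integral transform with a bounded kernel may be
  moved from one integrable factor to the other.\<close>
lemma fubini_bounded_kernel:
  fixes f g :: "complex \<Rightarrow> complex" and k :: "complex \<Rightarrow> complex \<Rightarrow> complex"
  assumes f: "integrable lebesgue f" and g: "integrable lebesgue g"
    and k [measurable]: "case_prod k \<in> borel_measurable (borel \<Otimes>\<^sub>M borel)"
    and bound: "\<And>u w. norm (k u w) \<le> 1"
  shows "(\<integral>w. g w * (\<integral>u. f u * k u w \<partial>lebesgue) \<partial>lebesgue) = (\<integral>u. f u * (\<integral>w. g w * k u w \<partial>lebesgue) \<partial>lebesgue)"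
proof -
  have [measurable]: "f \<in> borel_measurable lebesgue" "g \<in> borel_measurable lebesgue"
    using f g by auto
  have [measurable]: "(\<lambda>p. k (fst p) (snd p)) \<in> borel_measurable (lebesgue \<Otimes>\<^sub>M lebesgue)"
    using measurable_compose[OF measurable_Pair[OF lebesgue_fst_measurable lebesgue_snd_measurable] k]
    by (simp add: case_prod_beta)
  define F where "F u w = f u * g w * k u w" for u w
  have [measurable]: "case_prod F \<in> borel_measurable (lebesgue \<Otimes>\<^sub>M lebesgue)"
    unfolding F_def case_prod_beta by measurable
  have kw: "(\<lambda>w. k u w) \<in> borel_measurable lebesgue" for u
    by (rule borel_measurable_lebesgueI) measurable
  have b: "norm (F u w) \<le> norm (f u) * norm (g w)" for u w
    using mult_left_mono[OF bound[of u w], of "norm (f u) * norm (g w)"] by (simp add: F_def norm_mult)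
  have Fu: "integrable lebesgue (\<lambda>w. F u w)" for u
  proof (rule Bochner_Integration.integrable_bound)
    show "integrable lebesgue (\<lambda>w. norm (f u) * norm (g w))" using g by (intro integrable_mult_right) auto
    show "(\<lambda>w. F u w) \<in> borel_measurable lebesgue" unfolding F_def using kw by measurable
    show "AE w in lebesgue. norm (F u w) \<le> norm (norm (f u) * norm (g w))" using b by (intro AE_I2) simp
  qed
  have "integrable (lebesgue \<Otimes>\<^sub>M lebesgue) (case_prod F)"
  proof (rule lebesgue_pair.Fubini_integrable)
    show "AE u in lebesgue. integrable lebesgue (\<lambda>w. case_prod F (u, w))" using Fu by simp
    show "integrable lebesgue (\<lambda>u. \<integral>w. norm (case_prod F (u, w)) \<partial>lebesgue)"
    proof (rule Bochner_Integration.integrable_bound)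
      show "integrable lebesgue (\<lambda>u. norm (f u) * (\<integral>w. norm (g w) \<partial>lebesgue))"
        using f by (intro integrable_mult_left) auto
      show "AE u in lebesgue. norm (\<integral>w. norm (case_prod F (u, w)) \<partial>lebesgue) \<le> norm (norm (f u) * (\<integral>w. norm (g w) \<partial>lebesgue))"
      proof (rule AE_I2)
        fix u
        have "(\<integral>w. norm (F u w) \<partial>lebesgue) \<le> (\<integral>w. norm (f u) * norm (g w) \<partial>lebesgue)"
          using g Fu b by (intro integral_mono integrable_mult_right) auto
        then show "norm (\<integral>w. norm (case_prod F (u, w)) \<partial>lebesgue) \<le> norm (norm (f u) * (\<integral>w. norm (g w) \<partial>lebesgue))"
          by simp
      qed
    qed measurable
  qed measurable
  then have "(\<integral>w. (\<integral>u. F u w \<partial>lebesgue) \<partial>lebesgue) = (\<integral>u. (\<integral>w. F u w \<partial>lebesgue) \<partial>lebesgue)"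
    by (rule lebesgue_pair.Fubini_integral)
  moreover have "(\<integral>u. F u w \<partial>lebesgue) = g w * (\<integral>u. f u * k u w \<partial>lebesgue)" for w
    unfolding F_def by (simp add: mult.commute[of "f _" "g w"] mult.assoc)
  moreover have "(\<integral>w. F u w \<partial>lebesgue) = f u * (\<integral>w. g w * k u w \<partial>lebesgue)" for u
    unfolding F_def by (simp add: mult.assoc)
  ultimately show ?thesis by simp
qed

definition symplectic_phase :: "real \<Rightarrow> complex \<Rightarrow> complex \<Rightarrow> complex" where
  "symplectic_phase \<alpha> u w = exp (of_real \<alpha> * (u * cnj w - cnj u * w))"

lemma fourier_L1_symplectic_phase: "fourier_L1 \<alpha> G w = (\<integral>u. G u * symplectic_phase \<alpha> u w \<partial>lebesgue)"
  by (simp add: fourier_L1_def symplectic_phase_def)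

lemma norm_symplectic_phase [simp]: "norm (symplectic_phase \<alpha> u w) = 1"
  by (simp add: symplectic_phase_def norm_exp_eq_Re)

lemma cnj_symplectic_phase: "cnj (symplectic_phase \<alpha> u w) = symplectic_phase \<alpha> w u"
  by (simp add: symplectic_phase_def exp_cnj algebra_simps)

text \<open>Here the symplectic form pays off: composing two transforms depends on the outer variables
  through their difference only.\<close>
lemma symplectic_phase_mult: "symplectic_phase \<alpha> u w * symplectic_phase \<alpha> w v = symplectic_phase \<alpha> (u - v) w"
  by (simp add: symplectic_phase_def algebra_simps flip: exp_add)

lemma symplectic_phase_measurable [measurable]:
  "case_prod (symplectic_phase \<alpha>) \<in> borel_measurable (borel \<Otimes>\<^sub>M borel)"
  unfolding symplectic_phase_def by measurable

lemma symplectic_phase_lebesgue_measurable [measurable]: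
  "(\<lambda>u. symplectic_phase \<alpha> u w) \<in> borel_measurable lebesgue"
  "(\<lambda>p. symplectic_phase \<alpha> (fst p) (snd p)) \<in> borel_measurable (lebesgue \<Otimes>\<^sub>M lebesgue)"
  using measurable_compose[OF measurable_Pair[OF lebesgue_fst_measurable lebesgue_snd_measurable] symplectic_phase_measurable]
  by (auto simp: case_prod_beta intro!: borel_measurable_lebesgueI)

lemma symplectic_phase_integrable:
  assumes "integrable lebesgue G"
  shows "integrable lebesgue (\<lambda>u. G u * symplectic_phase \<alpha> u w)"
proof (rule Bochner_Integration.integrable_bound[OF assms])
  show "(\<lambda>u. G u * symplectic_phase \<alpha> u w) \<in> borel_measurable lebesgue" using assms by measurable
qed (simp add: norm_mult)

lemma fourier_L1_diff:
  assumes "integrable lebesgue G" "integrable lebesgue H"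
  shows "fourier_L1 \<alpha> (\<lambda>u. G u - H u) w = fourier_L1 \<alpha> G w - fourier_L1 \<alpha> H w"
  unfolding fourier_L1_symplectic_phase left_diff_distrib
  by (intro Bochner_Integration.integral_diff symplectic_phase_integrable assms)

lemma fourier_L1_cmult: "fourier_L1 \<alpha> (\<lambda>u. c * G u) w = c * fourier_L1 \<alpha> G w"
  unfolding fourier_L1_symplectic_phase by (simp add: mult.assoc)

lemma fourier_L1_measurable [measurable]:
  assumes [measurable]: "G \<in> borel_measurable lebesgue"
  shows "fourier_L1 \<alpha> G \<in> borel_measurable lebesgue"
proof -
  have [measurable]: "(\<lambda>p. symplectic_phase \<alpha> (snd p) (fst p)) \<in> borel_measurable (lebesgue \<Otimes>\<^sub>M lebesgue)"
    using measurable_compose[OF measurable_Pair[OF lebesgue_snd_measurable lebesgue_fst_measurable] symplectic_phase_measurable]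
    by (simp add: case_prod_beta)
  show ?thesis
    unfolding fourier_L1_symplectic_phase[abs_def]
    by (rule lebesgue.borel_measurable_lebesgue_integral) (simp add: case_prod_beta)
qed

lemma norm_fourier_L1_le: "norm (fourier_L1 \<alpha> G w) \<le> (\<integral>u. norm (G u) \<partial>lebesgue)"
  using integral_norm_bound[of lebesgue "\<lambda>u. G u * symplectic_phase \<alpha> u w"]
  by (simp add: fourier_L1_symplectic_phase norm_mult)

text \<open>The transform of a Gaussian is a value of a reproducing kernel. In the Fock space of
  parameter \<open>\<epsilon>\<close>, with \<open>b = (\<alpha> / \<epsilon>) x\<close>, the inner product of the kernels at \<open>- b\<close> and \<open>b\<close> is the integral on the
  left, up to the factor \<open>\<epsilon> / \<pi>\<close>, and it equals the kernel at \<open>- b\<close> evaluated in \<open>b\<close>.\<close>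
lemma fourier_gaussian:
  assumes a: "\<alpha> > 0" and e: "\<epsilon> > 0"
  shows "(\<integral>w. of_real (exp (- \<epsilon> * (norm w)\<^sup>2)) * symplectic_phase \<alpha> x w \<partial>lebesgue)
    = of_real (pi / \<epsilon> * exp (- (\<alpha>\<^sup>2 / \<epsilon>) * (norm x)\<^sup>2))"
proof -
  define b where "b = of_real (\<alpha> / \<epsilon>) * x"
  have eb: "of_real \<epsilon> * b = of_real \<alpha> * x" using e by (simp add: b_def)
  have ebc: "of_real \<epsilon> * cnj b = of_real \<alpha> * cnj x" using e by (simp add: b_def)
  have m: "fock_kernel \<epsilon> (- b) \<in> borel_measurable lebesgue"
    using fock_kernel_in_fock[OF e] by (auto simp: fock_space_def intro: borel_measurable_lebesgueI entire_measurable)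
  have "of_real (\<epsilon> / pi) * (\<integral>u. fock_kernel \<epsilon> (- b) u * exp (of_real \<epsilon> * b * cnj u - of_real (\<epsilon> * (norm u)\<^sup>2)) \<partial>lebesgue)
      = fock_kernel \<epsilon> (- b) b"
    using fock_reproducing[OF e fock_kernel_in_fock[OF e, of "- b"], of b] fock_inner_kernel_eq[OF e m, of b] by simp
  moreover have "fock_kernel \<epsilon> (- b) u * exp (of_real \<epsilon> * b * cnj u - of_real (\<epsilon> * (norm u)\<^sup>2))
      = of_real (exp (- \<epsilon> * (norm u)\<^sup>2)) * symplectic_phase \<alpha> x u" for u
  proof -
    have e1: "of_real \<epsilon> * u * cnj (- b) + (of_real \<epsilon> * b * cnj u - of_real (\<epsilon> * (norm u)\<^sup>2))
       = of_real (- \<epsilon> * (norm u)\<^sup>2) + of_real \<alpha> * (x * cnj u - cnj x * u)"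
      using eb ebc by (simp add: algebra_simps)
    show ?thesis
      unfolding fock_kernel_def symplectic_phase_def exp_of_real[symmetric] exp_add[symmetric] by (simp only: e1)
  qed
  moreover have "fock_kernel \<epsilon> (- b) b = of_real (exp (- (\<alpha>\<^sup>2 / \<epsilon>) * (norm x)\<^sup>2))"
  proof -
    have "of_real \<epsilon> * b * cnj (- b) = of_real (- (\<alpha>\<^sup>2 / \<epsilon>) * (norm x)\<^sup>2)"
      unfolding of_real_mult complex_norm_square b_def using e by (simp add: power2_eq_square)
    then show ?thesis unfolding fock_kernel_def exp_of_real[symmetric] by simp
  qed
  ultimately show ?thesis using e by (simp add: field_simps)
qed

section \<open>Gaussian regularization\<close>

definition heat_kernel :: "real \<Rightarrow> complex \<Rightarrow> real" where
  "heat_kernel t x = t / pi * exp (- t * (norm x)\<^sup>2)"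

text \<open>Convolution with the heat kernel (which is even) at inverse time \<open>t\<close>; the identity is the
  limit \<open>t \<rightarrow> \<infinity>\<close>.\<close>
definition heat_conv :: "real \<Rightarrow> (complex \<Rightarrow> complex) \<Rightarrow> complex \<Rightarrow> complex" where
  "heat_conv t G v = (\<integral>u. G u * of_real (heat_kernel t (u - v)) \<partial>lebesgue)"

lemma heat_kernel_nonneg: "t > 0 \<Longrightarrow> heat_kernel t x \<ge> 0"
  by (simp add: heat_kernel_def)

lemma heat_kernel_le: "t > 0 \<Longrightarrow> heat_kernel t x \<le> t / pi"
  by (simp add: heat_kernel_def divide_right_mono mult_left_le)

lemma heat_kernel_minus: "heat_kernel t (x - y) = heat_kernel t (y - x)"
  by (simp add: heat_kernel_def norm_minus_commute)

lemma heat_kernel_measurable [measurable]: "heat_kernel t \<in> borel_measurable borel"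
  unfolding heat_kernel_def by measurable

lemma heat_kernel_pair_measurable [measurable]:
  "(\<lambda>p. heat_kernel t (fst p - snd p)) \<in> borel_measurable (lebesgue \<Otimes>\<^sub>M lebesgue)"
  by (rule measurable_compose[OF _ heat_kernel_measurable]) measurable

lemma heat_kernel_lebesgue_measurable [measurable]:
  "(\<lambda>u. heat_kernel t (u - v)) \<in> borel_measurable lebesgue"
  by (intro borel_measurable_lebesgueI) measurable

lemma nn_integral_heat_kernel:
  assumes "t > 0"
  shows "(\<integral>\<^sup>+u. ennreal (heat_kernel t (u - v)) \<partial>lebesgue) = 1"
proof -
  have "(\<integral>\<^sup>+u. ennreal (heat_kernel t (u - v)) \<partial>lebesgue) = (\<integral>\<^sup>+u. ennreal (heat_kernel t u) \<partial>lborel)"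
    unfolding nn_integral_completion using nn_integral_lborel_shift(1)[of "\<lambda>u. ennreal (heat_kernel t u)" v] by simp
  also have "\<dots> = ennreal (t / pi) * (\<integral>\<^sup>+u. ennreal (exp (- t * (norm u)\<^sup>2)) \<partial>(lborel :: complex measure))"
    unfolding heat_kernel_def using assms by (subst nn_integral_cmult[symmetric]) (auto simp flip: ennreal_mult')
  also have "\<dots> = 1"
    unfolding nn_integral_gaussian_complex[OF assms] using assms by (simp flip: ennreal_mult)
  finally show ?thesis .
qed

lemma heat_conv_integrable:
  fixes G :: "complex \<Rightarrow> complex"
  assumes "t > 0" "integrable lebesgue G"
  shows "integrable lebesgue (\<lambda>u. G u * of_real (heat_kernel t (u - v)))"
proof (rule Bochner_Integration.integrable_bound)
  show "integrable lebesgue (\<lambda>u. (t / pi) * norm (G u))" using assms by auto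
  show "(\<lambda>u. G u * of_real (heat_kernel t (u - v))) \<in> borel_measurable lebesgue" using assms by measurable
  show "AE u in lebesgue. norm (G u * of_real (heat_kernel t (u - v))) \<le> norm ((t / pi) * norm (G u))"
  proof (rule AE_I2)
    fix u
    show "norm (G u * of_real (heat_kernel t (u - v))) \<le> norm ((t / pi) * norm (G u))"
      using mult_left_mono[OF heat_kernel_le[OF assms(1), of "u - v"], of "norm (G u)"]
        heat_kernel_nonneg[OF assms(1), of "u - v"] assms(1)
      by (simp add: norm_mult abs_mult mult.commute)
  qed
qed

lemma heat_conv_measurable [measurable]:
  assumes [measurable]: "G \<in> borel_measurable lebesgue"
  shows "heat_conv t G \<in> borel_measurable lebesgue"
proof -
  have [measurable]: "(\<lambda>p. heat_kernel t (snd p - fst p)) \<in> borel_measurable (lebesgue \<Otimes>\<^sub>M lebesgue)"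
    by (rule measurable_compose[OF _ heat_kernel_measurable]) measurable
  show ?thesis
    unfolding heat_conv_def[abs_def]
    by (rule lebesgue.borel_measurable_lebesgue_integral) (simp add: case_prod_beta)
qed

lemma heat_conv_diff:
  assumes "t > 0" "integrable lebesgue G" "integrable lebesgue H"
  shows "heat_conv t (\<lambda>u. G u - H u) v = heat_conv t G v - heat_conv t H v"
  unfolding heat_conv_def left_diff_distrib
  by (intro Bochner_Integration.integral_diff heat_conv_integrable assms)

lemma fourier_gauss_integrable:
  assumes G: "integrable lebesgue G" and e: "\<epsilon> > 0"
  shows "integrable lebesgue (\<lambda>w. fourier_L1 \<alpha> G w * of_real (exp (- \<epsilon> * (norm w)\<^sup>2)))"
proof (rule Bochner_Integration.integrable_bound)
  show "integrable lebesgue (\<lambda>w. of_real (\<integral>u. norm (G u) \<partial>lebesgue) * complex_of_real (exp (- \<epsilon> * (norm (w::complex))\<^sup>2)))"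
    using integrable_mult_right[OF gaussian_integrable_lebesgue[OF e]] by blast
  show "(\<lambda>w. fourier_L1 \<alpha> G w * of_real (exp (- \<epsilon> * (norm w)\<^sup>2))) \<in> borel_measurable lebesgue"
    using G by measurable
  show "AE w in lebesgue. norm (fourier_L1 \<alpha> G w * of_real (exp (- \<epsilon> * (norm w)\<^sup>2)))
      \<le> norm (of_real (\<integral>u. norm (G u) \<partial>lebesgue) * complex_of_real (exp (- \<epsilon> * (norm w)\<^sup>2)))"
    using norm_fourier_L1_le[of \<alpha> G] by (intro AE_I2) (simp add: norm_mult mult_right_mono)
qed

text \<open>The regularized form of the identity that the transform is its own inverse up to the
  factor \<open>(\<pi> / \<alpha>)\<^sup>2\<close>: by Fubini's theorem the Gaussian is transformed first, and its transform
  is a heat kernel.\<close>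
lemma fourier_gauss_fourier:
  assumes a: "\<alpha> > 0" and e: "\<epsilon> > 0" and G: "integrable lebesgue G"
  shows "fourier_L1 \<alpha> (\<lambda>w. fourier_L1 \<alpha> G w * of_real (exp (- \<epsilon> * (norm w)\<^sup>2))) v
    = of_real ((pi / \<alpha>)\<^sup>2) * heat_conv (\<alpha>\<^sup>2 / \<epsilon>) G v"
proof -
  have "fourier_L1 \<alpha> (\<lambda>w. fourier_L1 \<alpha> G w * of_real (exp (- \<epsilon> * (norm w)\<^sup>2))) v
     = (\<integral>w. of_real (exp (- \<epsilon> * (norm w)\<^sup>2)) * (\<integral>u. G u * symplectic_phase \<alpha> (u - v) w \<partial>lebesgue) \<partial>lebesgue)"
  proof -
    have "(\<integral>u. G u * symplectic_phase \<alpha> (u - v) w \<partial>lebesgue) = fourier_L1 \<alpha> G w * symplectic_phase \<alpha> w v" for w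
      unfolding fourier_L1_symplectic_phase by (simp add: symplectic_phase_mult[symmetric] mult.assoc[symmetric])
    then show ?thesis by (simp add: fourier_L1_symplectic_phase[of \<alpha> "\<lambda>w. fourier_L1 \<alpha> G w * _ w"] mult_ac)
  qed
  also have "\<dots> = (\<integral>u. G u * (\<integral>w. of_real (exp (- \<epsilon> * (norm w)\<^sup>2)) * symplectic_phase \<alpha> (u - v) w \<partial>lebesgue) \<partial>lebesgue)"
  proof (rule fubini_bounded_kernel)
    show "(\<lambda>(u, w). symplectic_phase \<alpha> (u - v) w) \<in> borel_measurable (borel \<Otimes>\<^sub>M borel)"
      unfolding symplectic_phase_def by measurable
  qed (use G gaussian_integrable_lebesgue[OF e] in auto)
  also have "\<dots> = (\<integral>u. of_real ((pi / \<alpha>)\<^sup>2) * (G u * of_real (heat_kernel (\<alpha>\<^sup>2 / \<epsilon>) (u - v))) \<partial>lebesgue)"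
    unfolding fourier_gaussian[OF a e] heat_kernel_def using a e by (simp add: field_simps power2_eq_square)
  finally show ?thesis by (simp add: heat_conv_def)
qed

text \<open>The multiplication formula moves the transform from \<open>G\<close> to the damped conjugate of its
  transform, where the preceding lemma evaluates it.\<close>
lemma gauss_plancherel:
  assumes a: "\<alpha> > 0" and e: "\<epsilon> > 0" and G: "integrable lebesgue G"
  shows "(\<integral>w. of_real ((norm (fourier_L1 \<alpha> G w))\<^sup>2 * exp (- \<epsilon> * (norm w)\<^sup>2)) \<partial>lebesgue)
    = of_real ((pi / \<alpha>)\<^sup>2) * (\<integral>u. G u * cnj (heat_conv (\<alpha>\<^sup>2 / \<epsilon>) G u) \<partial>lebesgue)"
proof -
  define E where "E w = fourier_L1 \<alpha> G w * of_real (exp (- \<epsilon> * (norm w)\<^sup>2))" for w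
  have E: "integrable lebesgue E" unfolding E_def by (rule fourier_gauss_integrable[OF G e])
  have "(\<integral>w. of_real ((norm (fourier_L1 \<alpha> G w))\<^sup>2 * exp (- \<epsilon> * (norm w)\<^sup>2)) \<partial>lebesgue)
      = (\<integral>w. cnj (E w) * (\<integral>u. G u * symplectic_phase \<alpha> u w \<partial>lebesgue) \<partial>lebesgue)"
    unfolding E_def fourier_L1_symplectic_phase[symmetric] of_real_mult complex_norm_square by (simp add: mult_ac)
  also have "\<dots> = (\<integral>u. G u * (\<integral>w. cnj (E w) * symplectic_phase \<alpha> u w \<partial>lebesgue) \<partial>lebesgue)"
    using E G by (intro fubini_bounded_kernel) auto
  also have "\<dots> = (\<integral>u. G u * cnj (fourier_L1 \<alpha> E u) \<partial>lebesgue)"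
  proof -
    have "cnj (fourier_L1 \<alpha> E u) = (\<integral>w. cnj (E w * symplectic_phase \<alpha> w u) \<partial>lebesgue)" for u
      unfolding fourier_L1_symplectic_phase by (rule Bochner_Integration.integral_cnj[symmetric])
    then show ?thesis by (simp add: cnj_symplectic_phase)
  qed
  also have "\<dots> = (\<integral>u. of_real ((pi / \<alpha>)\<^sup>2) * (G u * cnj (heat_conv (\<alpha>\<^sup>2 / \<epsilon>) G u)) \<partial>lebesgue)"
    unfolding E_def fourier_gauss_fourier[OF a e G] complex_cnj_mult complex_cnj_complex_of_real
    by (simp only: mult.left_commute)
  also have "\<dots> = of_real ((pi / \<alpha>)\<^sup>2) * (\<integral>u. G u * cnj (heat_conv (\<alpha>\<^sup>2 / \<epsilon>) G u) \<partial>lebesgue)"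
    by (rule integral_mult_right_zero)
  finally show ?thesis .
qed

text \<open>The heat kernel has integral 1, so the Cauchy-Schwarz inequality bounds \<open>|heat_conv t G|\<^sup>2\<close> by the heat
  convolution of \<open>|G|\<^sup>2\<close>, and integration over the outer variable gives the claim.\<close>
lemma L2sq_heat_conv_le:
  assumes t: "t > 0" and [measurable]: "G \<in> borel_measurable lebesgue"
  shows "L2sq lebesgue (heat_conv t G) \<le> L2sq lebesgue G"
proof -
  have [measurable]: "(\<lambda>p. heat_kernel t (snd p - fst p)) \<in> borel_measurable (lebesgue \<Otimes>\<^sub>M lebesgue)"
    by (rule measurable_compose[OF _ heat_kernel_measurable]) measurable
  have pt: "ennreal ((norm (heat_conv t G v))\<^sup>2)
      \<le> (\<integral>\<^sup>+u. ennreal ((norm (G u))\<^sup>2) * ennreal (heat_kernel t (u - v)) \<partial>lebesgue)" for v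
  proof -
    \<comment> \<open>split the kernel as \<open>s u * s u\<close> and give one factor to \<open>G\<close>\<close>
    define s where "s u = sqrt (heat_kernel t (u - v))" for u
    have ss: "s u * s u = heat_kernel t (u - v)" "s u \<ge> 0" for u
      using heat_kernel_nonneg[OF t] by (simp_all add: s_def)
    have [measurable]: "s \<in> borel_measurable lebesgue" unfolding s_def by measurable
    have "ennreal (norm (heat_conv t G v)) \<le> (\<integral>\<^sup>+u. ennreal (norm (G u * of_real (heat_kernel t (u - v)))) \<partial>lebesgue)"
    proof (cases "integrable lebesgue (\<lambda>u. G u * of_real (heat_kernel t (u - v)))")
      case True
      then show ?thesis unfolding heat_conv_def by (rule integral_norm_bound_ennreal)
    qed (simp add: heat_conv_def not_integrable_integral_eq)
    also have "\<dots> = (\<integral>\<^sup>+u. ennreal (norm (G u) * s u) * ennreal (s u) \<partial>lebesgue)"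
      by (intro nn_integral_cong) (simp add: norm_mult ss(2) mult.assoc heat_kernel_nonneg[OF t] flip: ennreal_mult ss(1))
    finally have "(ennreal (norm (heat_conv t G v)))\<^sup>2 \<le> (\<integral>\<^sup>+u. ennreal (norm (G u) * s u) * ennreal (s u) \<partial>lebesgue)\<^sup>2"
      by (rule power_mono) simp
    also have "\<dots> \<le> (\<integral>\<^sup>+u. (ennreal (norm (G u) * s u))\<^sup>2 \<partial>lebesgue) * (\<integral>\<^sup>+u. (ennreal (s u))\<^sup>2 \<partial>lebesgue)"
      by (rule Cauchy_Schwarz_nn_integral) measurable
    also have "(\<integral>\<^sup>+u. (ennreal (s u))\<^sup>2 \<partial>lebesgue) = 1"
      using nn_integral_heat_kernel[OF t, of v] by (simp add: ss power2_eq_square flip: ennreal_mult)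
    also have "(\<integral>\<^sup>+u. (ennreal (norm (G u) * s u))\<^sup>2 \<partial>lebesgue) = (\<integral>\<^sup>+u. ennreal ((norm (G u))\<^sup>2) * ennreal (heat_kernel t (u - v)) \<partial>lebesgue)"
    proof (rule nn_integral_cong)
      fix u
      have "(norm (G u) * s u)\<^sup>2 = (norm (G u))\<^sup>2 * heat_kernel t (u - v)"
        by (simp add: power2_eq_square ss(1)[symmetric])
      moreover have "(ennreal (norm (G u) * s u))\<^sup>2 = ennreal ((norm (G u) * s u)\<^sup>2)"
        using ss(2) by (intro ennreal_power) simp
      ultimately show "(ennreal (norm (G u) * s u))\<^sup>2 = ennreal ((norm (G u))\<^sup>2) * ennreal (heat_kernel t (u - v))"
        by (simp add: ennreal_mult' del: ennreal_power)
    qed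
    finally show ?thesis by (simp add: ennreal_power)
  qed
  have "L2sq lebesgue (heat_conv t G) \<le> (\<integral>\<^sup>+v. (\<integral>\<^sup>+u. ennreal ((norm (G u))\<^sup>2) * ennreal (heat_kernel t (u - v)) \<partial>lebesgue) \<partial>lebesgue)"
    unfolding L2sq_def by (intro nn_integral_mono pt)
  also have "\<dots> = (\<integral>\<^sup>+u. (\<integral>\<^sup>+v. ennreal ((norm (G u))\<^sup>2) * ennreal (heat_kernel t (u - v)) \<partial>lebesgue) \<partial>lebesgue)"
    by (rule lebesgue_pair.Fubini') measurable
  also have "\<dots> = (\<integral>\<^sup>+u. ennreal ((norm (G u))\<^sup>2) * 1 \<partial>lebesgue)"
  proof (rule nn_integral_cong)
    fix u
    show "(\<integral>\<^sup>+v. ennreal ((norm (G u))\<^sup>2) * ennreal (heat_kernel t (u - v)) \<partial>lebesgue) = ennreal ((norm (G u))\<^sup>2) * 1"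
      unfolding heat_kernel_minus[of t u]
      by (subst nn_integral_cmult) (auto simp: nn_integral_heat_kernel[OF t])
  qed
  finally show ?thesis by (simp add: L2sq_def)
qed

lemma scaleR_mult_of_real: "c *\<^sub>R (a * of_real h) = a * of_real (c * h)" for a :: complex
  by (simp add: scaleR_conv_of_real)

text \<open>Substitute \<open>u = v + x / (n + 1)\<close>; the parameter \<open>t = (n + 1)\<^sup>2\<close> is chosen so that the kernel
  becomes the fixed one with \<open>t = 1\<close>.\<close>
lemma heat_conv_rescale:
  assumes [measurable]: "G \<in> borel_measurable borel"
  shows "heat_conv ((real (Suc n))\<^sup>2) G v
    = (\<integral>x. G (v + (1 / real (Suc n)) *\<^sub>R x) * of_real (heat_kernel 1 x) \<partial>lborel)"
proof -
  define c where "c = 1 / real (Suc n)"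
  have c: "c > 0" "(real (Suc n))\<^sup>2 = 1 / c\<^sup>2" by (simp_all add: c_def power_divide)
  have "heat_conv ((real (Suc n))\<^sup>2) G v = (\<integral>u. G u * of_real (heat_kernel (1 / c\<^sup>2) (u - v)) \<partial>lborel)"
    unfolding heat_conv_def c(2) by (rule integral_completion) measurable
  also have "\<dots> = (\<integral>x. (c\<^sup>2) *\<^sub>R (G (v + c *\<^sub>R x) * of_real (heat_kernel (1 / c\<^sup>2) (c *\<^sub>R x))) \<partial>lborel)"
    using c(1) by (subst lborel_affine[of c v]) (simp_all add: integral_density integral_distr)
  also have "\<dots> = (\<integral>x. G (v + c *\<^sub>R x) * of_real (heat_kernel 1 x) \<partial>lborel)"
  proof (intro Bochner_Integration.integral_cong refl)
    fix x
    have "c\<^sup>2 * heat_kernel (1 / c\<^sup>2) (c *\<^sub>R x) = heat_kernel 1 x"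
      using c(1) by (simp add: heat_kernel_def power_mult_distrib)
    then show "(c\<^sup>2) *\<^sub>R (G (v + c *\<^sub>R x) * of_real (heat_kernel (1 / c\<^sup>2) (c *\<^sub>R x))) = G (v + c *\<^sub>R x) * of_real (heat_kernel 1 x)"
      using scaleR_mult_of_real[of "c\<^sup>2" "G (v + c *\<^sub>R x)" "heat_kernel (1 / c\<^sup>2) (c *\<^sub>R x)"] by simp
  qed
  finally show ?thesis by (simp add: c_def)
qed

lemma heat_kernel_integral:
  "integrable lborel (\<lambda>x. heat_kernel 1 x)" "(\<integral>x. heat_kernel 1 x \<partial>lborel) = 1"
  using gaussian_complex[of 1] by (simp_all add: heat_kernel_def)

lemma heat_conv_bounded:
  assumes "\<And>x. norm (G x) \<le> B" and [measurable]: "G \<in> borel_measurable borel"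
  shows "norm (heat_conv ((real (Suc n))\<^sup>2) G v) \<le> B"
proof -
  have "norm (heat_conv ((real (Suc n))\<^sup>2) G v) \<le> (\<integral>x. B * heat_kernel 1 x \<partial>lborel)"
    unfolding heat_conv_rescale[OF assms(2)]
  proof (rule Bochner_Integration.integral_norm_bound_integral)
    have le: "norm (G (v + (1 / real (Suc n)) *\<^sub>R x) * of_real (heat_kernel 1 x)) \<le> B * heat_kernel 1 x" for x
      using assms(1) heat_kernel_nonneg[of 1] by (simp add: norm_mult mult_right_mono)
    then show "norm (G (v + (1 / real (Suc n)) *\<^sub>R x) * of_real (heat_kernel 1 x)) \<le> B * heat_kernel 1 x" for x .
    show i: "integrable lborel (\<lambda>x. B * heat_kernel 1 x)" using heat_kernel_integral by simp
    show "integrable lborel (\<lambda>x. G (v + (1 / real (Suc n)) *\<^sub>R x) * of_real (heat_kernel 1 x))"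
      by (rule Bochner_Integration.integrable_bound[OF i]) (measurable, use le in \<open>fastforce intro: order_trans\<close>)
  qed
  then show ?thesis using heat_kernel_integral by simp
qed

lemma heat_conv_pointwise:
  assumes cont: "continuous_on UNIV G" and bound: "\<And>x. norm (G x) \<le> B"
  shows "(\<lambda>n. heat_conv ((real (Suc n))\<^sup>2) G v) \<longlonglongrightarrow> G v"
proof -
  have [measurable]: "G \<in> borel_measurable borel" using cont by (rule borel_measurable_continuous_onI)
  have "(\<lambda>n. \<integral>x. G (v + (1 / real (Suc n)) *\<^sub>R x) * of_real (heat_kernel 1 x) \<partial>lborel)
      \<longlonglongrightarrow> (\<integral>x. G v * of_real (heat_kernel 1 x) \<partial>lborel)"
  proof (rule integral_dominated_convergence[where w="\<lambda>x. B * heat_kernel 1 x"])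
    show "AE x in lborel. (\<lambda>n. G (v + (1 / real (Suc n)) *\<^sub>R x) * of_real (heat_kernel 1 x)) \<longlonglongrightarrow> G v * of_real (heat_kernel 1 x)"
    proof (intro AE_I2 tendsto_mult tendsto_const)
      fix x
      have "(\<lambda>n. v + (1 / real (Suc n)) *\<^sub>R x) \<longlonglongrightarrow> v + 0 *\<^sub>R x"
        by (intro tendsto_add tendsto_scaleR tendsto_const LIMSEQ_Suc[OF lim_1_over_n])
      then show "(\<lambda>n. G (v + (1 / real (Suc n)) *\<^sub>R x)) \<longlonglongrightarrow> G v"
        using cont by (intro isCont_tendsto_compose[of v G]) (auto simp: continuous_on_eq_continuous_at)
    qed
    show "AE x in lborel. norm (G (v + (1 / real (Suc n)) *\<^sub>R x) * of_real (heat_kernel 1 x)) \<le> B * heat_kernel 1 x" for n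
      using bound heat_kernel_nonneg[of 1] by (intro AE_I2) (simp add: norm_mult mult_right_mono)
    show "integrable lborel (\<lambda>x. B * heat_kernel 1 x)" using heat_kernel_integral by simp
  qed measurable
  then show ?thesis
    using heat_kernel_integral unfolding heat_conv_rescale[OF \<open>G \<in> borel_measurable borel\<close>] by simp
qed

text \<open>The convolutions converge pointwise and do not increase the norm. Dominated convergence gives the
  limit of the inner products with \<open>G\<close>, which suffices by \<open>L2sq_diff_le_of_L2sq_le\<close>.\<close>
lemma heat_conv_L2_continuous:
  assumes cont: "continuous_on UNIV G" and bound: "\<And>x. norm (G x) \<le> B"
    and G1: "integrable lebesgue G" and G2: "G \<in> L2 lebesgue"
  shows "L2_tendsto lebesgue (\<lambda>n. heat_conv ((real (Suc n))\<^sup>2) G) G"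
proof -
  let ?G = "\<lambda>n. heat_conv ((real (Suc n))\<^sup>2) G"
  have mb: "G \<in> borel_measurable borel" using cont by (rule borel_measurable_continuous_onI)
  have [measurable]: "G \<in> borel_measurable lebesgue" using G1 by simp
  have m: "?G n \<in> L2 lebesgue" for n
    using G2 L2sq_heat_conv_le[of "(real (Suc n))\<^sup>2" G] by (auto simp: L2_iff_L2sq intro: le_less_trans)
  have "(\<lambda>n. \<integral>x. ?G n x * cnj (G x) \<partial>lebesgue) \<longlonglongrightarrow> (\<integral>x. G x * cnj (G x) \<partial>lebesgue)"
  proof (rule integral_dominated_convergence[where w="\<lambda>x. B * norm (G x)"])
    show "AE x in lebesgue. (\<lambda>n. ?G n x * cnj (G x)) \<longlonglongrightarrow> G x * cnj (G x)"
      by (intro AE_I2 tendsto_mult tendsto_const heat_conv_pointwise[OF cont bound])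
    show "AE x in lebesgue. norm (?G n x * cnj (G x)) \<le> B * norm (G x)" for n
      using heat_conv_bounded[OF bound mb] by (intro AE_I2) (simp add: norm_mult mult_right_mono)
    show "integrable lebesgue (\<lambda>x. B * norm (G x))" using G1 by simp
  qed measurable
  moreover have "(\<integral>x. G x * cnj (G x) \<partial>lebesgue) = of_real (\<integral>x. (norm (G x))\<^sup>2 \<partial>lebesgue)"
    unfolding complex_norm_square[symmetric] by (rule integral_complex_of_real)
  ultimately have "(\<lambda>n. 2 * (\<integral>x. (norm (G x))\<^sup>2 \<partial>lebesgue) - 2 * Re (\<integral>x. ?G n x * cnj (G x) \<partial>lebesgue))
      \<longlonglongrightarrow> 2 * (\<integral>x. (norm (G x))\<^sup>2 \<partial>lebesgue) - 2 * Re (of_real (\<integral>x. (norm (G x))\<^sup>2 \<partial>lebesgue))"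
    by (intro tendsto_intros) simp
  then have "(\<lambda>n. ennreal (2 * (\<integral>x. (norm (G x))\<^sup>2 \<partial>lebesgue) - 2 * Re (\<integral>x. ?G n x * cnj (G x) \<partial>lebesgue))) \<longlonglongrightarrow> ennreal 0"
    by (intro tendsto_ennrealI) simp
  then show ?thesis
    unfolding L2_tendsto_L2sq ennreal_0
    by (rule tendsto_sandwich[OF _ _ tendsto_const, rotated 2])
       (use L2sq_diff_le_of_L2sq_le[OF m G2 L2sq_heat_conv_le] in \<open>auto simp del: of_nat_Suc\<close>)
qed

lemma bounded_support_L1_L2:
  assumes [measurable]: "f \<in> borel_measurable lebesgue"
    and bound: "\<And>x::'a::euclidean_space. norm (f x :: complex) \<le> B * indicator (cball 0 R) x" and B: "B \<ge> 0"
  shows "integrable lebesgue f" "f \<in> L2 lebesgue"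
proof -
  have i: "integrable lebesgue (\<lambda>x::'a. b * indicator (cball 0 R) x :: real)" for b
    using emeasure_lborel_cball_finite[of "0::'a" R]
    by (intro integrable_mult_right integrable_real_indicator) auto
  show "integrable lebesgue f"
    by (rule Bochner_Integration.integrable_bound[OF i[of B]]) (use bound B in \<open>auto simp: abs_mult\<close>)
  have "integrable lebesgue (\<lambda>x. (norm (f x))\<^sup>2)"
  proof (rule Bochner_Integration.integrable_bound[OF i[of "B\<^sup>2"]])
    show "AE x in lebesgue. norm ((norm (f x))\<^sup>2) \<le> norm (B\<^sup>2 * indicator (cball 0 R) x)"
    proof (rule AE_I2)
      fix x
      have "(norm (f x))\<^sup>2 \<le> (B * indicator (cball 0 R) x)\<^sup>2" by (intro power_mono bound) simp
      then show "norm ((norm (f x))\<^sup>2) \<le> norm (B\<^sup>2 * indicator (cball 0 R) x)"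
        by (cases "norm x \<le> R") (simp_all add: power_mult_distrib indicator_def)
    qed
  qed measurable
  then show "f \<in> L2 lebesgue" by (simp add: L2_def)
qed

text \<open>A measurable function is almost everywhere a limit of continuous functions \<open>g k\<close>.
  After truncating \<open>G\<close> to a bounded function of bounded support, radial clipping of the values of \<open>g k\<close> and
  multiplication by a continuous cutoff bound the approximants as well, and dominated convergence applies.\<close>
lemma L2_continuous_dense:
  fixes G :: "'a::euclidean_space \<Rightarrow> complex"
  assumes G: "G \<in> L2 lebesgue" and e: "e > 0"
  obtains \<phi> B where "continuous_on UNIV \<phi>" "\<And>x. norm (\<phi> x) \<le> B" "integrable lebesgue \<phi>" "\<phi> \<in> L2 lebesgue"
    "L2sq lebesgue (\<lambda>x. G x - \<phi> x) < ennreal e"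
proof -
  have [measurable]: "G \<in> borel_measurable lebesgue" using G by (rule L2_measurable)
  have nl [measurable]: "(norm :: 'a \<Rightarrow> real) \<in> borel_measurable lebesgue" by (rule borel_measurable_lebesgueI) simp
  define T where "T n x = (if norm x \<le> real n \<and> norm (G x) \<le> real n then G x else 0)" for n x
  have [measurable]: "T n \<in> borel_measurable lebesgue" for n unfolding T_def by measurable
  have "L2_tendsto lebesgue T G"
  proof (rule L2sq_dominated[where w="\<lambda>x. norm (G x)"])
    show "AE x in lebesgue. (\<lambda>n. T n x) \<longlonglongrightarrow> G x"
    proof (rule AE_I2)
      fix x
      obtain N where N: "norm x \<le> real N" "norm (G x) \<le> real N"
        using real_arch_simple[of "max (norm x) (norm (G x))"] by auto
      have "T n x = G x" if "n \<ge> N" for n using N that by (auto simp: T_def intro: order_trans)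
      then show "(\<lambda>n. T n x) \<longlonglongrightarrow> G x"
        by (intro tendsto_eventually) (auto simp: eventually_sequentially)
    qed
    show "AE x in lebesgue. norm (T n x - G x) \<le> norm (G x)" for n
      by (rule AE_I2) (simp add: T_def)
    show "(\<integral>\<^sup>+x. ennreal ((norm (G x))\<^sup>2) \<partial>lebesgue) < \<infinity>"
      using G by (simp add: L2_iff_L2sq L2sq_def)
  qed measurable
  then obtain n where n: "L2sq lebesgue (\<lambda>x. G x - T n x) < ennreal (e / 4)"
    using e by (elim L2_tendsto_less[where e="e/4"]) auto
  define B where "B = real n + 1"
  have B: "B > 0" "real n < B" by (auto simp: B_def)
  have "T n measurable_on UNIV" by (rule lebesgue_measurable_imp_measurable_on) auto
  then obtain N g where N: "negligible N" and g: "\<And>k. continuous_on UNIV (g k)"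
    and lim: "\<And>x. x \<notin> N \<Longrightarrow> (\<lambda>k. g k x) \<longlonglongrightarrow> T n x"
    unfolding measurable_on_def by (auto cong: if_cong)
  \<comment> \<open>the radial retraction onto the disc of radius \<open>B\<close>\<close>
  define cl where "cl z = (B / max B (norm z)) *\<^sub>R z" for z :: complex
  define cut where "cut x = max 0 (min 1 (B + 1 - norm x))" for x :: 'a
  have cl: "norm (cl z) \<le> B" for z using B by (auto simp: cl_def max_def divide_simps)
  have contcl: "continuous_on UNIV cl" unfolding cl_def using B by (intro continuous_intros) auto
  define \<phi> where "\<phi> k x = cut x *\<^sub>R cl (g k x)" for k x
  have cont: "continuous_on UNIV (\<phi> k)" for k
    unfolding \<phi>_def cut_def
    by (intro continuous_intros continuous_on_compose2[OF contcl] g) auto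
  have [measurable]: "\<phi> k \<in> borel_measurable lebesgue" for k
    by (intro borel_measurable_lebesgueI borel_measurable_continuous_onI cont)
  have b: "norm (\<phi> k x) \<le> B * indicator (cball 0 (B + 1)) x" for k x
  proof (cases "norm x \<le> B + 1")
    case True
    then have "\<bar>cut x\<bar> \<le> 1" by (simp add: cut_def)
    then have "norm (\<phi> k x) \<le> 1 * B" unfolding \<phi>_def norm_scaleR by (intro mult_mono cl) auto
    then show ?thesis using True by simp
  next
    case False
    then show ?thesis by (simp add: \<phi>_def cut_def)
  qed
  have \<phi>1: "integrable lebesgue (\<phi> k)" and \<phi>2: "\<phi> k \<in> L2 lebesgue" for k
    by (rule bounded_support_L1_L2[OF _ b less_imp_le[OF B(1)]], measurable)+
  have Tb: "norm (T n x) \<le> B * indicator (cball 0 (B + 1)) x" for x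
    using B by (auto simp: T_def)
  have lim': "(\<lambda>k. \<phi> k x) \<longlonglongrightarrow> T n x" if "x \<notin> N" for x
  proof -
    have "(\<lambda>k. \<phi> k x) \<longlonglongrightarrow> cut x *\<^sub>R cl (T n x)"
      unfolding \<phi>_def using contcl lim[OF that]
      by (intro tendsto_intros isCont_tendsto_compose[of _ cl]) (auto simp: continuous_on_eq_continuous_at)
    also have "cut x *\<^sub>R cl (T n x) = T n x"
      using B by (auto simp: T_def cut_def cl_def B_def max_def)
    finally show ?thesis .
  qed
  have "L2_tendsto lebesgue \<phi> (T n)"
  proof (rule L2sq_dominated[where w="\<lambda>x. 2 * B * indicator (cball 0 (B + 1)) x"])
    show "AE x in lebesgue. (\<lambda>k. \<phi> k x) \<longlonglongrightarrow> T n x"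
      using N lim' by (intro AE_I'[of N]) (auto simp: negligible_iff_null_sets)
    show "AE x in lebesgue. norm (\<phi> k x - T n x) \<le> 2 * B * indicator (cball 0 (B + 1)) x" for k
    proof (rule AE_I2)
      fix x
      show "norm (\<phi> k x - T n x) \<le> 2 * B * indicator (cball 0 (B + 1)) x"
        using norm_triangle_ineq4[of "\<phi> k x" "T n x"] b[of k x] Tb[of x] by linarith
    qed
    show "(\<lambda>x. 2 * B * indicator (cball (0::'a) (B + 1)) x) \<in> borel_measurable lebesgue"
      by (intro borel_measurable_times borel_measurable_const borel_measurable_indicator) auto
    have "(\<integral>\<^sup>+x. ennreal ((2 * B * indicator (cball (0::'a) (B + 1)) x)\<^sup>2) \<partial>lebesgue)
      = (\<integral>\<^sup>+x. ennreal ((2 * B)\<^sup>2) * indicator (cball (0::'a) (B + 1)) x \<partial>lebesgue)"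
      by (intro nn_integral_cong) (auto simp: indicator_def)
    also have "\<dots> = ennreal ((2 * B)\<^sup>2) * emeasure lborel (cball (0::'a) (B + 1))"
      by (subst nn_integral_cmult_indicator) auto
    also have "\<dots> < \<infinity>" using emeasure_lborel_cball_finite[of "0::'a" "B + 1"] by (simp add: ennreal_mult_less_top)
    finally show "(\<integral>\<^sup>+x. ennreal ((2 * B * indicator (cball (0::'a) (B + 1)) x)\<^sup>2) \<partial>lebesgue) < \<infinity>" .
  qed measurable
  then obtain k where k: "L2sq lebesgue (\<lambda>x. T n x - \<phi> k x) < ennreal (e / 4)"
    using e by (elim L2_tendsto_less[where e="e/4"]) auto
  have "L2sq lebesgue (\<lambda>x. G x - \<phi> k x) < ennreal (2 * (e / 4) + 2 * (e / 4))"
    by (rule L2sq_diff_less[OF _ _ _ n k]) auto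
  then have near: "L2sq lebesgue (\<lambda>x. G x - \<phi> k x) < ennreal e" by simp
  have "norm (\<phi> k x) \<le> B" for x using b[of k x] B by (cases "norm x \<le> B + 1") auto
  then show ?thesis by (rule that[OF cont _ \<phi>1 \<phi>2 near])
qed

text \<open>By density it suffices to treat continuous functions, since convolution does not increase the norm.\<close>
lemma heat_conv_L2_tendsto:
  assumes G1: "integrable lebesgue G" and G2: "G \<in> L2 lebesgue"
  shows "L2_tendsto lebesgue (\<lambda>n. heat_conv ((real (Suc n))\<^sup>2) G) G"
proof (rule L2_tendstoI)
  fix e :: real assume e: "e > 0"
  let ?T = "\<lambda>n. heat_conv ((real (Suc n))\<^sup>2)"
  obtain \<phi> B where \<phi>: "continuous_on UNIV \<phi>" "\<And>x. norm (\<phi> x) \<le> B" "integrable lebesgue \<phi>" "\<phi> \<in> L2 lebesgue"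
    and near: "L2sq lebesgue (\<lambda>x. G x - \<phi> x) < ennreal (e / 8)"
    using L2_continuous_dense[OF G2, of "e / 8"] e by auto
  have [measurable]: "G \<in> borel_measurable lebesgue" "\<phi> \<in> borel_measurable lebesgue" using G1 \<phi>(3) by auto
  have A: "L2sq lebesgue (\<lambda>x. ?T n G x - ?T n \<phi> x) < ennreal (e / 8)" for n
  proof -
    have "?T n (\<lambda>x. G x - \<phi> x) = (\<lambda>x. ?T n G x - ?T n \<phi> x)"
      by (intro ext heat_conv_diff G1 \<phi>(3)) simp
    then show ?thesis
      using L2sq_heat_conv_le[of "(real (Suc n))\<^sup>2" "\<lambda>x. G x - \<phi> x"] near
      by (simp del: of_nat_Suc)
  qed
  have "eventually (\<lambda>n. L2sq lebesgue (\<lambda>x. ?T n \<phi> x - \<phi> x) < ennreal (e / 16)) sequentially"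
    using e by (intro L2_tendstoD heat_conv_L2_continuous[OF \<phi>(1-4)]) auto
  then show "eventually (\<lambda>n. L2sq lebesgue (\<lambda>x. ?T n G x - G x) < ennreal e) sequentially"
  proof (eventually_elim)
    case (elim n)
    have near': "L2sq lebesgue (\<lambda>x. \<phi> x - G x) < ennreal (e / 8)" using near by (simp add: L2sq_minus_commute[of lebesgue \<phi> G])
    have "L2sq lebesgue (\<lambda>x. ?T n \<phi> x - G x) < ennreal (2 * (e / 16) + 2 * (e / 8))"
      by (rule L2sq_diff_less[OF _ _ _ elim near']) auto
    from L2sq_diff_less[OF _ _ _ A this]
    have "L2sq lebesgue (\<lambda>x. ?T n G x - G x) < ennreal (2 * (e / 8) + 2 * (2 * (e / 16) + 2 * (e / 8)))" by simp
    also have "2 * (e / 8) + 2 * (2 * (e / 16) + 2 * (e / 8)) = e" by simp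
    finally show ?case .
  qed
qed

section \<open>The Fourier transform on square-integrable functions\<close>

text \<open>Let \<open>\<epsilon> \<rightarrow> 0\<close> in the damped identity \<open>gauss_plancherel\<close>. On the left the damping is
  removed by monotone convergence; on the right the heat convolutions of \<open>G\<close> tend to \<open>G\<close> in the mean, so
  the inner products tend to the square norm of \<open>G\<close>. Taking \<open>\<epsilon> = (\<alpha> / (n + 1))\<^sup>2\<close> makes the heat parameter
  \<open>\<alpha>\<^sup>2 / \<epsilon>\<close> equal to \<open>(n + 1)\<^sup>2\<close>.\<close>
lemma fourier_plancherel:
  assumes a: "\<alpha> > 0" and G1: "integrable lebesgue G" and G2: "G \<in> L2 lebesgue"
  shows "L2sq lebesgue (fourier_L1 \<alpha> G) = ennreal ((pi / \<alpha>)\<^sup>2) * L2sq lebesgue G"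
proof -
  have [measurable]: "G \<in> borel_measurable lebesgue" using G1 by simp
  let ?T = "\<lambda>n. heat_conv ((real (Suc n))\<^sup>2) G"
  define \<epsilon> where "\<epsilon> n = (\<alpha> / real (Suc n))\<^sup>2" for n
  have \<epsilon>: "\<epsilon> n > 0" "\<alpha>\<^sup>2 / \<epsilon> n = (real (Suc n))\<^sup>2" for n
    using a by (auto simp: \<epsilon>_def power_divide simp del: of_nat_Suc)
  have \<epsilon>_lim: "\<epsilon> \<longlonglongrightarrow> 0"
  proof -
    have "(\<lambda>n. (\<alpha> * (1 / real (Suc n)))\<^sup>2) \<longlonglongrightarrow> (\<alpha> * 0)\<^sup>2"
      by (intro tendsto_power tendsto_mult tendsto_const LIMSEQ_Suc[OF lim_1_over_n])
    then show ?thesis by (simp add: \<epsilon>_def[abs_def])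
  qed
  have \<epsilon>_mono: "\<epsilon> n \<le> \<epsilon> m" if "m \<le> n" for m n
    unfolding \<epsilon>_def using a that by (intro power_mono divide_left_mono) auto
  define g where "g n w = (norm (fourier_L1 \<alpha> G w))\<^sup>2 * exp (- \<epsilon> n * (norm w)\<^sup>2)" for n w
  have g_int: "integrable lebesgue (g n)" for n
  proof (rule Bochner_Integration.integrable_bound)
    let ?K = "\<integral>u. norm (G u) \<partial>lebesgue"
    show "integrable lebesgue (\<lambda>w. ?K * norm (fourier_L1 \<alpha> G w * of_real (exp (- \<epsilon> n * (norm w)\<^sup>2))))"
      by (intro integrable_mult_right integrable_norm fourier_gauss_integrable G1 \<epsilon>)
    show "g n \<in> borel_measurable lebesgue" unfolding g_def by measurable
    show "AE w in lebesgue. norm (g n w) \<le> norm (?K * norm (fourier_L1 \<alpha> G w * of_real (exp (- \<epsilon> n * (norm w)\<^sup>2))))"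
    proof (rule AE_I2)
      fix w
      have "norm (g n w) = norm (fourier_L1 \<alpha> G w) * norm (fourier_L1 \<alpha> G w * of_real (exp (- \<epsilon> n * (norm w)\<^sup>2)))"
        by (simp add: g_def norm_mult power2_eq_square abs_mult)
      also have "\<dots> \<le> ?K * norm (fourier_L1 \<alpha> G w * of_real (exp (- \<epsilon> n * (norm w)\<^sup>2)))"
        by (intro mult_right_mono norm_fourier_L1_le) simp
      finally show "norm (g n w) \<le> norm (?K * norm (fourier_L1 \<alpha> G w * of_real (exp (- \<epsilon> n * (norm w)\<^sup>2))))"
        by simp
    qed
  qed
  have g_eq: "(\<integral>w. g n w \<partial>lebesgue) = (pi / \<alpha>)\<^sup>2 * Re (\<integral>u. G u * cnj (?T n u) \<partial>lebesgue)" for n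
  proof -
    have "complex_of_real (\<integral>w. g n w \<partial>lebesgue) = of_real ((pi / \<alpha>)\<^sup>2) * (\<integral>u. G u * cnj (?T n u) \<partial>lebesgue)"
      using gauss_plancherel[OF a \<epsilon>(1) G1, of n] unfolding \<epsilon>(2) g_def integral_complex_of_real .
    then have "Re (complex_of_real (\<integral>w. g n w \<partial>lebesgue)) = Re (of_real ((pi / \<alpha>)\<^sup>2) * (\<integral>u. G u * cnj (?T n u) \<partial>lebesgue))"
      by simp
    then show ?thesis unfolding times_complex.sel Re_complex_of_real Im_complex_of_real by simp
  qed
  have T2: "?T n \<in> L2 lebesgue" for n
    using G2 L2sq_heat_conv_le[of "(real (Suc n))\<^sup>2" G] by (auto simp: L2_iff_L2sq intro: le_less_trans)
  let ?N = "\<integral>u. (norm (G u))\<^sup>2 \<partial>lebesgue"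
  have inner_lim: "(\<lambda>n. \<integral>u. G u * cnj (?T n u) \<partial>lebesgue) \<longlonglongrightarrow> of_real ?N"
  proof -
    have diff: "(\<integral>u. G u * cnj (?T n u) \<partial>lebesgue) - of_real ?N = (\<integral>u. G u * cnj (?T n u - G u) \<partial>lebesgue)" for n
    proof -
      have "of_real ?N = (\<integral>u. G u * cnj (G u) \<partial>lebesgue)"
        unfolding complex_norm_square[symmetric] by (rule integral_complex_of_real[symmetric])
      then show ?thesis
        unfolding complex_cnj_diff right_diff_distrib
        using L2_mult_cnj_integrable[OF G2 T2] L2_mult_cnj_integrable[OF G2 G2] by simp
    qed
    have "(\<lambda>n. L2sq lebesgue (\<lambda>u. ?T n u - G u)) \<longlonglongrightarrow> 0"
      using heat_conv_L2_tendsto[OF G1 G2] unfolding L2_tendsto_L2sq .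
    then have "(\<lambda>n. ennreal (\<integral>u. (norm (?T n u - G u))\<^sup>2 \<partial>lebesgue)) \<longlonglongrightarrow> ennreal 0"
      unfolding L2sq_eq_integral[OF L2_diff[OF T2 G2]] ennreal_0 .
    then have "(\<lambda>n. \<integral>u. (norm (?T n u - G u))\<^sup>2 \<partial>lebesgue) \<longlonglongrightarrow> 0"
      by (subst (asm) tendsto_ennreal_iff) auto
    then have "(\<lambda>n. sqrt (?N * (\<integral>u. (norm (?T n u - G u))\<^sup>2 \<partial>lebesgue))) \<longlonglongrightarrow> sqrt (?N * 0)"
      by (intro tendsto_intros)
    then have sqrt_lim: "(\<lambda>n. sqrt (?N * (\<integral>u. (norm (?T n u - G u))\<^sup>2 \<partial>lebesgue))) \<longlonglongrightarrow> 0"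
      by (simp only: mult_zero_right real_sqrt_zero)
    have bound: "norm (\<integral>u. G u * cnj (?T n u - G u) \<partial>lebesgue) \<le> sqrt (?N * (\<integral>u. (norm (?T n u - G u))\<^sup>2 \<partial>lebesgue))" for n
      by (rule real_le_rsqrt) (rule L2_Cauchy_Schwarz[OF G2 L2_diff[OF T2 G2]])
    have "(\<lambda>n. \<integral>u. G u * cnj (?T n u - G u) \<partial>lebesgue) \<longlonglongrightarrow> 0"
      by (rule Lim_null_comparison[OF always_eventually sqrt_lim]) (intro allI bound)
    then show ?thesis unfolding diff[symmetric] LIM_zero_iff .
  qed
  have "(\<lambda>n. (pi / \<alpha>)\<^sup>2 * Re (\<integral>u. G u * cnj (?T n u) \<partial>lebesgue)) \<longlonglongrightarrow> (pi / \<alpha>)\<^sup>2 * Re (of_real ?N)"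
    by (intro tendsto_intros inner_lim)
  then have "(\<lambda>n. ennreal (\<integral>w. g n w \<partial>lebesgue)) \<longlonglongrightarrow> ennreal ((pi / \<alpha>)\<^sup>2 * ?N)"
    unfolding g_eq by (intro tendsto_ennrealI) simp
  also have "(\<lambda>n. ennreal (\<integral>w. g n w \<partial>lebesgue)) = (\<lambda>n. \<integral>\<^sup>+w. ennreal (g n w) \<partial>lebesgue)"
    using g_int by (subst nn_integral_eq_integral) (auto simp: g_def)
  finally have lim1: "(\<lambda>n. \<integral>\<^sup>+w. ennreal (g n w) \<partial>lebesgue) \<longlonglongrightarrow> ennreal ((pi / \<alpha>)\<^sup>2 * ?N)" .
  have mono: "incseq (\<lambda>n w. ennreal (g n w))"
    unfolding g_def
    by (intro monoI le_funI ennreal_leI mult_left_mono) (auto intro!: mult_right_mono \<epsilon>_mono)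
  have sup: "(SUP n. ennreal (g n w)) = ennreal ((norm (fourier_L1 \<alpha> G w))\<^sup>2)" for w
  proof (rule LIMSEQ_unique[OF LIMSEQ_SUP])
    show "incseq (\<lambda>n. ennreal (g n w))" using mono by (auto simp: mono_def le_fun_def)
    have "(\<lambda>n. g n w) \<longlonglongrightarrow> (norm (fourier_L1 \<alpha> G w))\<^sup>2 * exp (- 0 * (norm w)\<^sup>2)"
      unfolding g_def by (intro tendsto_intros \<epsilon>_lim)
    then show "(\<lambda>n. ennreal (g n w)) \<longlonglongrightarrow> ennreal ((norm (fourier_L1 \<alpha> G w))\<^sup>2)"
      by (intro tendsto_ennrealI) simp
  qed
  have "L2sq lebesgue (fourier_L1 \<alpha> G) = (SUP n. \<integral>\<^sup>+w. ennreal (g n w) \<partial>lebesgue)"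
    unfolding L2sq_def sup[symmetric]
    by (rule nn_integral_monotone_convergence_SUP[OF mono]) (use g_int in auto)
  also have "\<dots> = ennreal ((pi / \<alpha>)\<^sup>2 * ?N)"
  proof (rule LIMSEQ_unique[OF LIMSEQ_SUP lim1])
    show "incseq (\<lambda>n. \<integral>\<^sup>+w. ennreal (g n w) \<partial>lebesgue)"
      using mono by (auto simp: mono_def le_fun_def intro!: nn_integral_mono)
  qed
  finally show ?thesis by (simp add: L2sq_eq_integral[OF G2] ennreal_mult)
qed

lemma fourier_L1_in_L2:
  assumes "\<alpha> > 0" "integrable lebesgue G" "G \<in> L2 lebesgue"
  shows "fourier_L1 \<alpha> G \<in> L2 lebesgue"
  using fourier_plancherel[OF assms] assms by (auto simp: L2_iff_L2sq ennreal_mult_less_top)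

lemma fourier_plancherel_diff:
  assumes "\<alpha> > 0" "G \<in> L1 lebesgue \<inter> L2 lebesgue" "H \<in> L1 lebesgue \<inter> L2 lebesgue"
  shows "L2sq lebesgue (\<lambda>w. fourier_L1 \<alpha> G w - fourier_L1 \<alpha> H w)
    = ennreal ((pi / \<alpha>)\<^sup>2) * L2sq lebesgue (\<lambda>u. G u - H u)"
proof -
  have "(\<lambda>w. fourier_L1 \<alpha> G w - fourier_L1 \<alpha> H w) = fourier_L1 \<alpha> (\<lambda>u. G u - H u)"
    using assms by (intro ext fourier_L1_diff[symmetric]) (auto simp: L1_def)
  then show ?thesis
    using assms by (simp add: L1_def L2_diff fourier_plancherel)
qed

text \<open>The relation from which \<^const>\<open>fourier_L2\<close> chooses a value.\<close>
definition fourier_L2_limit :: "real \<Rightarrow> (complex \<Rightarrow> complex) \<Rightarrow> (complex \<Rightarrow> complex) \<Rightarrow> bool" where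
  "fourier_L2_limit \<alpha> G F \<longleftrightarrow> F \<in> L2 lebesgue \<and>
    (\<exists>Gn. (\<forall>n. Gn n \<in> L1 lebesgue \<inter> L2 lebesgue) \<and> L2_tendsto lebesgue Gn G \<and>
          L2_tendsto lebesgue (\<lambda>n. fourier_L1 \<alpha> (Gn n)) F)"

lemma ennreal_mult_less_mult_iff:
  assumes "c > 0"
  shows "ennreal c * x < ennreal (c * e) \<longleftrightarrow> x < ennreal e"
proof (cases x)
  case (real r)
  then have "ennreal c * x = ennreal (c * r)" using assms by (simp add: ennreal_mult)
  then show ?thesis using real assms by (simp add: ennreal_less_iff)
next
  case top
  then show ?thesis using assms by (simp add: ennreal_mult_top)
qed

text \<open>By Plancherel's theorem a sequence is Cauchy exactly if the sequence of its
  transforms is, and the space is complete.\<close>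
lemma L2_tendsto_fourier_transfer:
  assumes a: "\<alpha> > 0" and G: "\<And>n. Gn n \<in> L1 lebesgue \<inter> L2 lebesgue"
  shows "(\<exists>F. F \<in> L2 lebesgue \<and> L2_tendsto lebesgue (\<lambda>n. fourier_L1 \<alpha> (Gn n)) F)
    \<longleftrightarrow> (\<exists>G. G \<in> L2 lebesgue \<and> L2_tendsto lebesgue Gn G)"
proof -
  let ?c = "(pi / \<alpha>)\<^sup>2"
  have c: "?c > 0" using a by simp
  have F2: "fourier_L1 \<alpha> (Gn n) \<in> L2 lebesgue" for n
    using G[of n] by (intro fourier_L1_in_L2 a) (auto simp: L1_def)
  have iff: "L2sq lebesgue (\<lambda>w. fourier_L1 \<alpha> (Gn m) w - fourier_L1 \<alpha> (Gn n) w) < ennreal (?c * e)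
      \<longleftrightarrow> L2sq lebesgue (\<lambda>u. Gn m u - Gn n u) < ennreal e" for m n e
    unfolding fourier_plancherel_diff[OF a G G] by (rule ennreal_mult_less_mult_iff[OF c])
  show ?thesis
  proof
    assume "\<exists>F. F \<in> L2 lebesgue \<and> L2_tendsto lebesgue (\<lambda>n. fourier_L1 \<alpha> (Gn n)) F"
    then obtain F where F: "F \<in> L2 lebesgue" "L2_tendsto lebesgue (\<lambda>n. fourier_L1 \<alpha> (Gn n)) F" by blast
    show "\<exists>G. G \<in> L2 lebesgue \<and> L2_tendsto lebesgue Gn G"
    proof (rule L2_complete[of Gn])
      fix e :: real assume "e > 0"
      then show "\<exists>N. \<forall>m\<ge>N. \<forall>n\<ge>N. L2sq lebesgue (\<lambda>x. Gn m x - Gn n x) < ennreal e"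
        using L2_tendsto_Cauchy[OF L2_measurable[OF F2] L2_measurable[OF F(1)] F(2), of "?c * e"] c
        unfolding iff by simp
    qed (use G in auto)
  next
    assume "\<exists>G. G \<in> L2 lebesgue \<and> L2_tendsto lebesgue Gn G"
    then obtain H where H: "H \<in> L2 lebesgue" "L2_tendsto lebesgue Gn H" by blast
    show "\<exists>F. F \<in> L2 lebesgue \<and> L2_tendsto lebesgue (\<lambda>n. fourier_L1 \<alpha> (Gn n)) F"
    proof (rule L2_complete[OF F2])
      fix e :: real assume "e > 0"
      then have "\<exists>N. \<forall>m\<ge>N. \<forall>n\<ge>N. L2sq lebesgue (\<lambda>x. Gn m x - Gn n x) < ennreal (e / ?c)"
        using c G by (intro L2_tendsto_Cauchy[OF _ L2_measurable[OF H(1)] H(2)]) (auto intro: L2_measurable)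
      then have "\<exists>N. \<forall>m\<ge>N. \<forall>n\<ge>N. L2sq lebesgue (\<lambda>x. fourier_L1 \<alpha> (Gn m) x - fourier_L1 \<alpha> (Gn n) x) < ennreal (?c * (e / ?c))"
        unfolding iff .
      then show "\<exists>N. \<forall>m\<ge>N. \<forall>n\<ge>N. L2sq lebesgue (\<lambda>x. fourier_L1 \<alpha> (Gn m) x - fourier_L1 \<alpha> (Gn n) x) < ennreal e"
        using c by simp
    qed auto
  qed
qed

lemma fourier_L2_limit_exists:
  assumes a: "\<alpha> > 0" and G: "G \<in> L2 lebesgue"
  shows "\<exists>F. fourier_L2_limit \<alpha> G F"
proof -
  have "\<exists>\<phi>. \<phi> \<in> L1 lebesgue \<inter> L2 lebesgue \<and> L2sq lebesgue (\<lambda>x. G x - \<phi> x) < ennreal (1 / real (Suc n))" for n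
  proof -
    have "1 / real (Suc n) > 0" by simp
    then show ?thesis by (rule L2_continuous_dense[OF G]) (auto simp: L1_def)
  qed
  then obtain Gn where Gn: "\<And>n. Gn n \<in> L1 lebesgue \<inter> L2 lebesgue"
    "\<And>n. L2sq lebesgue (\<lambda>x. G x - Gn n x) < ennreal (1 / real (Suc n))" by metis
  have lim: "L2_tendsto lebesgue Gn G"
    unfolding L2_tendsto_L2sq
  proof (rule tendsto_sandwich[OF _ _ tendsto_const])
    show "(\<lambda>n. ennreal (1 / real (Suc n))) \<longlonglongrightarrow> 0"
      using tendsto_ennrealI[OF LIMSEQ_Suc[OF lim_1_over_n[where 'a=real]]] by simp
    show "\<forall>\<^sub>F n in sequentially. L2sq lebesgue (\<lambda>x. Gn n x - G x) \<le> ennreal (1 / real (Suc n))"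
      using Gn(2) by (intro always_eventually) (auto simp: L2sq_minus_commute[of _ _ G] simp del: of_nat_Suc intro: less_imp_le)
  qed auto
  have "\<exists>F. F \<in> L2 lebesgue \<and> L2_tendsto lebesgue (\<lambda>n. fourier_L1 \<alpha> (Gn n)) F"
    unfolding L2_tendsto_fourier_transfer[OF a Gn(1)] using G lim by (intro exI[of _ G] conjI)
  then obtain F where F: "F \<in> L2 lebesgue" "L2_tendsto lebesgue (\<lambda>n. fourier_L1 \<alpha> (Gn n)) F"
    by (elim exE conjE)
  then have "fourier_L2_limit \<alpha> G F"
    unfolding fourier_L2_limit_def by (intro conjI exI[of _ Gn] allI Gn(1) lim)
  then show ?thesis by (intro exI)
qed

text \<open>Both directions at once: the relation is well defined and injective up to null sets, because the
  transforms of the approximating sequences have the same mean-square distance as the sequences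
  themselves, up to a positive factor.\<close>
lemma fourier_L2_limit_unique:
  assumes a: "\<alpha> > 0" and GF: "fourier_L2_limit \<alpha> G F" "fourier_L2_limit \<alpha> G' F'"
    and G: "G \<in> L2 lebesgue" "G' \<in> L2 lebesgue"
  shows "(AE x in lebesgue. G x = G' x) \<longleftrightarrow> (AE x in lebesgue. F x = F' x)"
proof -
  let ?c = "ennreal ((pi / \<alpha>)\<^sup>2)"
  obtain P where P: "\<And>n. P n \<in> L1 lebesgue \<inter> L2 lebesgue" "L2_tendsto lebesgue P G"
      "L2_tendsto lebesgue (\<lambda>n. fourier_L1 \<alpha> (P n)) F" and F: "F \<in> L2 lebesgue"
    using GF(1) unfolding fourier_L2_limit_def by blast
  obtain Q where Q: "\<And>n. Q n \<in> L1 lebesgue \<inter> L2 lebesgue" "L2_tendsto lebesgue Q G'"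
      "L2_tendsto lebesgue (\<lambda>n. fourier_L1 \<alpha> (Q n)) F'" and F': "F' \<in> L2 lebesgue"
    using GF(2) unfolding fourier_L2_limit_def by blast
  have [measurable]: "G \<in> borel_measurable lebesgue" "G' \<in> borel_measurable lebesgue"
    "F \<in> borel_measurable lebesgue" "F' \<in> borel_measurable lebesgue"
    "\<And>n. P n \<in> borel_measurable lebesgue" "\<And>n. Q n \<in> borel_measurable lebesgue"
    using G F F' P(1) Q(1) by (auto intro: L2_measurable)
  have "(AE x in lebesgue. G x = G' x) \<longleftrightarrow> (\<lambda>n. L2sq lebesgue (\<lambda>x. P n x - Q n x)) \<longlonglongrightarrow> 0"
    using L2_tendsto_AE_iff[of P lebesgue G G'] L2_tendsto_iff_diff[of P lebesgue Q G'] P(2) Q(2) by auto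
  also have "\<dots> \<longleftrightarrow> (\<lambda>n. ?c * L2sq lebesgue (\<lambda>x. P n x - Q n x)) \<longlonglongrightarrow> 0"
  proof
    assume "(\<lambda>n. L2sq lebesgue (\<lambda>x. P n x - Q n x)) \<longlonglongrightarrow> 0"
    then have "(\<lambda>n. ?c * L2sq lebesgue (\<lambda>x. P n x - Q n x)) \<longlonglongrightarrow> ?c * 0"
      by (intro ennreal_tendsto_cmult) auto
    then show "(\<lambda>n. ?c * L2sq lebesgue (\<lambda>x. P n x - Q n x)) \<longlonglongrightarrow> 0" by simp
  next
    assume "(\<lambda>n. ?c * L2sq lebesgue (\<lambda>x. P n x - Q n x)) \<longlonglongrightarrow> 0"
    then have "(\<lambda>n. ennreal (1 / (pi / \<alpha>)\<^sup>2) * (?c * L2sq lebesgue (\<lambda>x. P n x - Q n x))) \<longlonglongrightarrow> ennreal (1 / (pi / \<alpha>)\<^sup>2) * 0"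
      by (intro ennreal_tendsto_cmult) auto
    moreover have "ennreal (1 / (pi / \<alpha>)\<^sup>2) * ?c = 1" using a by (simp flip: ennreal_mult')
    ultimately show "(\<lambda>n. L2sq lebesgue (\<lambda>x. P n x - Q n x)) \<longlonglongrightarrow> 0" by (simp add: mult.assoc[symmetric])
  qed
  also have "\<dots> \<longleftrightarrow> (\<lambda>n. L2sq lebesgue (\<lambda>x. fourier_L1 \<alpha> (P n) x - fourier_L1 \<alpha> (Q n) x)) \<longlonglongrightarrow> 0"
    unfolding fourier_plancherel_diff[OF a P(1) Q(1)] ..
  also have "\<dots> \<longleftrightarrow> (AE x in lebesgue. F x = F' x)"
    using L2_tendsto_AE_iff[of "\<lambda>n. fourier_L1 \<alpha> (P n)" lebesgue F F']
      L2_tendsto_iff_diff[of "\<lambda>n. fourier_L1 \<alpha> (P n)" lebesgue "\<lambda>n. fourier_L1 \<alpha> (Q n)" F'] P(3) Q(3) by auto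
  finally show ?thesis .
qed

lemma fourier_L2_limit_L1:
  assumes "\<alpha> > 0" "integrable lebesgue G" "G \<in> L2 lebesgue"
  shows "fourier_L2_limit \<alpha> G (fourier_L1 \<alpha> G)"
  unfolding fourier_L2_limit_def using assms fourier_L1_in_L2[OF assms]
  by (intro conjI exI[of _ "\<lambda>n. G"] allI L2_tendsto_const) (simp_all add: L1_def)

text \<open>The range is dense: approximate \<open>H\<close> by a continuous \<open>\<phi>\<close> and \<open>\<phi>\<close> by a heat convolution, which is, up to
  a factor, the transform of a damped transform of \<open>\<phi>\<close> by \<open>fourier_gauss_fourier\<close>. Since the transform is an isometry up to
  a factor, a dense range is everything.\<close>
lemma fourier_L2_limit_onto:
  assumes a: "\<alpha> > 0" and H: "H \<in> L2 lebesgue"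
  obtains G where "G \<in> L2 lebesgue" "fourier_L2_limit \<alpha> G H"
proof -
  let ?c = "complex_of_real ((pi / \<alpha>)\<^sup>2)"
  have c: "?c \<noteq> 0" using a by simp
  have "\<exists>E. E \<in> L1 lebesgue \<inter> L2 lebesgue \<and> L2sq lebesgue (\<lambda>x. H x - fourier_L1 \<alpha> E x) < ennreal e" if e: "e > 0" for e
  proof -
    obtain \<phi> B where \<phi>: "continuous_on UNIV \<phi>" "\<And>x. norm (\<phi> x) \<le> B" "integrable lebesgue \<phi>" "\<phi> \<in> L2 lebesgue"
      and near: "L2sq lebesgue (\<lambda>x. H x - \<phi> x) < ennreal (e / 4)"
      using L2_continuous_dense[OF H, of "e / 4"] e by auto
    obtain n where n: "L2sq lebesgue (\<lambda>x. \<phi> x - heat_conv ((real (Suc n))\<^sup>2) \<phi> x) < ennreal (e / 4)"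
      using L2_tendsto_less[OF heat_conv_L2_tendsto[OF \<phi>(3,4)], of "e / 4"] e by auto
    define \<epsilon> where "\<epsilon> = (\<alpha> / real (Suc n))\<^sup>2"
    have \<epsilon>: "\<epsilon> > 0" "\<alpha>\<^sup>2 / \<epsilon> = (real (Suc n))\<^sup>2"
      using a by (auto simp: \<epsilon>_def power_divide simp del: of_nat_Suc)
    define D where "D w = fourier_L1 \<alpha> \<phi> w * of_real (exp (- \<epsilon> * (norm w)\<^sup>2))" for w
    \<comment> \<open>its transform is the heat convolution of \<open>\<phi>\<close>\<close>
    define E where "E w = (1 / ?c) * D w" for w
    have D1: "integrable lebesgue D" unfolding D_def by (rule fourier_gauss_integrable[OF \<phi>(3) \<epsilon>(1)])
    have [measurable]: "D \<in> borel_measurable lebesgue" "\<phi> \<in> borel_measurable lebesgue" "H \<in> borel_measurable lebesgue"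
      using D1 \<phi>(3) H by (auto intro: L2_measurable)
    have "L2sq lebesgue D \<le> L2sq lebesgue (fourier_L1 \<alpha> \<phi>)"
      unfolding L2sq_def D_def
      by (intro nn_integral_mono ennreal_leI power_mono) (use \<epsilon>(1) in \<open>auto simp: norm_mult mult_left_le\<close>)
    then have D2: "D \<in> L2 lebesgue"
      using fourier_L1_in_L2[OF a \<phi>(3,4)] by (auto simp: L2_iff_L2sq intro: le_less_trans)
    have "fourier_L1 \<alpha> E v = heat_conv ((real (Suc n))\<^sup>2) \<phi> v" for v
      using fourier_gauss_fourier[OF a \<epsilon>(1) \<phi>(3), of v] c
      unfolding E_def fourier_L1_cmult \<epsilon>(2) D_def[symmetric] by simp
    then have FE: "fourier_L1 \<alpha> E = heat_conv ((real (Suc n))\<^sup>2) \<phi>" by (rule ext)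
    have "L2sq lebesgue (\<lambda>x. H x - fourier_L1 \<alpha> E x) < ennreal (2 * (e / 4) + 2 * (e / 4))"
      unfolding FE by (rule L2sq_diff_less[OF _ _ _ near n]) auto
    moreover have "E \<in> L1 lebesgue \<inter> L2 lebesgue"
      unfolding E_def L1_def Int_iff mem_Collect_eq by (intro conjI integrable_mult_right L2_cmult D1 D2)
    ultimately show ?thesis by auto
  qed
  then have "\<forall>n. \<exists>E. E \<in> L1 lebesgue \<inter> L2 lebesgue \<and> L2sq lebesgue (\<lambda>x. H x - fourier_L1 \<alpha> E x) < ennreal (1 / real (Suc n))"
    by (simp del: of_nat_Suc)
  then obtain E where E: "\<And>n. E n \<in> L1 lebesgue \<inter> L2 lebesgue"
    "\<And>n. L2sq lebesgue (\<lambda>x. H x - fourier_L1 \<alpha> (E n) x) < ennreal (1 / real (Suc n))" by metis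
  have lim: "L2_tendsto lebesgue (\<lambda>n. fourier_L1 \<alpha> (E n)) H"
    unfolding L2_tendsto_L2sq
  proof (rule tendsto_sandwich[OF _ _ tendsto_const])
    show "(\<lambda>n. ennreal (1 / real (Suc n))) \<longlonglongrightarrow> 0"
      using tendsto_ennrealI[OF LIMSEQ_Suc[OF lim_1_over_n[where 'a=real]]] by simp
    show "\<forall>\<^sub>F n in sequentially. L2sq lebesgue (\<lambda>x. fourier_L1 \<alpha> (E n) x - H x) \<le> ennreal (1 / real (Suc n))"
      using E(2) by (intro always_eventually) (auto simp: L2sq_minus_commute[of _ _ H] simp del: of_nat_Suc intro: less_imp_le)
  qed auto
  have "\<exists>G. G \<in> L2 lebesgue \<and> L2_tendsto lebesgue E G"
    unfolding L2_tendsto_fourier_transfer[OF a E(1), symmetric] using H lim by (intro exI[of _ H] conjI)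
  then obtain G where G: "G \<in> L2 lebesgue" "L2_tendsto lebesgue E G"
    by (elim exE conjE)
  then have "fourier_L2_limit \<alpha> G H"
    unfolding fourier_L2_limit_def by (intro conjI H exI[of _ E] allI E(1) lim)
  with G(1) show ?thesis by (rule that)
qed

lemma fourier_L2_limit_fourier_L2:
  assumes "\<alpha> > 0" "G \<in> L2 lebesgue"
  shows "fourier_L2_limit \<alpha> G (fourier_L2 \<alpha> G)"
proof -
  have "fourier_L2 \<alpha> G = (SOME F. fourier_L2_limit \<alpha> G F)"
    unfolding fourier_L2_def fourier_L2_limit_def ..
  then show ?thesis using someI_ex[OF fourier_L2_limit_exists[OF assms]] by (simp only:)
qed

lemma fourier_L2_inv_limit:
  assumes a: "\<alpha> > 0" and H: "H \<in> L2 lebesgue"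
  shows "fourier_L2_inv \<alpha> H \<in> L2 lebesgue"
    and "AE w in lebesgue. fourier_L2 \<alpha> (fourier_L2_inv \<alpha> H) w = H w"
proof -
  obtain G where G: "G \<in> L2 lebesgue" "fourier_L2_limit \<alpha> G H"
    using fourier_L2_limit_onto[OF a H] by blast
  have "AE w in lebesgue. fourier_L2 \<alpha> G w = H w"
    using fourier_L2_limit_unique[OF a fourier_L2_limit_fourier_L2[OF a G(1)] G(2) G(1) G(1)] by simp
  with G(1) have "\<exists>G. G \<in> L2 lebesgue \<and> (AE w in lebesgue. fourier_L2 \<alpha> G w = H w)" by blast
  from someI_ex[OF this] show "fourier_L2_inv \<alpha> H \<in> L2 lebesgue"
    "AE w in lebesgue. fourier_L2 \<alpha> (fourier_L2_inv \<alpha> H) w = H w"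
    unfolding fourier_L2_inv_def by auto
qed

text \<open>The inverse is an arbitrary choice among almost everywhere equal functions, and so is the
  transform that defines it. This is the form in which it can be computed with.\<close>
lemma fourier_L2_inv_eq_iff:
  assumes a: "\<alpha> > 0" and H: "H \<in> L2 lebesgue" and G: "integrable lebesgue G" "G \<in> L2 lebesgue"
  shows "(AE u in lebesgue. fourier_L2_inv \<alpha> H u = G u) \<longleftrightarrow> (AE w in lebesgue. H w = fourier_L1 \<alpha> G w)"
proof -
  have inv: "fourier_L2_inv \<alpha> H \<in> L2 lebesgue" by (rule fourier_L2_inv_limit[OF a H])
  have "(AE u in lebesgue. fourier_L2_inv \<alpha> H u = G u)
      \<longleftrightarrow> (AE w in lebesgue. fourier_L2 \<alpha> (fourier_L2_inv \<alpha> H) w = fourier_L1 \<alpha> G w)"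
    by (rule fourier_L2_limit_unique[OF a fourier_L2_limit_fourier_L2[OF a inv] fourier_L2_limit_L1[OF a G] inv G(2)])
  also have "\<dots> \<longleftrightarrow> (AE w in lebesgue. H w = fourier_L1 \<alpha> G w)"
  proof
    assume "AE w in lebesgue. fourier_L2 \<alpha> (fourier_L2_inv \<alpha> H) w = fourier_L1 \<alpha> G w"
    with fourier_L2_inv_limit(2)[OF a H] show "AE w in lebesgue. H w = fourier_L1 \<alpha> G w"
      by eventually_elim simp
  next
    assume "AE w in lebesgue. H w = fourier_L1 \<alpha> G w"
    with fourier_L2_inv_limit(2)[OF a H]
    show "AE w in lebesgue. fourier_L2 \<alpha> (fourier_L2_inv \<alpha> H) w = fourier_L1 \<alpha> G w"
      by eventually_elim simp
  qed
  finally show ?thesis .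
qed

section \<open>Taylor series in the Fock space\<close>

lemma power_le_exp: "x \<ge> 0 \<Longrightarrow> x ^ n \<le> fact n * exp (x::real)"
proof -
  assume x: "x \<ge> 0"
  have "x ^ n / fact n \<le> (\<Sum>k. x ^ k /\<^sub>R fact k)"
    using sum_le_suminf[of "\<lambda>k. x ^ k /\<^sub>R fact k" "{n}"] x summable_exp_generic[of x]
    by (simp add: divide_inverse mult.commute)
  also have "\<dots> = exp x" by (simp add: exp_def)
  finally show ?thesis by (simp add: field_simps)
qed

lemma power_in_fock:
  assumes "\<alpha> > 0"
  shows "(\<lambda>z. z ^ n) \<in> fock_space \<alpha>"
proof (rule exp_linear_in_fock[OF assms])
  show "(\<lambda>z. z ^ n) holomorphic_on UNIV" by (intro holomorphic_intros)
  show "norm (u ^ n) \<le> fact n * exp (1 * norm u)" for u :: complex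
    using power_le_exp[of "norm u" n] by (simp add: norm_power)
qed

lemma polynomial_in_fock:
  assumes "\<alpha> > 0"
  shows "(\<lambda>z. \<Sum>k<N. a k * z ^ k) \<in> fock_space \<alpha>"
proof (induction N)
  case 0
  show ?case using fock_space_cmult[OF assms power_in_fock[OF assms, of 0], of 0] by simp
next
  case (Suc N)
  show ?case
    using fock_space_add[OF assms Suc fock_space_cmult[OF assms power_in_fock[OF assms, of N], of "a N"]] by simp
qed

text \<open>The exact value is \<open>n! / \<alpha>\<^sup>n\<close>. A weaker bound suffices, and it follows from one term of the exponential series:
  \<open>(\<alpha>|z|\<^sup>2 / 2)\<^sup>n / n! \<le> e\<^bsup>\<alpha>|z|\<^sup>2 / 2\<^esup>\<close>.\<close>
lemma L2sq_power_le:
  assumes a: "\<alpha> > 0"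
  shows "L2sq lebesgue (\<lambda>z. z ^ n * fock_weight \<alpha> z) \<le> ennreal (2 * (2 / \<alpha>) ^ n * fact n)"
proof -
  define c where "c = (2 / \<alpha>) ^ n * fact n * (\<alpha> / pi)"
  have c: "c \<ge> 0" using a by (simp add: c_def)
  have pt: "(norm (z ^ n * fock_weight \<alpha> z))\<^sup>2 \<le> c * exp (- (\<alpha> / 2) * (norm z)\<^sup>2)" for z :: complex
  proof -
    have "(\<alpha> / 2 * (norm z)\<^sup>2) ^ n \<le> fact n * exp (\<alpha> / 2 * (norm z)\<^sup>2)"
      using a by (intro power_le_exp) simp
    then have "((norm z)\<^sup>2) ^ n \<le> (2 / \<alpha>) ^ n * (fact n * exp (\<alpha> / 2 * (norm z)\<^sup>2))"
      using a by (simp add: power_mult_distrib power_divide field_simps)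
    moreover have "(norm (z ^ n))\<^sup>2 = ((norm z)\<^sup>2) ^ n" by (simp add: norm_power flip: power_mult) (simp add: mult.commute)
    ultimately have "(norm (z ^ n))\<^sup>2 * (norm (fock_weight \<alpha> z))\<^sup>2
        \<le> (2 / \<alpha>) ^ n * (fact n * exp (\<alpha> / 2 * (norm z)\<^sup>2)) * (\<alpha> / pi * exp (- \<alpha> * (norm z)\<^sup>2))"
      unfolding fock_weight_sq[OF a] using a by (intro mult_mono) auto
    also have "\<dots> = c * (exp (\<alpha> / 2 * (norm z)\<^sup>2) * exp (- \<alpha> * (norm z)\<^sup>2))" by (simp add: c_def)
    also have "exp (\<alpha> / 2 * (norm z)\<^sup>2) * exp (- \<alpha> * (norm z)\<^sup>2) = exp (- (\<alpha> / 2) * (norm z)\<^sup>2)"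
      by (simp flip: exp_add)
    finally show ?thesis by (simp add: norm_mult power_mult_distrib)
  qed
  have "L2sq lebesgue (\<lambda>z. z ^ n * fock_weight \<alpha> z) \<le> (\<integral>\<^sup>+z. ennreal (c * exp (- (\<alpha> / 2) * (norm z)\<^sup>2)) \<partial>(lebesgue :: complex measure))"
    unfolding L2sq_def by (intro nn_integral_mono ennreal_leI pt)
  also have "\<dots> = ennreal c * (\<integral>\<^sup>+z. ennreal (exp (- (\<alpha> / 2) * (norm z)\<^sup>2)) \<partial>(lborel :: complex measure))"
    unfolding nn_integral_completion using c by (subst nn_integral_cmult[symmetric]) (auto simp: ennreal_mult)
  also have "\<dots> = ennreal (2 * (2 / \<alpha>) ^ n * fact n)"
    using nn_integral_gaussian_complex[of "\<alpha> / 2"] a c by (simp add: c_def field_simps flip: ennreal_mult')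
  finally show ?thesis .
qed

lemma fock_norm_power_le:
  assumes a: "\<alpha> > 0"
  shows "\<alpha> ^ n / fact n * fock_norm \<alpha> (\<lambda>z. z ^ n) \<le> sqrt 2 * sqrt ((2 * \<alpha>) ^ n / fact n)"
proof -
  have "ennreal ((fock_norm \<alpha> (\<lambda>z. z ^ n))\<^sup>2) \<le> ennreal (2 * (2 / \<alpha>) ^ n * fact n)"
    unfolding fock_norm_sq[OF a power_in_fock[OF a]] by (rule L2sq_power_le[OF a])
  then have "(fock_norm \<alpha> (\<lambda>z. z ^ n))\<^sup>2 \<le> 2 * (2 / \<alpha>) ^ n * fact n"
    using a by (subst (asm) ennreal_le_iff) auto
  then have "(\<alpha> ^ n / fact n)\<^sup>2 * (fock_norm \<alpha> (\<lambda>z. z ^ n))\<^sup>2 \<le> (\<alpha> ^ n / fact n)\<^sup>2 * (2 * (2 / \<alpha>) ^ n * fact n)"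
    by (rule mult_left_mono) simp
  also have "\<dots> = 2 * ((2 * \<alpha>) ^ n / fact n)"
    using a by (simp add: power_divide power_mult_distrib power2_eq_square field_simps)
  finally have "(\<alpha> ^ n / fact n * fock_norm \<alpha> (\<lambda>z. z ^ n))\<^sup>2 \<le> 2 * ((2 * \<alpha>) ^ n / fact n)"
    by (simp only: power_mult_distrib)
  then have "\<alpha> ^ n / fact n * fock_norm \<alpha> (\<lambda>z. z ^ n) \<le> sqrt (2 * ((2 * \<alpha>) ^ n / fact n))"
    by (rule real_le_rsqrt)
  then show ?thesis by (simp only: real_sqrt_mult)
qed

lemma power_series_tail_entire:
  assumes sums: "\<And>z. (\<lambda>k. a k * z ^ k) sums h z"
  obtains q where "q holomorphic_on UNIV" "\<And>z. h z - (\<Sum>k<N. a k * z ^ k) = z ^ N * q (z :: complex)"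
proof -
  define q where "q z = (\<Sum>k. a (k + N) * z ^ k)" for z
  have split: "(\<lambda>k. a (k + N) * z ^ (k + N)) sums (h z - (\<Sum>k<N. a k * z ^ k))" for z
    using sums_split_initial_segment[OF sums[of z], of N] .
  have summ: "summable (\<lambda>k. a (k + N) * z ^ k)" for z
  proof (cases "z = 0")
    case True
    then show ?thesis by (auto intro: summable_finite[of "{0}"])
  next
    case False
    have "(\<lambda>k. a (k + N) * z ^ (k + N) * (1 / z ^ N)) sums ((h z - (\<Sum>k<N. a k * z ^ k)) * (1 / z ^ N))"
      using split by (rule sums_mult2)
    then show ?thesis using False by (simp add: power_add sums_iff)
  qed
  then have qs: "(\<lambda>k. a (k + N) * z ^ k) sums q z" for z unfolding q_def by (rule summable_sums)
  have "q field_differentiable at z" for z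
  proof -
    have "q holomorphic_on ball 0 (norm z + 1)"
      by (rule power_series_holomorphic) (use qs in simp)
    then show ?thesis by (rule holomorphic_on_imp_differentiable_at) auto
  qed
  then have "q holomorphic_on UNIV" by (auto simp: holomorphic_on_def intro: field_differentiable_at_within)
  moreover have "h z - (\<Sum>k<N. a k * z ^ k) = z ^ N * q z" for z
  proof (rule sums_unique2[OF split])
    show "(\<lambda>k. a (k + N) * z ^ (k + N)) sums (z ^ N * q z)"
      using sums_mult[OF qs[of z], of "z ^ N"] by (simp add: power_add mult_ac)
  qed
  ultimately show ?thesis by (rule that)
qed

text \<open>For \<open>k < N\<close> the integrand is the entire function \<open>z\<^bsup>N - k\<^esup> q(z)\<close>, which vanishes
  at 0, times a multiple of the radial weight \<open>|z|\<^bsup>2k\<^esup> e\<^bsup>-\<alpha>|z|\<^sup>2\<^esup>\<close>.\<close>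
lemma fock_inner_tail_power:
  assumes a: "\<alpha> > 0" and q: "q holomorphic_on UNIV" and f: "(\<lambda>z. z ^ N * q z) \<in> fock_space \<alpha>" and k: "k < N"
  shows "(\<integral>z. (z ^ N * q z * fock_weight \<alpha> z) * cnj (z ^ k * fock_weight \<alpha> z) \<partial>lebesgue) = 0"
proof -
  define \<rho> where "\<rho> z = (norm z) ^ (2 * k) * (\<alpha> / pi * exp (- \<alpha> * (norm z)\<^sup>2))" for z :: complex
  define g where "g z = z ^ (N - k) * q z" for z
  have [measurable]: "q \<in> borel_measurable borel" using q by (rule entire_measurable)
  have [measurable]: "\<rho> \<in> borel_measurable borel" unfolding \<rho>_def by measurable
  have g: "g holomorphic_on UNIV" unfolding g_def using q by (intro holomorphic_intros)
  have [measurable]: "g \<in> borel_measurable borel" using g by (rule entire_measurable)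
  have eq: "(z ^ N * q z * fock_weight \<alpha> z) * cnj (z ^ k * fock_weight \<alpha> z) = g z * of_real (\<rho> z)" for z
  proof -
    have "(z ^ N * q z * fock_weight \<alpha> z) * cnj (z ^ k * fock_weight \<alpha> z)
       = z ^ (N - k) * q z * (z ^ k * cnj (z ^ k)) * (fock_weight \<alpha> z * cnj (fock_weight \<alpha> z))"
      using k by (simp add: mult_ac flip: power_add)
    also have "z ^ k * cnj (z ^ k) = of_real ((norm z) ^ (2 * k))"
      unfolding complex_cnj_power power_mult_distrib[symmetric] complex_norm_square[symmetric]
      by (simp add: power_mult)
    finally show ?thesis
      unfolding fock_weight_sq(2)[OF a] g_def \<rho>_def by simp
  qed
  have "integrable lebesgue (\<lambda>z. g z * of_real (\<rho> z))"
    unfolding eq[symmetric]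
    using L2_mult_cnj_integrable[OF fock_weighted_L2[OF a f] fock_weighted_L2[OF a power_in_fock[OF a, of k]]] by simp
  then have "integrable lborel (\<lambda>z. g z * of_real (\<rho> z))" by (subst (asm) integrable_completion) auto
  then have "(\<integral>z. g z * of_real (\<rho> z) \<partial>lborel) = (\<integral>z. g 0 * of_real (\<rho> z) \<partial>lborel)"
    by (intro radial_mean_value g) (auto simp: \<rho>_def norm_mult)
  also have "\<dots> = 0" using k by (simp add: g_def)
  finally show ?thesis unfolding eq by (subst integral_completion) auto
qed

text \<open>Write \<open>P N\<close> for the Taylor polynomials and \<open>R N\<close> for the remainders. For \<open>N \<le> M\<close> the remainder \<open>R M\<close> is
  orthogonal to \<open>P M - P N\<close>, so \<open>\<parallel>P M - P N\<parallel>\<^sup>2 = \<parallel>R N\<parallel>\<^sup>2 - \<parallel>R M\<parallel>\<^sup>2\<close>. The sequence \<open>\<parallel>R N\<parallel>\<^sup>2\<close> is decreasing, so it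
  has a limit \<open>l\<close>; letting \<open>M\<close> tend to infinity, Fatou's lemma gives \<open>\<parallel>R N\<parallel>\<^sup>2 \<le> \<parallel>R N\<parallel>\<^sup>2 - l\<close>, where the
  right-hand side tends to 0.\<close>
lemma fock_taylor_tendsto:
  assumes a: "\<alpha> > 0" and h: "h \<in> fock_space \<alpha>" and sums: "\<And>z. (\<lambda>k. a k * z ^ k) sums h z"
  shows "(\<lambda>N. L2sq lebesgue (\<lambda>z. (h z - (\<Sum>k<N. a k * z ^ k)) * fock_weight \<alpha> z)) \<longlonglongrightarrow> 0"
proof -
  define P where "P N z = (\<Sum>k<N. a k * z ^ k)" for N and z :: complex
  define W where "W f z = f z * fock_weight \<alpha> z" for f z
  have P: "P N \<in> fock_space \<alpha>" for N unfolding P_def by (rule polynomial_in_fock[OF a])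
  define R where "R N z = h z - P N z" for N z
  have R: "R N \<in> fock_space \<alpha>" for N unfolding R_def by (rule fock_space_diff[OF a h P])
  have WR: "W (R N) \<in> L2 lebesgue" for N unfolding W_def by (rule fock_weighted_L2[OF a R])
  define D where "D N M z = P M z - P N z" for N M z
  have D: "D N M \<in> fock_space \<alpha>" for N M unfolding D_def by (rule fock_space_diff[OF a P P])
  have WD: "W (D N M) \<in> L2 lebesgue" for N M unfolding W_def by (rule fock_weighted_L2[OF a D])
  have orth_power: "(\<integral>z. W (R M) z * cnj (W (\<lambda>z. z ^ k) z) \<partial>lebesgue) = 0" if "k < M" for k M
  proof -
    obtain q where q: "q holomorphic_on UNIV" "\<And>z. h z - (\<Sum>k<M. a k * z ^ k) = z ^ M * q z"
      using power_series_tail_entire[OF sums, where N=M] by blast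
    have "R M = (\<lambda>z. z ^ M * q z)" unfolding R_def P_def q(2) ..
    then show ?thesis using fock_inner_tail_power[OF a q(1) _ that] R[of M] unfolding W_def by simp
  qed
  have orth: "(\<integral>z. W (R M) z * cnj (W (D N M) z) \<partial>lebesgue) = 0" if "N \<le> M" for N M
  proof -
    have "D N M z = (\<Sum>k\<in>{N..<M}. a k * z ^ k)" for z
      unfolding D_def P_def using that by (simp add: sum_diff_nat_ivl lessThan_atLeast0)
    then have "W (R M) z * cnj (W (D N M) z) = (\<Sum>k\<in>{N..<M}. cnj (a k) * (W (R M) z * cnj (W (\<lambda>z. z ^ k) z)))" for z
      unfolding W_def by (simp add: sum_distrib_left sum_distrib_right mult_ac)
    moreover have "integrable lebesgue (\<lambda>z. W (R M) z * cnj (W (\<lambda>z. z ^ k) z))" for k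
      using L2_mult_cnj_integrable[OF WR fock_weighted_L2[OF a power_in_fock[OF a, of k]]] unfolding W_def by simp
    ultimately show ?thesis using orth_power by simp
  qed
  define d where "d N = (\<integral>z. (norm (W (R N) z))\<^sup>2 \<partial>lebesgue)" for N
  have pyth: "(\<integral>z. (norm (W (D N M) z))\<^sup>2 \<partial>lebesgue) = d N - d M" if "N \<le> M" for N M
  proof -
    define r where "r z = Re (W (R M) z * cnj (W (D N M) z))" for z
    have i: "integrable lebesgue (\<lambda>z. W (R M) z * cnj (W (D N M) z))" by (rule L2_mult_cnj_integrable[OF WR WD])
    have r: "integrable lebesgue r" "(\<integral>z. r z \<partial>lebesgue) = 0"
      unfolding r_def using integrable_Re[OF i] Bochner_Integration.integral_Re[OF i] orth[OF that] by simp_all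
    have "W (R N) z = W (R M) z + W (D N M) z" for z unfolding W_def R_def D_def by (simp add: algebra_simps)
    then have "(norm (W (R N) z))\<^sup>2 = (norm (W (R M) z))\<^sup>2 + (norm (W (D N M) z))\<^sup>2 + 2 * r z" for z
      unfolding cmod_power2 r_def by (simp add: power2_eq_square algebra_simps)
    then have "d N = d M + (\<integral>z. (norm (W (D N M) z))\<^sup>2 \<partial>lebesgue) + 2 * (\<integral>z. r z \<partial>lebesgue)"
      unfolding d_def using WR[of M] WD[of N M] r(1) by (simp add: L2_def)
    then show ?thesis using r(2) by simp
  qed
  have "decseq d"
  proof (rule decseq_SucI)
    fix N
    have "0 \<le> (\<integral>z. (norm (W (D N (Suc N)) z))\<^sup>2 \<partial>lebesgue)" by simp
    then show "d (Suc N) \<le> d N" using pyth[of N "Suc N"] by simp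
  qed
  moreover have dpos: "d N \<ge> 0" for N unfolding d_def by simp
  ultimately obtain l where l: "d \<longlonglongrightarrow> l" "\<And>N. l \<le> d N"
    using decseq_convergent[of d 0] by blast
  have le: "L2sq lebesgue (W (R N)) \<le> ennreal (d N - l)" for N
  proof -
    have m: "W (D N M) \<in> borel_measurable lebesgue" for M using WD by (rule L2_measurable)
    have "L2sq lebesgue (W (R N)) = (\<integral>\<^sup>+z. liminf (\<lambda>M. ennreal ((norm (W (D N M) z))\<^sup>2)) \<partial>lebesgue)"
      unfolding L2sq_def
    proof (rule nn_integral_cong)
      fix z
      have "(\<lambda>M. P M z) \<longlonglongrightarrow> h z" using sums[of z] unfolding P_def sums_def .
      then have "(\<lambda>M. ennreal ((norm (W (D N M) z))\<^sup>2)) \<longlonglongrightarrow> ennreal ((norm (W (R N) z))\<^sup>2)"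
        unfolding W_def D_def R_def by (intro tendsto_ennrealI tendsto_intros)
      then show "ennreal ((norm (W (R N) z))\<^sup>2) = liminf (\<lambda>M. ennreal ((norm (W (D N M) z))\<^sup>2))"
        by (intro lim_imp_Liminf[symmetric]) auto
    qed
    also have "\<dots> \<le> liminf (\<lambda>M. L2sq lebesgue (W (D N M)))"
      unfolding L2sq_def by (rule nn_integral_liminf) (use m in measurable)
    also have "\<dots> \<le> liminf (\<lambda>M::nat. ennreal (d N - l))"
    proof (rule Liminf_mono)
      show "eventually (\<lambda>M. L2sq lebesgue (W (D N M)) \<le> ennreal (d N - l)) sequentially"
        using pyth[of N] l(2) unfolding eventually_sequentially L2sq_eq_integral[OF WD]
        by (intro exI[of _ N] allI impI ennreal_leI) simp
    qed
    finally show ?thesis by (simp add: Liminf_const)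
  qed
  have "(\<lambda>N. ennreal (d N - l)) \<longlonglongrightarrow> ennreal (l - l)" by (intro tendsto_ennrealI tendsto_intros l)
  then have "(\<lambda>N. ennreal (d N - l)) \<longlonglongrightarrow> 0" by simp
  then have "(\<lambda>N. L2sq lebesgue (W (R N))) \<longlonglongrightarrow> 0"
    by (rule tendsto_sandwich[OF _ _ tendsto_const, rotated 2]) (intro always_eventually allI le zero_le)+
  then show ?thesis unfolding W_def R_def P_def .
qed

text \<open>The constant is a parameter, so that a bound can be uniform over a family of functionals.\<close>
definition fock_functional :: "real \<Rightarrow> real \<Rightarrow> ((complex \<Rightarrow> complex) \<Rightarrow> complex) \<Rightarrow> bool" where
  "fock_functional \<alpha> C L \<longleftrightarrow>
     (\<forall>h\<in>fock_space \<alpha>. \<forall>k\<in>fock_space \<alpha>. L (\<lambda>z. h z + k z) = L h + L k) \<and>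
     (\<forall>c. \<forall>h\<in>fock_space \<alpha>. L (\<lambda>z. c * h z) = c * L h) \<and>
     (\<forall>h\<in>fock_space \<alpha>. norm (L h) \<le> C * fock_norm \<alpha> h)"

lemma fock_functional_sums:
  assumes a: "\<alpha> > 0" and L: "fock_functional \<alpha> C L"
    and h: "h \<in> fock_space \<alpha>" and sums: "\<And>z. (\<lambda>k. a k * z ^ k) sums h z"
  shows "(\<lambda>k. a k * L (\<lambda>z. z ^ k)) sums L h"
proof -
  have add: "L (\<lambda>z. h z + k z) = L h + L k" if "h \<in> fock_space \<alpha>" "k \<in> fock_space \<alpha>" for h k
    using L that unfolding fock_functional_def by blast
  have scal: "L (\<lambda>z. c * h z) = c * L h" if "h \<in> fock_space \<alpha>" for h c
    using L that unfolding fock_functional_def by blast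
  have bd: "norm (L h) \<le> C * fock_norm \<alpha> h" if "h \<in> fock_space \<alpha>" for h
    using L that unfolding fock_functional_def by blast
  let ?P = "\<lambda>N z. \<Sum>k<N. a k * z ^ k"
  have P: "?P N \<in> fock_space \<alpha>" for N by (rule polynomial_in_fock[OF a])
  have LP: "L (?P N) = (\<Sum>k<N. a k * L (\<lambda>z. z ^ k))" for N
  proof (induction N)
    case 0
    show ?case using scal[OF P[of 0], of 0] by simp
  next
    case (Suc N)
    then show ?case
      using add[OF P[of N] fock_space_cmult[OF a power_in_fock[OF a, of N], of "a N"]]
        scal[OF power_in_fock[OF a, of N], of "a N"] by simp
  qed
  have R: "(\<lambda>z. h z - ?P N z) \<in> fock_space \<alpha>" for N by (rule fock_space_diff[OF a h P])
  have LR: "L h - L (?P N) = L (\<lambda>z. h z - ?P N z)" for N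
    using add[OF R[of N] P[of N]] by simp
  define n where "n N = fock_norm \<alpha> (\<lambda>z. h z - ?P N z)" for N
  have n0: "n N \<ge> 0" for N unfolding n_def by (rule fock_norm_nonneg)
  have "(\<lambda>N. ennreal ((n N)\<^sup>2)) \<longlonglongrightarrow> ennreal 0"
    using fock_taylor_tendsto[OF a h sums] unfolding n_def fock_norm_sq[OF a R] ennreal_0 .
  then have "(\<lambda>N. (n N)\<^sup>2) \<longlonglongrightarrow> 0" by (subst (asm) tendsto_ennreal_iff) auto
  then have "(\<lambda>N. sqrt ((n N)\<^sup>2)) \<longlonglongrightarrow> sqrt 0" by (rule tendsto_real_sqrt)
  then have "n \<longlonglongrightarrow> 0" using n0 by simp
  then have "(\<lambda>N. C * n N) \<longlonglongrightarrow> C * 0" by (intro tendsto_intros)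
  then have Cn: "(\<lambda>N. C * n N) \<longlonglongrightarrow> 0" by simp
  have "(\<lambda>N. L (?P N) - L h) \<longlonglongrightarrow> 0"
  proof (rule Lim_null_comparison[OF always_eventually Cn], rule allI)
    fix N
    show "norm (L (?P N) - L h) \<le> C * n N"
      using bd[OF R[of N]] unfolding n_def LR[symmetric] by (simp add: norm_minus_commute)
  qed
  then have "(\<lambda>N. L (?P N)) \<longlonglongrightarrow> L h" by (simp only: LIM_zero_iff)
  then show ?thesis unfolding LP sums_def .
qed

lemma fock_functional_zero:
  assumes a: "\<alpha> > 0" and L: "fock_functional \<alpha> C L" and zero: "\<And>k. L (\<lambda>z. z ^ k) = 0"
    and h: "h \<in> fock_space \<alpha>"
  shows "L h = 0"
proof -
  have "(\<lambda>k. (deriv ^^ k) h 0 / fact k * z ^ k) sums h z" for z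
    using holomorphic_power_series[of h 0 "norm z + 1" z] fock_holomorphic[OF h]
    by (auto intro: holomorphic_on_subset)
  from fock_functional_sums[OF a L h this] zero show ?thesis by (simp add: sums_iff)
qed

text \<open>Expanding the kernel in powers of its argument shows that \<open>L K\<^sub>w\<close> is a power series in \<open>cnj w\<close>
  whose coefficients are, up to \<open>\<alpha>\<^sup>k / k!\<close>, the values of \<open>L\<close> on monomials.\<close>
lemma fock_functional_kernel:
  assumes a: "\<alpha> > 0" and L: "fock_functional \<alpha> C L"
  shows "(\<lambda>k. cnj w ^ k * (of_real (\<alpha> ^ k / fact k) * L (\<lambda>z. z ^ k))) sums L (fock_kernel \<alpha> w)"
proof -
  have "(\<lambda>k. (of_real \<alpha> * cnj w) ^ k / fact k * z ^ k) sums fock_kernel \<alpha> w z" for z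
    using exp_converges[of "of_real \<alpha> * z * cnj w"]
    unfolding fock_kernel_def by (simp add: power_mult_distrib scaleR_conv_of_real divide_inverse mult_ac)
  from fock_functional_sums[OF a L fock_kernel_in_fock[OF a] this]
  show ?thesis by (simp add: power_mult_distrib mult_ac)
qed

section \<open>Uniqueness from the antidiagonal\<close>

lemma entire_zero_on_reals:
  assumes F: "F holomorphic_on UNIV" and zero: "\<And>t::real. F (of_real t) = 0"
  shows "F z = 0"
proof (rule analytic_continuation[OF F, of "range of_real" 0])
  show "(0::complex) islimpt range of_real"
    unfolding islimpt_approachable
  proof (intro allI impI)
    fix e :: real assume "e > 0"
    then show "\<exists>x'\<in>range of_real. x' \<noteq> 0 \<and> dist x' (0::complex) < e"
      by (intro bexI[of _ "of_real (e / 2)"] conjI rangeI) (auto simp del: of_real_divide)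
  qed
qed (use zero in auto)

lemma power_series_zero_coeff:
  assumes sums: "\<And>s::complex. (\<lambda>n. a n * s ^ n) sums 0"
  shows "a n = 0"
proof (rule ccontr)
  assume n: "a n \<noteq> 0"
  have "a 0 = 0" using sums_unique2[OF sums[of 0] powser_sums_zero[of a]] by simp
  then have "n > 0" using n by (cases n) auto
  obtain s where s: "0 < s" "\<And>z. z \<in> cball (0::complex) s - {0} \<Longrightarrow> (0::complex) \<noteq> 0"
    by (rule powser_0_nonzero[of 1 0 a "\<lambda>_. 0" n]) (use sums n \<open>n > 0\<close> in auto)
  have "of_real s \<in> cball (0::complex) s - {0}" using s(1) by auto
  from s(2)[OF this] show False by simp
qed

text \<open>The series is the restriction of an entire function \<open>\<Phi>(s, z)\<close> to the totally real
  plane \<open>s = cnj w\<close>, \<open>z = - w\<close>. With \<open>w = x + \<i> y\<close> this is \<open>\<Phi>(x - \<i> y, - x - \<i> y)\<close> for real \<open>x\<close> and \<open>y\<close>.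
  The identity theorem frees \<open>x\<close> and then \<open>y\<close> to be complex, one variable at a time, and the resulting
  linear substitution is invertible.\<close>
lemma antidiagonal_series_zero:
  fixes g :: "nat \<Rightarrow> complex \<Rightarrow> complex"
  assumes g: "\<And>n. g n holomorphic_on UNIV"
    and bound: "\<And>n z R. norm z \<le> R \<Longrightarrow> norm (g n z) \<le> b R n"
    and summ: "\<And>R S::real. S \<ge> 0 \<Longrightarrow> summable (\<lambda>n. S ^ n * b R n)"
    and zero: "AE w in lebesgue. (\<lambda>n. cnj w ^ n * g n (- w)) sums 0"
  shows "g n z = 0"
proof -
  define \<Phi> where "\<Phi> s z = (\<Sum>n. s ^ n * g n z)" for s z
  have unif: "uniform_limit X (\<lambda>N x. \<Sum>n<N. p x ^ n * g n (q x)) (\<lambda>x. \<Phi> (p x) (q x)) sequentially"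
    if "\<And>x. x \<in> X \<Longrightarrow> norm (p x) \<le> S" "\<And>x. x \<in> X \<Longrightarrow> norm (q x) \<le> R" "S \<ge> 0" for X :: "complex set" and p q S R
    unfolding \<Phi>_def
  proof (rule Weierstrass_m_test)
    show "summable (\<lambda>n. S ^ n * b R n)" by (rule summ[OF that(3)])
    show "norm (p x ^ n * g n (q x)) \<le> S ^ n * b R n" if "x \<in> X" for n x
      unfolding norm_mult norm_power
      using \<open>\<And>x. x \<in> X \<Longrightarrow> norm (p x) \<le> S\<close>[OF that] \<open>\<And>x. x \<in> X \<Longrightarrow> norm (q x) \<le> R\<close>[OF that] \<open>S \<ge> 0\<close>
      by (intro mult_mono power_mono bound) auto
  qed
  have unif_ball: "uniform_limit (cball x 1) (\<lambda>N x. \<Sum>n<N. p x ^ n * g n (q x)) (\<lambda>x. \<Phi> (p x) (q x)) sequentially"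
    if p: "continuous_on UNIV p" and q: "continuous_on UNIV q" for p q and x :: complex
  proof -
    obtain S where "S \<ge> 0" "\<And>y. y \<in> cball x 1 \<Longrightarrow> norm (p y) \<le> S"
      using continuous_on_compact_bound[OF compact_cball continuous_on_subset[OF p subset_UNIV]] by metis
    moreover obtain R where "R \<ge> 0" "\<And>y. y \<in> cball x 1 \<Longrightarrow> norm (q y) \<le> R"
      using continuous_on_compact_bound[OF compact_cball continuous_on_subset[OF q subset_UNIV]] by metis
    ultimately show ?thesis by (intro unif)
  qed
  have hol: "(\<lambda>x. \<Phi> (p x) (q x)) holomorphic_on UNIV"
    if p: "p holomorphic_on UNIV" and q: "q holomorphic_on UNIV" for p q
  proof (rule holomorphic_uniform_sequence)
    show "(\<lambda>x. \<Sum>n<N. p x ^ n * g n (q x)) holomorphic_on UNIV" for N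
    proof (intro holomorphic_intros p)
      show "(\<lambda>x. g n (q x)) holomorphic_on UNIV" for n
        using holomorphic_on_compose_gen[OF q g[of n]] by (simp add: o_def)
    qed
    show "\<exists>d. 0 < d \<and> cball x d \<subseteq> UNIV \<and> uniform_limit (cball x d) (\<lambda>N x. \<Sum>n<N. p x ^ n * g n (q x)) (\<lambda>x. \<Phi> (p x) (q x)) sequentially" for x
      using unif_ball[OF holomorphic_on_imp_continuous_on[OF p] holomorphic_on_imp_continuous_on[OF q]]
      by (intro exI[of _ 1]) auto
  qed simp
  have cont: "continuous_on UNIV (\<lambda>w. \<Phi> (cnj w) (- w))"
  proof -
    have "isCont (\<lambda>w. \<Phi> (cnj w) (- w)) x" for x
    proof -
      have "continuous_on (cball x 1) (\<lambda>w. \<Phi> (cnj w) (- w))"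
      proof (rule uniform_limit_theorem[OF _ unif_ball])
        have "continuous_on (cball x 1) (\<lambda>w. g n (- w))" for n
          by (rule continuous_on_compose2[OF holomorphic_on_imp_continuous_on[OF g[of n]]])
             (auto intro: continuous_intros)
        then show "\<forall>\<^sub>F N in sequentially. continuous_on (cball x 1) (\<lambda>w. \<Sum>n<N. cnj w ^ n * g n (- w))"
          by (intro always_eventually allI continuous_intros)
      qed (auto intro: continuous_intros)
      then show ?thesis by (rule continuous_on_interior) simp
    qed
    then show ?thesis by (simp add: continuous_on_eq_continuous_at)
  qed
  \<comment> \<open>continuity turns the almost everywhere hypothesis into an identity at every point\<close>
  have diag: "\<Phi> (cnj w) (- w) = 0" for w
  proof -
    have "closed {w. \<Phi> (cnj w) (- w) = 0}" by (intro closed_Collect_eq cont continuous_on_const)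
    moreover have "AE w in lebesgue. w \<in> {w. \<Phi> (cnj w) (- w) = 0}"
      using zero by eventually_elim (simp add: \<Phi>_def sums_iff)
    ultimately have "w \<in> {w. \<Phi> (cnj w) (- w) = 0}" by (rule mem_closed_if_AE_lebesgue)
    then show ?thesis by simp
  qed
  have real_y: "\<Phi> (x - \<i> * of_real y) (- x - \<i> * of_real y) = 0" for x and y :: real
  proof (rule entire_zero_on_reals[of "\<lambda>x. \<Phi> (x - \<i> * of_real y) (- x - \<i> * of_real y)"])
    show "(\<lambda>x. \<Phi> (x - \<i> * of_real y) (- x - \<i> * of_real y)) holomorphic_on UNIV"
      by (intro hol holomorphic_intros)
    show "\<Phi> (of_real t - \<i> * of_real y) (- of_real t - \<i> * of_real y) = 0" for t :: real
      using diag[of "of_real t + \<i> * of_real y"] by simp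
  qed
  have all_y: "\<Phi> (x - \<i> * y) (- x - \<i> * y) = 0" for x y
  proof (rule entire_zero_on_reals[of "\<lambda>y. \<Phi> (x - \<i> * y) (- x - \<i> * y)"])
    show "(\<lambda>y. \<Phi> (x - \<i> * y) (- x - \<i> * y)) holomorphic_on UNIV"
      by (intro hol holomorphic_intros)
  qed (rule real_y)
  have \<Phi>0: "\<Phi> s z = 0" for s z
  proof -
    \<comment> \<open>solve \<open>x - \<i> y = s\<close> and \<open>- x - \<i> y = z\<close> for \<open>x\<close> and \<open>y\<close>\<close>
    have "(s - z) / 2 - \<i> * (\<i> * (s + z) / 2) = s" "- ((s - z) / 2) - \<i> * (\<i> * (s + z) / 2) = z"
      by (simp_all add: field_simps)
    then show ?thesis using all_y[of "(s - z) / 2" "\<i> * (s + z) / 2"] by simp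
  qed
  have "(\<lambda>n. g n z * s ^ n) sums 0" for s
  proof -
    have "summable (\<lambda>n. s ^ n * g n z)"
    proof (rule summable_comparison_test'[OF summ[of "norm s" "norm z"], of 0])
      show "norm (s ^ n * g n z) \<le> norm s ^ n * b (norm z) n" for n
        unfolding norm_mult norm_power by (intro mult_left_mono bound) auto
    qed simp
    then have "(\<lambda>n. s ^ n * g n z) sums \<Phi> s z" unfolding \<Phi>_def by (rule summable_sums)
    then show ?thesis by (simp add: \<Phi>0 mult.commute)
  qed
  then show ?thesis by (rule power_series_zero_coeff[of "\<lambda>n. g n z"])
qed

text \<open>By the inequality \<open>2 p q \<le> p\<^sup>2 + q\<^sup>2\<close> with \<open>q = 2\<^sup>-\<^sup>n\<close>, the square root is traded for an
  exponential series and a geometric one.\<close>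
lemma summable_power_sqrt_fact:
  assumes "c \<ge> 0" "S \<ge> 0"
  shows "summable (\<lambda>n. S ^ n * sqrt (c ^ n / fact n :: real))"
proof (rule summable_comparison_test'[of "\<lambda>n. (4 * S\<^sup>2 * c) ^ n / fact n + (1/4) ^ n" 0])
  show "summable (\<lambda>n. (4 * S\<^sup>2 * c) ^ n / fact n + (1/4) ^ n)"
  proof (intro summable_add summable_geometric)
    have "x ^ n / fact n = inverse (fact n) * x ^ n" for x :: real and n
      by (simp add: divide_inverse)
    then show "summable (\<lambda>n. (4 * S\<^sup>2 * c) ^ n / fact n)"
      using summable_exp[of "4 * S\<^sup>2 * c"] by (simp only:)
  qed simp
  fix n
  define p q where "p = (2 * S) ^ n * sqrt (c ^ n / fact n)" and "q = (1/2 :: real) ^ n"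
  have "p\<^sup>2 = ((2 * S) ^ n)\<^sup>2 * (c ^ n / fact n)"
    using assms by (simp add: p_def power_mult_distrib)
  also have "\<dots> = (4 * S\<^sup>2 * c) ^ n / fact n"
    by (simp add: power_mult_distrib flip: power_mult) (simp add: power_mult mult.commute[of n 2])
  finally have p: "p\<^sup>2 = (4 * S\<^sup>2 * c) ^ n / fact n" .
  have q: "q\<^sup>2 = (1/4) ^ n" by (simp add: q_def power_divide flip: power_mult) (simp add: power_mult mult.commute[of n 2])
  have "2 * (p * q) \<le> p\<^sup>2 + q\<^sup>2"
    using zero_le_power2[of "p - q"] by (simp add: power2_eq_square algebra_simps)
  moreover have "p * q \<ge> 0" using assms by (simp add: p_def q_def)
  moreover have "S ^ n * sqrt (c ^ n / fact n) = p * q"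
    by (simp add: p_def q_def power_mult_distrib field_simps)
  ultimately show "norm (S ^ n * sqrt (c ^ n / fact n)) \<le> (4 * S\<^sup>2 * c) ^ n / fact n + (1/4) ^ n"
    unfolding p[symmetric] q[symmetric] by simp
qed

text \<open>On kernels the family is the power series \<open>\<Sum>\<^sub>n (cnj w)\<^sup>n (\<alpha>\<^sup>n / n!) M\<^sub>z (z\<^sup>n)\<close> with entire
  coefficients; the bound on the norms of the monomials makes it converge locally uniformly. Vanishing on the
  antidiagonal therefore kills \<open>M\<^sub>z\<close> on monomials, and a bounded functional is determined by these.\<close>
lemma fock_family_zero:
  assumes a: "\<alpha> > 0"
    and M: "\<And>R z. norm z \<le> R \<Longrightarrow> fock_functional \<alpha> (C R) (M z)"
    and hol: "\<And>h. h \<in> fock_space \<alpha> \<Longrightarrow> (\<lambda>z. M z h) holomorphic_on UNIV"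
    and zero: "AE w in lebesgue. M (- w) (fock_kernel \<alpha> w) = 0"
    and h: "h \<in> fock_space \<alpha>"
  shows "M z h = 0"
proof -
  define g where "g n z = of_real (\<alpha> ^ n / fact n) * M z (\<lambda>z. z ^ n)" for n z
  define b where "b R n = \<bar>C R\<bar> * (sqrt 2 * sqrt ((2 * \<alpha>) ^ n / fact n))" for R n
  have "g n z = 0" for n z
  proof (rule antidiagonal_series_zero[of g b])
    show "g n holomorphic_on UNIV" for n
      unfolding g_def by (intro holomorphic_intros hol power_in_fock a)
    show "norm (g n z) \<le> b R n" if "norm z \<le> R" for n z R
    proof -
      have "norm (M z (\<lambda>z. z ^ n)) \<le> C R * fock_norm \<alpha> (\<lambda>z. z ^ n)"
        using M[OF that] power_in_fock[OF a] unfolding fock_functional_def by blast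
      also have "\<dots> \<le> \<bar>C R\<bar> * fock_norm \<alpha> (\<lambda>z. z ^ n)" by (intro mult_right_mono fock_norm_nonneg) simp
      finally have "(\<alpha> ^ n / fact n) * norm (M z (\<lambda>z. z ^ n)) \<le> (\<alpha> ^ n / fact n) * (\<bar>C R\<bar> * fock_norm \<alpha> (\<lambda>z. z ^ n))"
        using a by (intro mult_left_mono) auto
      also have "\<dots> = \<bar>C R\<bar> * (\<alpha> ^ n / fact n * fock_norm \<alpha> (\<lambda>z. z ^ n))" by simp
      also have "\<dots> \<le> b R n"
        unfolding b_def by (intro mult_left_mono fock_norm_power_le a) simp
      finally show ?thesis using a by (simp add: g_def norm_mult norm_divide norm_power)
    qed
    show "summable (\<lambda>n. S ^ n * b R n)" if "S \<ge> 0" for R S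
      using summable_mult[OF summable_power_sqrt_fact[of "2 * \<alpha>" S], of "\<bar>C R\<bar> * sqrt 2"] a that
      by (simp add: b_def mult_ac)
    show "AE w in lebesgue. (\<lambda>n. cnj w ^ n * g n (- w)) sums 0"
      using zero
    proof eventually_elim
      case (elim w)
      have "fock_functional \<alpha> (C (norm w)) (M (- w))" by (rule M) simp
      from fock_functional_kernel[OF a this, of w] elim show ?case unfolding g_def by simp
    qed
  qed
  then have "M z (\<lambda>z. z ^ n) = 0" for n using a by (simp add: g_def)
  then show ?thesis by (intro fock_functional_zero[OF a M[OF order_refl] _ h])
qed

text \<open>By Cauchy's inequality on discs of radius 1, the derivatives in \<open>z\<close> form a family of the same kind.\<close>
lemma fock_family_deriv:
  assumes a: "\<alpha> > 0"
    and M: "\<And>R z. norm z \<le> R \<Longrightarrow> fock_functional \<alpha> (C R) (M z)"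
    and hol: "\<And>h. h \<in> fock_space \<alpha> \<Longrightarrow> (\<lambda>z. M z h) holomorphic_on UNIV"
    and z: "norm z \<le> R"
  shows "fock_functional \<alpha> (C (R + 1)) (\<lambda>h. deriv (\<lambda>z. M z h) z)"
  unfolding fock_functional_def
proof (intro conjI ballI allI)
  have diff: "(\<lambda>z. M z h) field_differentiable at z" if "h \<in> fock_space \<alpha>" for h z
    using hol[OF that] by (rule holomorphic_on_imp_differentiable_at) auto
  fix h assume h: "h \<in> fock_space \<alpha>"
  have "M z (\<lambda>x. h x + k x) = M z h + M z k" if "k \<in> fock_space \<alpha>" for k z
    using M[of z "norm z"] h that unfolding fock_functional_def by blast
  then show "deriv (\<lambda>z. M z (\<lambda>x. h x + k x)) z = deriv (\<lambda>z. M z h) z + deriv (\<lambda>z. M z k) z" if "k \<in> fock_space \<alpha>" for k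
    using diff h that by simp
  have "M z (\<lambda>x. c * h x) = c * M z h" for c z
    using M[of z "norm z"] h unfolding fock_functional_def by blast
  then show "deriv (\<lambda>z. M z (\<lambda>x. c * h x)) z = c * deriv (\<lambda>z. M z h) z" for c
    using diff[OF h] by simp
  have "norm ((deriv ^^ 1) (\<lambda>z. M z h) z) \<le> fact 1 * (C (R + 1) * fock_norm \<alpha> h) / 1 ^ 1"
  proof (rule Cauchy_inequality)
    show "(\<lambda>z. M z h) holomorphic_on ball z 1" using hol[OF h] by (rule holomorphic_on_subset) simp
    show "continuous_on (cball z 1) (\<lambda>z. M z h)"
      using hol[OF h] by (intro holomorphic_on_imp_continuous_on) (auto intro: holomorphic_on_subset)
    fix x assume "norm (z - x) = 1"
    then have "norm x \<le> R + 1" using z norm_triangle_ineq2[of x z] by (simp add: norm_minus_commute)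
    then show "norm (M x h) \<le> C (R + 1) * fock_norm \<alpha> h"
      using M[of x "R + 1"] h unfolding fock_functional_def by blast
  qed simp
  then show "norm (deriv (\<lambda>z. M z h) z) \<le> C (R + 1) * fock_norm \<alpha> h" by simp
qed

section \<open>Toeplitz operators\<close>

lemma toeplitz_eq:
  assumes a: "\<alpha> > 0"
  shows "toeplitz \<alpha> f h z = (\<integral>u. (f u * (h u * fock_weight \<alpha> u)) * cnj (fock_kernel \<alpha> z u * fock_weight \<alpha> u) \<partial>lebesgue)"
proof -
  have "(f u * (h u * fock_weight \<alpha> u)) * cnj (fock_kernel \<alpha> z u * fock_weight \<alpha> u)
     = of_real (\<alpha> / pi) * (f u * h u * exp (of_real \<alpha> * z * cnj u - of_real (\<alpha> * (norm u)\<^sup>2)))" for u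
  proof -
    have "(f u * (h u * fock_weight \<alpha> u)) * cnj (fock_kernel \<alpha> z u * fock_weight \<alpha> u)
      = f u * h u * (fock_weight \<alpha> u * cnj (fock_kernel \<alpha> z u * fock_weight \<alpha> u))" by (simp only: mult.assoc)
    then show ?thesis unfolding fock_weight_kernel[OF a] by (simp only: mult_ac)
  qed
  then show ?thesis unfolding toeplitz_def by (simp only: integral_mult_right_zero)
qed

lemma toeplitz_integrable:
  assumes a: "\<alpha> > 0" and f: "f \<in> Linf lebesgue" and h: "h \<in> fock_space \<alpha>"
  shows "integrable lebesgue (\<lambda>u. (f u * (h u * fock_weight \<alpha> u)) * cnj (fock_kernel \<alpha> z u * fock_weight \<alpha> u))"
  by (intro L2_mult_cnj_integrable[of "\<lambda>u. f u * (h u * fock_weight \<alpha> u)"] Linf_mult_L2 f fock_weighted_L2 a h fock_kernel_in_fock)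

lemma toeplitz_add:
  assumes "\<alpha> > 0" "f \<in> Linf lebesgue" "h \<in> fock_space \<alpha>" "k \<in> fock_space \<alpha>"
  shows "toeplitz \<alpha> f (\<lambda>u. h u + k u) z = toeplitz \<alpha> f h z + toeplitz \<alpha> f k z"
  unfolding toeplitz_eq[OF assms(1)] distrib_right distrib_left
  using toeplitz_integrable[OF assms(1,2)] assms(3,4) by (intro Bochner_Integration.integral_add)

lemma toeplitz_cmult: "toeplitz \<alpha> f (\<lambda>u. c * h u) z = c * toeplitz \<alpha> f h z"
  unfolding toeplitz_def by (simp add: mult.left_commute[of _ c] mult.assoc)

lemma toeplitz_cong_AE:
  assumes "AE u in lebesgue. f u = g u" "f \<in> borel_measurable lebesgue" "g \<in> borel_measurable lebesgue" "h \<in> fock_space \<alpha>" and a: "\<alpha> > 0"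
  shows "toeplitz \<alpha> f h z = toeplitz \<alpha> g h z"
proof -
  have [measurable]: "(\<lambda>u. h u * fock_weight \<alpha> u) \<in> borel_measurable lebesgue"
    "(\<lambda>u. fock_kernel \<alpha> z u * fock_weight \<alpha> u) \<in> borel_measurable lebesgue"
    using fock_weighted_L2[OF a assms(4)] fock_weighted_L2[OF a fock_kernel_in_fock[OF a]] by (auto intro: L2_measurable)
  show ?thesis
    unfolding toeplitz_eq[OF a]
  proof (rule integral_cong_AE)
    show "AE u in lebesgue. f u * (h u * fock_weight \<alpha> u) * cnj (fock_kernel \<alpha> z u * fock_weight \<alpha> u)
        = g u * (h u * fock_weight \<alpha> u) * cnj (fock_kernel \<alpha> z u * fock_weight \<alpha> u)"
      using assms(1) by eventually_elim simp
  qed (use assms(2,3) in measurable)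
qed

lemma is_toeplitz_cong_AE:
  assumes a: "\<alpha> > 0" and T: "is_toeplitz \<alpha> A f" and f: "f \<in> Linf lebesgue" "g \<in> Linf lebesgue"
    and ae: "AE u in lebesgue. g u = f u"
  shows "is_toeplitz \<alpha> A g"
proof -
  have m: "f \<in> borel_measurable lebesgue" "g \<in> borel_measurable lebesgue" using f by (auto simp: Linf_def)
  have "toeplitz \<alpha> g h = toeplitz \<alpha> f h" if "h \<in> fock_space \<alpha>" for h
    by (rule ext) (rule toeplitz_cong_AE[OF ae m(2,1) that a])
  then show ?thesis using T by (simp add: is_toeplitz_def)
qed

text \<open>The integral is an inner product of \<open>f h\<close> with the kernel at \<open>z\<close>.\<close>
lemma toeplitz_bound:
  assumes a: "\<alpha> > 0" and B: "B \<ge> 0" "AE u in lebesgue. norm (f u) \<le> B" and f: "f \<in> Linf lebesgue" and h: "h \<in> fock_space \<alpha>"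
  shows "norm (toeplitz \<alpha> f h z) \<le> B * fock_norm \<alpha> h * exp (\<alpha> / 2 * (norm z)\<^sup>2)"
  unfolding toeplitz_eq[OF a]
proof (rule L2_Cauchy_Schwarz_le)
  show "(\<lambda>u. f u * (h u * fock_weight \<alpha> u)) \<in> L2 lebesgue" by (intro Linf_mult_L2 f fock_weighted_L2 a h)
  show "(\<lambda>u. fock_kernel \<alpha> z u * fock_weight \<alpha> u) \<in> L2 lebesgue" by (intro fock_weighted_L2 a fock_kernel_in_fock)
  show "L2sq lebesgue (\<lambda>u. f u * (h u * fock_weight \<alpha> u)) \<le> ennreal ((B * fock_norm \<alpha> h)\<^sup>2)"
    using L2sq_Linf_mult_le[OF B, of "\<lambda>u. h u * fock_weight \<alpha> u"] L2_measurable[OF fock_weighted_L2[OF a h]]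
    by (simp add: fock_norm_sq[OF a h, symmetric] power_mult_distrib flip: ennreal_mult')
  show "L2sq lebesgue (\<lambda>u. fock_kernel \<alpha> z u * fock_weight \<alpha> u) \<le> ennreal ((exp (\<alpha> / 2 * (norm z)\<^sup>2))\<^sup>2)"
    using fock_norm_sq[OF a fock_kernel_in_fock[OF a, of z]] by (simp add: fock_norm_kernel[OF a])
qed (use B fock_norm_nonneg in auto)

text \<open>By the reproducing property, the Toeplitz operator with symbol 1 is the identity.\<close>
lemma fock_eval_bound:
  assumes a: "\<alpha> > 0" and h: "h \<in> fock_space \<alpha>"
  shows "norm (h z) \<le> fock_norm \<alpha> h * exp (\<alpha> / 2 * (norm z)\<^sup>2)"
proof -
  have "h \<in> borel_measurable lebesgue" by (intro borel_measurable_lebesgueI fock_measurable[OF h])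
  then have "toeplitz \<alpha> (\<lambda>_. 1) h z = h z"
    using fock_reproducing[OF a h, of z] fock_inner_kernel_eq[OF a, of h z] by (simp add: toeplitz_def)
  moreover have "(\<lambda>_. 1) \<in> Linf lebesgue" by (auto simp: Linf_def)
  ultimately show ?thesis using toeplitz_bound[OF a _ _ _ h, of 1 "\<lambda>_. 1" z] by simp
qed

lemma norm_exp_minus_one_le: "norm (exp z - 1 :: complex) \<le> norm z * exp (norm z)"
  using Taylor_exp_field[of z 0] by (simp add: mult.commute)

text \<open>Differentiation under the integral sign: the difference quotients are dominated
  through \<open>|e\<^sup>x - 1| \<le> |x| e\<^bsup>|x|\<^esup>\<close>, at the price of a larger rate \<open>R\<close>.\<close>
lemma exp_integral_has_derivative:
  fixes G :: "complex \<Rightarrow> complex"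
  assumes a: "\<alpha> > 0" and [measurable]: "G \<in> borel_measurable lebesgue"
    and int: "\<And>R. integrable lebesgue (\<lambda>u. norm (G u) * exp (R * norm u))"
  shows "((\<lambda>z. \<integral>u. G u * exp (of_real \<alpha> * z * cnj u) \<partial>lebesgue) has_field_derivative
    (\<integral>u. (of_real \<alpha> * cnj u * G u) * exp (of_real \<alpha> * z * cnj u) \<partial>lebesgue)) (at z)"
  unfolding has_field_derivative_iff tendsto_at_iff_sequentially
proof (intro allI impI)
  fix X assume X: "\<forall>i. X i \<in> UNIV - {z}" "X \<longlonglongrightarrow> z"
  define e where "e y u = exp (of_real \<alpha> * y * cnj u)" for y u
  have em [measurable]: "e y \<in> borel_measurable lebesgue" for y
    unfolding e_def by (rule borel_measurable_lebesgueI) measurable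
  have cm [measurable]: "cnj \<in> borel_measurable lebesgue" by (rule borel_measurable_lebesgueI) simp
  have e_le: "norm (e y u) \<le> exp (\<alpha> * norm y * norm u)" for y u
    using norm_exp[of "of_real \<alpha> * y * cnj u"] a by (simp add: e_def norm_mult)
  have Ge: "integrable lebesgue (\<lambda>u. G u * e y u)" for y
  proof (rule Bochner_Integration.integrable_bound[OF int[of "\<alpha> * norm y"]])
    show "AE u in lebesgue. norm (G u * e y u) \<le> norm (norm (G u) * exp (\<alpha> * norm y * norm u))"
      using e_le by (intro AE_I2) (simp add: norm_mult mult_left_mono)
  qed measurable
  have Xz: "(\<lambda>i. X i - z) \<longlonglongrightarrow> 0" using X(2) by (simp add: LIM_zero)
  then have "Bseq (\<lambda>i. X i - z)" by (intro convergent_imp_Bseq convergentI)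
  then obtain K where K: "K > 0" "\<And>i. norm (X i - z) \<le> K"
    by (rule BseqE) (simp add: that)
  define Q where "Q i u = G u * (e (X i) u - e z u) / (X i - z)" for i u
  have "(\<lambda>i. \<integral>u. Q i u \<partial>lebesgue) \<longlonglongrightarrow> (\<integral>u. (of_real \<alpha> * cnj u * G u) * e z u \<partial>lebesgue)"
  proof (rule integral_dominated_convergence)
    show "AE u in lebesgue. (\<lambda>i. Q i u) \<longlonglongrightarrow> of_real \<alpha> * cnj u * G u * e z u"
    proof (rule AE_I2)
      fix u
      have "((\<lambda>y. e y u) has_field_derivative (of_real \<alpha> * cnj u * e z u)) (at z)"
        unfolding e_def by (auto intro!: derivative_eq_intros)
      then have "((\<lambda>y. (e y u - e z u) / (y - z)) \<circ> X) \<longlonglongrightarrow> of_real \<alpha> * cnj u * e z u"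
        using X unfolding has_field_derivative_iff tendsto_at_iff_sequentially by blast
      then have "(\<lambda>i. G u * ((e (X i) u - e z u) / (X i - z))) \<longlonglongrightarrow> G u * (of_real \<alpha> * cnj u * e z u)"
        unfolding o_def by (intro tendsto_mult tendsto_const)
      then show "(\<lambda>i. Q i u) \<longlonglongrightarrow> of_real \<alpha> * cnj u * G u * e z u"
        by (simp add: Q_def mult_ac)
    qed
    \<comment> \<open>the three terms absorb the exponential at \<open>z\<close>, the factor \<open>\<alpha>|u|\<close>, and the exponential of
      the increment\<close>
    define R where "R = \<alpha> * norm z + \<alpha> + \<alpha> * K"
    show "integrable lebesgue (\<lambda>u. norm (G u) * exp (R * norm u))" by (rule int)
    show "AE u in lebesgue. norm (Q i u) \<le> norm (G u) * exp (R * norm u)" for i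
    proof (rule AE_I2)
      fix u
      define x where "x = of_real \<alpha> * (X i - z) * cnj u"
      have nz: "norm (X i - z) > 0" using X(1) by simp
      have nx: "norm x = \<alpha> * norm (X i - z) * norm u" using a by (simp add: x_def norm_mult)
      have "e (X i) u - e z u = e z u * (exp x - 1)"
        by (simp add: e_def x_def algebra_simps flip: exp_add)
      then have "norm (e (X i) u - e z u) = norm (e z u) * norm (exp x - 1)" by (simp add: norm_mult)
      also have "\<dots> \<le> exp (\<alpha> * norm z * norm u) * (norm x * exp (norm x))"
        by (intro mult_mono e_le norm_exp_minus_one_le) auto
      also have "\<dots> \<le> exp (\<alpha> * norm z * norm u) * ((exp (\<alpha> * norm u) * norm (X i - z)) * exp (\<alpha> * K * norm u))"
      proof (intro mult_left_mono mult_mono)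
        have "\<alpha> * norm u \<le> exp (\<alpha> * norm u)" using exp_ge_add_one_self[of "\<alpha> * norm u"] by linarith
        then show "norm x \<le> exp (\<alpha> * norm u) * norm (X i - z)"
          unfolding nx using mult_right_mono[of "\<alpha> * norm u" "exp (\<alpha> * norm u)" "norm (X i - z)"] by (simp add: mult_ac)
        have "\<alpha> * norm (X i - z) * norm u \<le> \<alpha> * K * norm u"
          using K a by (intro mult_right_mono mult_left_mono) auto
        then show "exp (norm x) \<le> exp (\<alpha> * K * norm u)" unfolding nx by simp
      qed auto
      also have "\<dots> = exp (R * norm u) * norm (X i - z)"
      proof -
        have "exp (R * norm u) = exp (\<alpha> * norm z * norm u) * exp (\<alpha> * norm u) * exp (\<alpha> * K * norm u)"
          by (simp only: R_def distrib_right exp_add)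
        then show ?thesis by (simp only: mult_ac)
      qed
      finally have "norm (e (X i) u - e z u) / norm (X i - z) \<le> exp (R * norm u)"
        using nz by (simp add: divide_le_eq)
      then have "norm (G u) * (norm (e (X i) u - e z u) / norm (X i - z)) \<le> norm (G u) * exp (R * norm u)"
        by (rule mult_left_mono) simp
      then show "norm (Q i u) \<le> norm (G u) * exp (R * norm u)"
        by (simp add: Q_def norm_mult norm_divide)
    qed
    show "(\<lambda>u. of_real \<alpha> * cnj u * G u * e z u) \<in> borel_measurable lebesgue" by measurable
    show "Q i \<in> borel_measurable lebesgue" for i unfolding Q_def by measurable
  qed
  moreover have "(\<integral>u. Q i u \<partial>lebesgue) = ((\<integral>u. G u * e (X i) u \<partial>lebesgue) - (\<integral>u. G u * e z u \<partial>lebesgue)) / (X i - z)" for i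
    unfolding Q_def using Ge by (simp add: right_diff_distrib)
  ultimately show "((\<lambda>y. ((\<integral>u. G u * exp (of_real \<alpha> * y * cnj u) \<partial>lebesgue) - (\<integral>u. G u * exp (of_real \<alpha> * z * cnj u) \<partial>lebesgue)) / (y - z)) \<circ> X)
      \<longlonglongrightarrow> (\<integral>u. (of_real \<alpha> * cnj u * G u) * exp (of_real \<alpha> * z * cnj u) \<partial>lebesgue)"
    unfolding e_def o_def by simp
qed

lemma toeplitz_has_derivative:
  assumes a: "\<alpha> > 0" and f: "f \<in> Linf lebesgue" and h: "h \<in> fock_space \<alpha>"
  shows "(toeplitz \<alpha> f h has_field_derivative
    (\<integral>u. (of_real \<alpha> * cnj u * (f u * (h u * fock_weight \<alpha> u) * cnj (fock_weight \<alpha> u))) * exp (of_real \<alpha> * z * cnj u) \<partial>lebesgue)) (at z)"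
proof -
  define G where "G u = f u * (h u * fock_weight \<alpha> u) * cnj (fock_weight \<alpha> u)" for u
  have fh: "(\<lambda>u. f u * (h u * fock_weight \<alpha> u)) \<in> L2 lebesgue" by (intro Linf_mult_L2 f fock_weighted_L2 a h)
  have wm [measurable]: "fock_weight \<alpha> \<in> borel_measurable lebesgue" by (rule borel_measurable_lebesgueI) simp
  have [measurable]: "(\<lambda>u. f u * (h u * fock_weight \<alpha> u)) \<in> borel_measurable lebesgue" using fh by (rule L2_measurable)
  have Gm: "G \<in> borel_measurable lebesgue" unfolding G_def by measurable
  have int: "integrable lebesgue (\<lambda>u. norm (G u) * exp (R * norm u))" for R
  proof -
    have "(\<lambda>u. of_real (exp (R * norm u)) * fock_weight \<alpha> u) \<in> L2 lebesgue"
      unfolding L2_def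
    proof (intro CollectI conjI)
      show "(\<lambda>u. of_real (exp (R * norm u)) * fock_weight \<alpha> u) \<in> borel_measurable lebesgue" by measurable
      have eq: "(norm (of_real (exp (R * norm u)) * fock_weight \<alpha> u))\<^sup>2 = \<alpha> / pi * exp (2 * R * norm u - \<alpha> * (norm u)\<^sup>2)" for u
        unfolding norm_mult power_mult_distrib fock_weight_sq[OF a]
        by (simp add: exp_diff exp_minus field_simps flip: exp_double)
      have "integrable lborel (\<lambda>u::complex. \<alpha> / pi * exp (2 * R * norm u - \<alpha> * (norm u)\<^sup>2))"
        by (intro integrable_mult_right gaussian_exp_integrable a)
      then show "integrable lebesgue (\<lambda>u. (norm (of_real (exp (R * norm u)) * fock_weight \<alpha> u))\<^sup>2)"
        unfolding eq by (subst integrable_completion) auto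
    qed
    from integrable_norm[OF L2_mult_cnj_integrable[OF fh this]]
    show ?thesis by (simp add: G_def norm_mult mult_ac)
  qed
  have "toeplitz \<alpha> f h = (\<lambda>z. \<integral>u. G u * exp (of_real \<alpha> * z * cnj u) \<partial>lebesgue)"
  proof
    fix z
    have "cnj (fock_kernel \<alpha> z u) = exp (of_real \<alpha> * z * cnj u)" for u
      by (simp add: fock_kernel_def exp_cnj mult_ac)
    then show "toeplitz \<alpha> f h z = (\<integral>u. G u * exp (of_real \<alpha> * z * cnj u) \<partial>lebesgue)"
      unfolding toeplitz_eq[OF a] G_def by (simp add: mult_ac)
  qed
  then show ?thesis
    using exp_integral_has_derivative[OF a Gm int, of z] unfolding G_def by (simp only:)
qed

lemma toeplitz_holomorphic:
  assumes "\<alpha> > 0" "f \<in> Linf lebesgue" "h \<in> fock_space \<alpha>"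
  shows "toeplitz \<alpha> f h holomorphic_on UNIV"
  using toeplitz_has_derivative[OF assms] by (auto simp: holomorphic_on_open)

text \<open>The function whose symplectic Fourier transform is \<^const>\<open>H0\<close> when \<open>f\<close> is the symbol.\<close>
definition gauss_symbol :: "real \<Rightarrow> (complex \<Rightarrow> complex) \<Rightarrow> complex \<Rightarrow> complex" where
  "gauss_symbol \<alpha> f u = of_real (\<alpha> / pi * exp (- \<alpha> * (norm u)\<^sup>2)) * f u"

lemma gauss_symbol_measurable [measurable]:
  assumes [measurable]: "f \<in> borel_measurable lebesgue"
  shows "gauss_symbol \<alpha> f \<in> borel_measurable lebesgue"
  unfolding gauss_symbol_def by measurable

text \<open>The Gaussian dominates any bounded symbol, and also the factor \<open>cnj u\<close>.\<close>
lemma gauss_symbol_L1_L2: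
  assumes a: "\<alpha> > 0" and f: "f \<in> Linf lebesgue"
  shows "integrable lebesgue (gauss_symbol \<alpha> f)" "gauss_symbol \<alpha> f \<in> L2 lebesgue"
    and "integrable lebesgue (\<lambda>u. of_real \<alpha> * cnj u * gauss_symbol \<alpha> f u)"
        "(\<lambda>u. of_real \<alpha> * cnj u * gauss_symbol \<alpha> f u) \<in> L2 lebesgue"
proof -
  obtain B where B: "B \<ge> 0" "AE u in lebesgue. norm (f u) \<le> B" and [measurable]: "f \<in> borel_measurable lebesgue"
    using f by (rule LinfE)
  have [measurable]: "cnj \<in> borel_measurable lebesgue" by (rule borel_measurable_lebesgueI) simp
  have b0: "AE u in lebesgue. norm (gauss_symbol \<alpha> f u) \<le> \<alpha> / pi * B * exp (0 * norm u - \<alpha> * (norm u)\<^sup>2)"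
    using B(2)
  proof eventually_elim
    case (elim u)
    then have "(\<alpha> / pi * exp (- \<alpha> * (norm u)\<^sup>2)) * norm (f u) \<le> (\<alpha> / pi * exp (- \<alpha> * (norm u)\<^sup>2)) * B"
      using a by (intro mult_left_mono) auto
    moreover have "norm (gauss_symbol \<alpha> f u) = (\<alpha> / pi * exp (- \<alpha> * (norm u)\<^sup>2)) * norm (f u)"
      unfolding gauss_symbol_def norm_mult norm_of_real using a by simp
    ultimately show ?case by (simp add: mult_ac)
  qed
  show "integrable lebesgue (gauss_symbol \<alpha> f)" "gauss_symbol \<alpha> f \<in> L2 lebesgue"
    by (rule gaussian_bound_L1_L2[OF a _ b0]; measurable)+
  have b1: "AE u in lebesgue. norm (of_real \<alpha> * cnj u * gauss_symbol \<alpha> f u) \<le> \<alpha> * (\<alpha> / pi * B) * exp (1 * norm u - \<alpha> * (norm u)\<^sup>2)"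
    using b0
  proof eventually_elim
    case (elim u)
    have "norm u \<le> exp (norm u)" using exp_ge_add_one_self[of "norm u"] by linarith
    then have "(\<alpha> * norm u) * norm (gauss_symbol \<alpha> f u) \<le> (\<alpha> * exp (norm u)) * (\<alpha> / pi * B * exp (0 * norm u - \<alpha> * (norm u)\<^sup>2))"
      using a by (intro mult_mono elim mult_left_mono) auto
    also have "\<dots> = \<alpha> * (\<alpha> / pi * B) * exp (1 * norm u - \<alpha> * (norm u)\<^sup>2)"
      by (simp add: exp_diff exp_minus field_simps)
    finally show ?case using a by (simp add: norm_mult)
  qed
  show "integrable lebesgue (\<lambda>u. of_real \<alpha> * cnj u * gauss_symbol \<alpha> f u)"
    "(\<lambda>u. of_real \<alpha> * cnj u * gauss_symbol \<alpha> f u) \<in> L2 lebesgue"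
    by (rule gaussian_bound_L1_L2[OF a _ b1]; measurable)+
qed

lemma gauss_symbol_cancel: "\<alpha> > 0 \<Longrightarrow> gauss_symbol \<alpha> f u = gauss_symbol \<alpha> g u \<longleftrightarrow> f u = g u"
  by (simp add: gauss_symbol_def)

text \<open>In the exponent, the terms \<open>\<alpha> u cnj w\<close> from the kernel and \<open>- \<alpha> w cnj u\<close> from the evaluation at
  \<open>- w\<close> add up to a purely imaginary number.\<close>
lemma toeplitz_kernel_antidiagonal:
  "toeplitz \<alpha> f (fock_kernel \<alpha> w) (- w) = fourier_L1 \<alpha> (gauss_symbol \<alpha> f) w"
proof -
  have "of_real (\<alpha> / pi) * (f u * fock_kernel \<alpha> w u * exp (of_real \<alpha> * (- w) * cnj u - of_real (\<alpha> * (norm u)\<^sup>2)))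
      = gauss_symbol \<alpha> f u * exp (of_real \<alpha> * (u * cnj w - cnj u * w))" for u
  proof -
    have e: "of_real \<alpha> * u * cnj w + (of_real \<alpha> * (- w) * cnj u - of_real (\<alpha> * (norm u)\<^sup>2))
        = of_real (- \<alpha> * (norm u)\<^sup>2) + of_real \<alpha> * (u * cnj w - cnj u * w)"
      by (simp add: algebra_simps)
    have "fock_kernel \<alpha> w u * exp (of_real \<alpha> * (- w) * cnj u - of_real (\<alpha> * (norm u)\<^sup>2))
        = of_real (exp (- \<alpha> * (norm u)\<^sup>2)) * exp (of_real \<alpha> * (u * cnj w - cnj u * w))"
      unfolding fock_kernel_def exp_of_real[symmetric] exp_add[symmetric] e ..
    then show ?thesis unfolding gauss_symbol_def of_real_mult by (simp only: mult_ac)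
  qed
  then show ?thesis
    unfolding toeplitz_def fourier_L1_def integral_mult_right_zero[symmetric] by (simp only:)
qed

lemma toeplitz_kernel_deriv_antidiagonal:
  assumes a: "\<alpha> > 0" and f: "f \<in> Linf lebesgue"
  shows "deriv (toeplitz \<alpha> f (fock_kernel \<alpha> w)) (- w) = fourier_L1 \<alpha> (\<lambda>u. of_real \<alpha> * cnj u * gauss_symbol \<alpha> f u) w"
proof -
  have "(of_real \<alpha> * cnj u * (f u * (fock_kernel \<alpha> w u * fock_weight \<alpha> u) * cnj (fock_weight \<alpha> u))) * exp (of_real \<alpha> * (- w) * cnj u)
      = of_real \<alpha> * cnj u * gauss_symbol \<alpha> f u * exp (of_real \<alpha> * (u * cnj w - cnj u * w))" for u
  proof -
    have e: "of_real \<alpha> * u * cnj w + of_real \<alpha> * (- w) * cnj u = of_real \<alpha> * (u * cnj w - cnj u * w)"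
      by (simp add: algebra_simps)
    have "fock_kernel \<alpha> w u * exp (of_real \<alpha> * (- w) * cnj u) = exp (of_real \<alpha> * (u * cnj w - cnj u * w))"
      unfolding fock_kernel_def exp_add[symmetric] e ..
    moreover have "(of_real \<alpha> * cnj u * (f u * (fock_kernel \<alpha> w u * fock_weight \<alpha> u) * cnj (fock_weight \<alpha> u))) * exp (of_real \<alpha> * (- w) * cnj u)
       = of_real \<alpha> * cnj u * ((fock_weight \<alpha> u * cnj (fock_weight \<alpha> u)) * f u) * (fock_kernel \<alpha> w u * exp (of_real \<alpha> * (- w) * cnj u))"
      by (simp only: mult_ac)
    ultimately show ?thesis unfolding gauss_symbol_def fock_weight_sq(2)[OF a] by (simp only:)
  qed
  then show ?thesis
    using DERIV_imp_deriv[OF toeplitz_has_derivative[OF a f fock_kernel_in_fock[OF a, of w], of "- w"]]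
    unfolding fourier_L1_def by (simp only:)
qed

section \<open>Recovering the symbol\<close>

lemma fock_bounded_operatorD:
  assumes "fock_bounded_operator \<alpha> A"
  shows "\<And>h. h \<in> fock_space \<alpha> \<Longrightarrow> A h \<in> fock_space \<alpha>"
    and "\<And>h k. h \<in> fock_space \<alpha> \<Longrightarrow> k \<in> fock_space \<alpha> \<Longrightarrow> A (\<lambda>z. h z + k z) = (\<lambda>z. A h z + A k z)"
    and "\<And>c h. h \<in> fock_space \<alpha> \<Longrightarrow> A (\<lambda>z. c * h z) = (\<lambda>z. c * A h z)"
    and "\<exists>C. \<forall>h\<in>fock_space \<alpha>. fock_norm \<alpha> (A h) \<le> C * fock_norm \<alpha> h"
  using assms unfolding fock_bounded_operator_def by blast+

text \<open>Point evaluations on the Fock space are bounded, locally uniformly in the point. So the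
  two criteria become statements about one holomorphic family of bounded functionals.\<close>
lemma operator_minus_toeplitz_family:
  assumes a: "\<alpha> > 0" and A: "fock_bounded_operator \<alpha> A" and f: "f \<in> Linf lebesgue"
  obtains C where "\<And>R z. norm z \<le> R \<Longrightarrow> fock_functional \<alpha> (C R) (\<lambda>h. A h z - toeplitz \<alpha> f h z)"
    and "\<And>h. h \<in> fock_space \<alpha> \<Longrightarrow> (\<lambda>z. A h z - toeplitz \<alpha> f h z) holomorphic_on UNIV"
proof -
  note A' = fock_bounded_operatorD[OF A]
  obtain K where K: "\<And>h. h \<in> fock_space \<alpha> \<Longrightarrow> fock_norm \<alpha> (A h) \<le> K * fock_norm \<alpha> h" using A'(4) by blast
  obtain B where B: "B \<ge> 0" "AE u in lebesgue. norm (f u) \<le> B" using f by (rule LinfE)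
  define C where "C R = (\<bar>K\<bar> + B) * exp (\<alpha> / 2 * R\<^sup>2)" for R
  have "fock_functional \<alpha> (C R) (\<lambda>h. A h z - toeplitz \<alpha> f h z)" if z: "norm z \<le> R" for R z
    unfolding fock_functional_def
  proof (intro conjI ballI allI)
    fix h assume h: "h \<in> fock_space \<alpha>"
    show "A (\<lambda>z. h z + k z) z - toeplitz \<alpha> f (\<lambda>z. h z + k z) z = A h z - toeplitz \<alpha> f h z + (A k z - toeplitz \<alpha> f k z)"
      if "k \<in> fock_space \<alpha>" for k
      by (simp add: A'(2)[OF h that] toeplitz_add[OF a f h that])
    show "A (\<lambda>z. c * h z) z - toeplitz \<alpha> f (\<lambda>z. c * h z) z = c * (A h z - toeplitz \<alpha> f h z)" for c
      by (simp add: A'(3)[OF h] toeplitz_cmult right_diff_distrib)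
    have e: "exp (\<alpha> / 2 * (norm z)\<^sup>2) \<le> exp (\<alpha> / 2 * R\<^sup>2)"
      using a z by (simp add: power_mono)
    have "fock_norm \<alpha> (A h) \<le> \<bar>K\<bar> * fock_norm \<alpha> h"
      using K[OF h] mult_right_mono[OF abs_ge_self[of K] fock_norm_nonneg[of \<alpha> h]] by linarith
    then have "norm (A h z) \<le> \<bar>K\<bar> * fock_norm \<alpha> h * exp (\<alpha> / 2 * (norm z)\<^sup>2)"
      by (intro order_trans[OF fock_eval_bound[OF a A'(1)[OF h]]] mult_right_mono) auto
    moreover have "norm (toeplitz \<alpha> f h z) \<le> B * fock_norm \<alpha> h * exp (\<alpha> / 2 * (norm z)\<^sup>2)"
      by (rule toeplitz_bound[OF a B f h])
    ultimately have "norm (A h z - toeplitz \<alpha> f h z) \<le> (\<bar>K\<bar> + B) * fock_norm \<alpha> h * exp (\<alpha> / 2 * (norm z)\<^sup>2)"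
      using norm_triangle_ineq4[of "A h z" "toeplitz \<alpha> f h z"] by (simp add: distrib_right)
    also have "\<dots> \<le> (\<bar>K\<bar> + B) * fock_norm \<alpha> h * exp (\<alpha> / 2 * R\<^sup>2)"
      using B(1) fock_norm_nonneg by (intro mult_left_mono e) auto
    finally show "norm (A h z - toeplitz \<alpha> f h z) \<le> C R * fock_norm \<alpha> h" by (simp add: C_def mult_ac)
  qed
  moreover have "(\<lambda>z. A h z - toeplitz \<alpha> f h z) holomorphic_on UNIV" if "h \<in> fock_space \<alpha>" for h
    using fock_holomorphic[OF A'(1)[OF that]] toeplitz_holomorphic[OF a f that] by (intro holomorphic_intros)
  ultimately show ?thesis by (rule that)
qed

lemma canonical_kernel_eq:
  assumes "\<alpha> > 0" "fock_bounded_operator \<alpha> A"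
  shows "canonical_kernel \<alpha> A w z = A (fock_kernel \<alpha> w) z"
  unfolding canonical_kernel_def
  by (intro fock_reproducing assms fock_bounded_operatorD(1)[OF assms(2)] fock_kernel_in_fock)

lemma H0_toeplitz:
  assumes a: "\<alpha> > 0" and A: "fock_bounded_operator \<alpha> A" and T: "is_toeplitz \<alpha> A f"
  shows "H0 \<alpha> A w = fourier_L1 \<alpha> (gauss_symbol \<alpha> f) w"
  using T fock_kernel_in_fock[OF a, of w]
  by (simp add: H0_def canonical_kernel_eq[OF a A] is_toeplitz_def toeplitz_kernel_antidiagonal)

lemma H1_toeplitz:
  assumes a: "\<alpha> > 0" and A: "fock_bounded_operator \<alpha> A" and f: "f \<in> Linf lebesgue" and T: "is_toeplitz \<alpha> A f"
  shows "H1 \<alpha> A w = fourier_L1 \<alpha> (\<lambda>u. of_real \<alpha> * cnj u * gauss_symbol \<alpha> f u) w"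
proof -
  have "A (fock_kernel \<alpha> w) = toeplitz \<alpha> f (fock_kernel \<alpha> w)"
    using T fock_kernel_in_fock[OF a] unfolding is_toeplitz_def by blast
  then show ?thesis
    unfolding H1_def canonical_kernel_eq[OF a A] by (simp add: toeplitz_kernel_deriv_antidiagonal[OF a f])
qed

lemma is_toeplitz_of_H0:
  assumes a: "\<alpha> > 0" and A: "fock_bounded_operator \<alpha> A" and f: "f \<in> Linf lebesgue"
    and H: "AE w in lebesgue. H0 \<alpha> A w = fourier_L1 \<alpha> (gauss_symbol \<alpha> f) w"
  shows "is_toeplitz \<alpha> A f"
proof -
  obtain C where C: "\<And>R z. norm z \<le> R \<Longrightarrow> fock_functional \<alpha> (C R) (\<lambda>h. A h z - toeplitz \<alpha> f h z)"
    and hol: "\<And>h. h \<in> fock_space \<alpha> \<Longrightarrow> (\<lambda>z. A h z - toeplitz \<alpha> f h z) holomorphic_on UNIV"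
    using operator_minus_toeplitz_family[OF a A f] by blast
  have zero: "AE w in lebesgue. A (fock_kernel \<alpha> w) (- w) - toeplitz \<alpha> f (fock_kernel \<alpha> w) (- w) = 0"
    using H by eventually_elim (simp add: H0_def canonical_kernel_eq[OF a A] toeplitz_kernel_antidiagonal)
  have "A h z - toeplitz \<alpha> f h z = 0" if "h \<in> fock_space \<alpha>" for h z
    using a C hol zero that
    by (rule fock_family_zero[where M="\<lambda>z h. A h z - toeplitz \<alpha> f h z"])
  then show ?thesis unfolding is_toeplitz_def by (auto simp: fun_eq_iff)
qed

text \<open>The difference \<open>A h - T\<^sub>f h\<close> has derivative 0 by the same argument, applied to the family of
  derivatives; the hypothesis at the origin fixes the constant.\<close>
lemma is_toeplitz_of_H1:
  assumes a: "\<alpha> > 0" and A: "fock_bounded_operator \<alpha> A" and f: "f \<in> Linf lebesgue"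
    and H: "AE w in lebesgue. H1 \<alpha> A w = fourier_L1 \<alpha> (\<lambda>u. of_real \<alpha> * cnj u * gauss_symbol \<alpha> f u) w"
    and origin: "\<And>h. h \<in> fock_space \<alpha> \<Longrightarrow> A h 0 = toeplitz \<alpha> f h 0"
  shows "is_toeplitz \<alpha> A f"
proof -
  obtain C where C: "\<And>R z. norm z \<le> R \<Longrightarrow> fock_functional \<alpha> (C R) (\<lambda>h. A h z - toeplitz \<alpha> f h z)"
    and hol: "\<And>h. h \<in> fock_space \<alpha> \<Longrightarrow> (\<lambda>z. A h z - toeplitz \<alpha> f h z) holomorphic_on UNIV"
    using operator_minus_toeplitz_family[OF a A f] by blast
  have dhol: "(\<lambda>z. deriv (\<lambda>z. A h z - toeplitz \<alpha> f h z) z) holomorphic_on UNIV" if "h \<in> fock_space \<alpha>" for h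
    using hol[OF that] by (rule holomorphic_deriv) simp
  have "deriv (\<lambda>z. A h z - toeplitz \<alpha> f h z) z = deriv (A h) z - deriv (toeplitz \<alpha> f h) z" if "h \<in> fock_space \<alpha>" for h z
    using fock_holomorphic[OF fock_bounded_operatorD(1)[OF A that]] toeplitz_holomorphic[OF a f that]
    by (intro deriv_diff) (auto intro: holomorphic_on_imp_differentiable_at)
  then have zero: "AE w in lebesgue. deriv (\<lambda>z. A (fock_kernel \<alpha> w) z - toeplitz \<alpha> f (fock_kernel \<alpha> w) z) (- w) = 0"
    using H
    by (auto simp: H1_def canonical_kernel_eq[OF a A] toeplitz_kernel_deriv_antidiagonal[OF a f] fock_kernel_in_fock[OF a])
  have dC: "fock_functional \<alpha> (C (R + 1)) (\<lambda>h. deriv (\<lambda>z. A h z - toeplitz \<alpha> f h z) z)" if "norm z \<le> R" for R z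
    using a C hol that by (rule fock_family_deriv[where M="\<lambda>z h. A h z - toeplitz \<alpha> f h z"])
  have d0: "deriv (\<lambda>z. A h z - toeplitz \<alpha> f h z) z = 0" if "h \<in> fock_space \<alpha>" for h z
    using a dC dhol zero that
    by (rule fock_family_zero[where M="\<lambda>z h. deriv (\<lambda>z. A h z - toeplitz \<alpha> f h z) z"])
  have "A h z - toeplitz \<alpha> f h z = 0" if h: "h \<in> fock_space \<alpha>" for h z
  proof -
    have "((\<lambda>z. A h z - toeplitz \<alpha> f h z) has_field_derivative 0) (at z)" for z
      using holomorphic_derivI[OF hol[OF h], of z] d0[OF h] by simp
    then have "A h z - toeplitz \<alpha> f h z = A h 0 - toeplitz \<alpha> f h 0"
      using has_field_derivative_zero_constant[of UNIV "\<lambda>z. A h z - toeplitz \<alpha> f h z"] by auto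
    then show ?thesis using origin[OF h] by simp
  qed
  then show ?thesis unfolding is_toeplitz_def by (auto simp: fun_eq_iff)
qed

lemma gauss_symbol_symbol0:
  assumes "\<alpha> > 0"
  shows "gauss_symbol \<alpha> (symbol0 \<alpha> A) u = fourier_L2_inv \<alpha> (H0 \<alpha> A) u"
proof -
  have "of_real (\<alpha> / pi * exp (- \<alpha> * (norm u)\<^sup>2)) * of_real (pi / \<alpha> * exp (\<alpha> * (norm u)\<^sup>2)) = (1 :: complex)"
    unfolding of_real_mult[symmetric] using assms by (simp add: exp_minus)
  then show ?thesis unfolding gauss_symbol_def symbol0_def mult.assoc[symmetric] by (simp only: mult_1_left)
qed

lemma gauss_symbol_symbol1:
  assumes "\<alpha> > 0" "u \<noteq> 0"
  shows "of_real \<alpha> * cnj u * gauss_symbol \<alpha> (symbol1 \<alpha> A) u = fourier_L2_inv \<alpha> (H1 \<alpha> A) u"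
proof -
  have "of_real \<alpha> * of_real (\<alpha> / pi * exp (- \<alpha> * (norm u)\<^sup>2)) * of_real (pi / \<alpha>\<^sup>2 * exp (\<alpha> * (norm u)\<^sup>2)) = (1 :: complex)"
    unfolding of_real_mult[symmetric] using assms(1) by (simp add: exp_minus power2_eq_square)
  moreover have "of_real \<alpha> * cnj u * gauss_symbol \<alpha> (symbol1 \<alpha> A) u
      = (of_real \<alpha> * of_real (\<alpha> / pi * exp (- \<alpha> * (norm u)\<^sup>2)) * of_real (pi / \<alpha>\<^sup>2 * exp (\<alpha> * (norm u)\<^sup>2)))
        * (cnj u * (1 / cnj u)) * fourier_L2_inv \<alpha> (H1 \<alpha> A) u"
    unfolding gauss_symbol_def symbol1_def by (simp only: mult_ac)
  moreover have "cnj u * (1 / cnj u) = 1" using assms(2) by simp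
  ultimately show ?thesis by (simp only: mult_1_left)
qed

lemma symbol0_of_toeplitz:
  assumes a: "\<alpha> > 0" and A: "fock_bounded_operator \<alpha> A" and f: "f \<in> Linf lebesgue" and T: "is_toeplitz \<alpha> A f"
  shows "H0 \<alpha> A \<in> L2 lebesgue" "symbol0 \<alpha> A \<in> Linf lebesgue" "AE u in lebesgue. symbol0 \<alpha> A u = f u"
proof -
  have H: "H0 \<alpha> A = fourier_L1 \<alpha> (gauss_symbol \<alpha> f)" by (rule ext) (rule H0_toeplitz[OF a A T])
  show H2: "H0 \<alpha> A \<in> L2 lebesgue"
    unfolding H by (rule fourier_L1_in_L2[OF a gauss_symbol_L1_L2(1,2)[OF a f]])
  have "AE u in lebesgue. fourier_L2_inv \<alpha> (H0 \<alpha> A) u = gauss_symbol \<alpha> f u"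
    unfolding fourier_L2_inv_eq_iff[OF a H2 gauss_symbol_L1_L2(1,2)[OF a f]] using H by simp
  then show ae: "AE u in lebesgue. symbol0 \<alpha> A u = f u"
    by eventually_elim (simp add: gauss_symbol_symbol0[OF a, symmetric] gauss_symbol_cancel[OF a])
  have [measurable]: "fourier_L2_inv \<alpha> (H0 \<alpha> A) \<in> borel_measurable lebesgue"
    using fourier_L2_inv_limit(1)[OF a H2] by (rule L2_measurable)
  have "symbol0 \<alpha> A \<in> borel_measurable lebesgue" unfolding symbol0_def by measurable
  then show "symbol0 \<alpha> A \<in> Linf lebesgue" by (rule Linf_cong_AE[OF f _ ae])
qed

lemma symbol1_of_toeplitz:
  assumes a: "\<alpha> > 0" and A: "fock_bounded_operator \<alpha> A" and f: "f \<in> Linf lebesgue" and T: "is_toeplitz \<alpha> A f"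
  shows "H1 \<alpha> A \<in> L2 lebesgue" "symbol1 \<alpha> A \<in> Linf lebesgue" "AE u in lebesgue. symbol1 \<alpha> A u = f u"
proof -
  have H: "H1 \<alpha> A = fourier_L1 \<alpha> (\<lambda>u. of_real \<alpha> * cnj u * gauss_symbol \<alpha> f u)"
    by (rule ext) (rule H1_toeplitz[OF a A f T])
  show H2: "H1 \<alpha> A \<in> L2 lebesgue"
    unfolding H by (rule fourier_L1_in_L2[OF a gauss_symbol_L1_L2(3,4)[OF a f]])
  have "AE u in lebesgue. fourier_L2_inv \<alpha> (H1 \<alpha> A) u = of_real \<alpha> * cnj u * gauss_symbol \<alpha> f u"
    unfolding fourier_L2_inv_eq_iff[OF a H2 gauss_symbol_L1_L2(3,4)[OF a f]] using H by simp
  with AE_lebesgue_neq[of 0] show ae: "AE u in lebesgue. symbol1 \<alpha> A u = f u"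
  proof eventually_elim
    case (elim u)
    then have "of_real \<alpha> * cnj u * gauss_symbol \<alpha> (symbol1 \<alpha> A) u = of_real \<alpha> * cnj u * gauss_symbol \<alpha> f u"
      using gauss_symbol_symbol1[OF a, of u A] by simp
    then show ?case using elim(1) a gauss_symbol_cancel[OF a] by simp
  qed
  have [measurable]: "fourier_L2_inv \<alpha> (H1 \<alpha> A) \<in> borel_measurable lebesgue"
    using fourier_L2_inv_limit(1)[OF a H2] by (rule L2_measurable)
  have [measurable]: "cnj \<in> borel_measurable lebesgue" by (rule borel_measurable_lebesgueI) simp
  have "symbol1 \<alpha> A \<in> borel_measurable lebesgue" unfolding symbol1_def by measurable
  then show "symbol1 \<alpha> A \<in> Linf lebesgue" by (rule Linf_cong_AE[OF f _ ae])
qed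

lemma is_toeplitz_symbol0:
  assumes a: "\<alpha> > 0" and A: "fock_bounded_operator \<alpha> A"
    and H: "H0 \<alpha> A \<in> L2 lebesgue" and f: "symbol0 \<alpha> A \<in> Linf lebesgue"
  shows "is_toeplitz \<alpha> A (symbol0 \<alpha> A)"
proof (rule is_toeplitz_of_H0[OF a A f])
  show "AE w in lebesgue. H0 \<alpha> A w = fourier_L1 \<alpha> (gauss_symbol \<alpha> (symbol0 \<alpha> A)) w"
    unfolding fourier_L2_inv_eq_iff[OF a H gauss_symbol_L1_L2(1,2)[OF a f], symmetric]
    by (simp add: gauss_symbol_symbol0[OF a])
qed

lemma is_toeplitz_symbol1:
  assumes a: "\<alpha> > 0" and A: "fock_bounded_operator \<alpha> A"
    and H: "H1 \<alpha> A \<in> L2 lebesgue" and f: "symbol1 \<alpha> A \<in> Linf lebesgue"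
    and origin: "\<And>h. h \<in> fock_space \<alpha> \<Longrightarrow> A h 0 = toeplitz \<alpha> (symbol1 \<alpha> A) h 0"
  shows "is_toeplitz \<alpha> A (symbol1 \<alpha> A)"
proof (rule is_toeplitz_of_H1[OF a A f _ origin])
  show "AE w in lebesgue. H1 \<alpha> A w = fourier_L1 \<alpha> (\<lambda>u. of_real \<alpha> * cnj u * gauss_symbol \<alpha> (symbol1 \<alpha> A) u) w"
    unfolding fourier_L2_inv_eq_iff[OF a H gauss_symbol_L1_L2(3,4)[OF a f], symmetric]
    using AE_lebesgue_neq[of 0] by eventually_elim (simp add: gauss_symbol_symbol1[OF a])
qed

lemma toeplitz_symbol_unique:
  assumes "\<alpha> > 0" "fock_bounded_operator \<alpha> A" "f \<in> Linf lebesgue" "g \<in> Linf lebesgue"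
    and "is_toeplitz \<alpha> A f" "is_toeplitz \<alpha> A g"
  shows "AE u in lebesgue. f u = g u"
  using symbol0_of_toeplitz(3)[OF assms(1,2,3,5)] symbol0_of_toeplitz(3)[OF assms(1,2,4,6)]
  by eventually_elim simp

theorem theorem1p1:
  fixes \<alpha> :: real
    and A :: "(complex \<Rightarrow> complex) \<Rightarrow> (complex \<Rightarrow> complex)"
  assumes "\<alpha> > 0"
    and "fock_bounded_operator \<alpha> A"
  shows
    "(((\<exists>f\<in>Linf lebesgue. is_toeplitz \<alpha> A f) \<longleftrightarrow>
         H0 \<alpha> A \<in> L2 lebesgue \<and> symbol0 \<alpha> A \<in> Linf lebesgue) \<and>
      ((\<exists>f\<in>Linf lebesgue. is_toeplitz \<alpha> A f) \<longrightarrow>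
         is_toeplitz \<alpha> A (symbol0 \<alpha> A) \<and>
         (\<forall>f\<in>Linf lebesgue. \<forall>g\<in>Linf lebesgue.
            is_toeplitz \<alpha> A f \<and> is_toeplitz \<alpha> A g \<longrightarrow> (AE u in lebesgue. f u = g u)))) \<and>
     (((\<exists>f\<in>Linf lebesgue. is_toeplitz \<alpha> A f) \<longleftrightarrow>
         H1 \<alpha> A \<in> L2 lebesgue \<and> symbol1 \<alpha> A \<in> Linf lebesgue \<and>
         (\<forall>h\<in>fock_space \<alpha>. A h 0 = toeplitz \<alpha> (symbol1 \<alpha> A) h 0)) \<and>
      ((\<exists>f\<in>Linf lebesgue. is_toeplitz \<alpha> A f) \<longrightarrow>
         is_toeplitz \<alpha> A (symbol1 \<alpha> A) \<and>
         (\<forall>f\<in>Linf lebesgue. \<forall>g\<in>Linf lebesgue.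
            is_toeplitz \<alpha> A f \<and> is_toeplitz \<alpha> A g \<longrightarrow> (AE u in lebesgue. f u = g u))))"
proof -
  note unique = toeplitz_symbol_unique[OF assms]
  have zero: "H0 \<alpha> A \<in> L2 lebesgue \<and> symbol0 \<alpha> A \<in> Linf lebesgue \<and> is_toeplitz \<alpha> A (symbol0 \<alpha> A)"
    and one: "H1 \<alpha> A \<in> L2 lebesgue \<and> symbol1 \<alpha> A \<in> Linf lebesgue \<and> is_toeplitz \<alpha> A (symbol1 \<alpha> A)"
    if "f \<in> Linf lebesgue" "is_toeplitz \<alpha> A f" for f
    using symbol0_of_toeplitz[OF assms that] symbol1_of_toeplitz[OF assms that]
      is_toeplitz_cong_AE[OF assms(1) that(2,1)] by auto
  have origin: "\<forall>h\<in>fock_space \<alpha>. A h 0 = toeplitz \<alpha> (symbol1 \<alpha> A) h 0" if "is_toeplitz \<alpha> A (symbol1 \<alpha> A)"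
    using that by (simp add: is_toeplitz_def)
  show ?thesis
    using zero one origin unique is_toeplitz_symbol0[OF assms] is_toeplitz_symbol1[OF assms]
    by (intro conjI iffI impI) blast+
qed

end
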